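(* Let $(S,\mathfrak{m},k)$ and $(T,\mathfrak{n},k)$ be local rings with common residue field $k$, with $S\neq k\neq T$, and let $R=S\times_k T$ be their fiber product over $k$. Let $M$ and $N$ be finitely generated $R$-modules with $\operatorname{Tor}^R_{2i+1}(M,N)=0=\operatorname{Tor}^R_{2j}(M,N)$ for some $i\geq 2$ and some $j\geq 3$. Then $\operatorname{pd}_R M\leq 1$ or $\operatorname{pd}_R N\leq 1$.
   Context: A local ring is a commutative Noetherian ring with a unique maximal ideal. With $\pi_S:S\to k$ and $\pi_T:T\to k$ the natural surjections onto the common residue field, the fiber product is the subring $R=S\times_k T=\{(s,t)\in S\times T : \pi_S(s)=\pi_T(t)\}$ of $S\times T$; it is a local ring with maximal ideal $\mathfrak{m}\times\mathfrak{n}$. $\operatorname{pd}_R$ denotes projective dimension over $R$. *)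

theory Defs
  imports "HOL-Algebra.Algebra" "HOL-Library.Extended_Nat"
begin

section \<open>Local rings and fiber products\<close>

locale local_ring = cring R + noetherian_ring R for R (structure) and \<mm> +
  assumes maximal: "maximalideal \<mm> R"
    and unique: "maximalideal J R \<Longrightarrow> J = \<mm>"

definition residue_map ::
    "('a, 'c) ring_scheme \<Rightarrow> 'a set \<Rightarrow> ('k, 'd) ring_scheme \<Rightarrow> ('a \<Rightarrow> 'k) \<Rightarrow> bool"
  where "residue_map R \<mm> k \<pi> \<longleftrightarrow>
    \<pi> \<in> ring_hom R k \<and> \<pi> ` carrier R = carrier k \<and> a_kernel R k \<pi> = \<mm>"

definition fiber_product ::
    "('s, 'c) ring_scheme \<Rightarrow> ('t, 'd) ring_scheme \<Rightarrow> ('s \<Rightarrow> 'k) \<Rightarrow> ('t \<Rightarrow> 'k) \<Rightarrow> ('s \<times> 't) ring"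
  where "fiber_product S T \<pi>S \<pi>T =
    (RDirProd S T)\<lparr>carrier := {(s, t). s \<in> carrier S \<and> t \<in> carrier T \<and> \<pi>S s = \<pi>T t}\<rparr>"

section \<open>Modules\<close>

text \<open>The record type of modules inherits the fields \<open>mult\<close> and \<open>one\<close> from rings; they play
  no role for modules and are left unspecified below.\<close>

definition module_hom :: "('a, 'r) ring_scheme \<Rightarrow> ('a, 'b) module \<Rightarrow> ('a, 'c) module \<Rightarrow> ('b \<Rightarrow> 'c) set"
  where "module_hom R M N = {h. h \<in> carrier M \<rightarrow> carrier N \<and>
    (\<forall>x \<in> carrier M. \<forall>y \<in> carrier M. h (x \<oplus>\<^bsub>M\<^esub> y) = h x \<oplus>\<^bsub>N\<^esub> h y) \<and>
    (\<forall>a \<in> carrier R. \<forall>x \<in> carrier M. h (a \<odot>\<^bsub>M\<^esub> x) = a \<odot>\<^bsub>N\<^esub> h x)}"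

definition span_of :: "('a, 'r) ring_scheme \<Rightarrow> ('a, 'b) module \<Rightarrow> 'b set \<Rightarrow> 'b set"
  where "span_of R M A = \<Inter>{H. submodule H R M \<and> A \<subseteq> H}"

definition finitely_generated :: "('a, 'r) ring_scheme \<Rightarrow> ('a, 'b) module \<Rightarrow> bool"
  where "finitely_generated R M \<longleftrightarrow>
    (\<exists>A. finite A \<and> A \<subseteq> carrier M \<and> span_of R M A = carrier M)"

definition quotient_module :: "('a, 'b) module \<Rightarrow> 'b set \<Rightarrow> ('a, 'b set) module"
  where "quotient_module M H =
    \<lparr>carrier = a_rcosets\<^bsub>M\<^esub> H, monoid.mult = undefined, one = undefined,
     ring.zero = H, ring.add = set_add M, smult = (\<lambda>a A. \<Union>x\<in>A. H +>\<^bsub>M\<^esub> (a \<odot>\<^bsub>M\<^esub> x))\<rparr>"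

text \<open>The free module with basis \<open>B\<close>: finitely supported functions, with support in \<open>B\<close>.\<close>

definition free_module :: "('a, 'r) ring_scheme \<Rightarrow> 'x set \<Rightarrow> ('a, 'x \<Rightarrow> 'a) module"
  where "free_module R B =
    \<lparr>carrier = {f. (\<forall>x. f x \<in> carrier R) \<and> finite {x. f x \<noteq> \<zero>\<^bsub>R\<^esub>} \<and> {x. f x \<noteq> \<zero>\<^bsub>R\<^esub>} \<subseteq> B},
     monoid.mult = undefined, one = undefined,
     ring.zero = (\<lambda>x. \<zero>\<^bsub>R\<^esub>), ring.add = (\<lambda>f g x. f x \<oplus>\<^bsub>R\<^esub> g x), smult = (\<lambda>a f x. a \<otimes>\<^bsub>R\<^esub> f x)\<rparr>"

definition basis_vector :: "('a, 'r) ring_scheme \<Rightarrow> 'x \<Rightarrow> 'x \<Rightarrow> 'a"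
  where "basis_vector R x = (\<lambda>y. if y = x then \<one>\<^bsub>R\<^esub> else \<zero>\<^bsub>R\<^esub>)"

text \<open>A module is projective iff it is a direct summand, i.e. a retract, of a free module.
  A basis taken from the element type of \<open>P\<close> loses no generality: if \<open>P\<close> is a retract of any
  free module, then it is one of the free module with basis \<open>carrier P\<close>.\<close>

definition projective_module :: "('a, 'r) ring_scheme \<Rightarrow> ('a, 'p) module \<Rightarrow> bool"
  where "projective_module R P \<longleftrightarrow> module R P \<and>
    (\<exists>(B :: 'p set) s r. s \<in> module_hom R P (free_module R B) \<and>
       r \<in> module_hom R (free_module R B) P \<and> (\<forall>x \<in> carrier P. r (s x) = x))"

section \<open>Tensor products\<close>

definition tensor_relations ::
    "('a, 'r) ring_scheme \<Rightarrow> ('a, 'b) module \<Rightarrow> ('a, 'c) module \<Rightarrow> ('b \<times> 'c \<Rightarrow> 'a) set"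
  where "tensor_relations R M N =
    (let F = free_module R (carrier M \<times> carrier N); e = (\<lambda>x y. basis_vector R (x, y)) in
      {e (x \<oplus>\<^bsub>M\<^esub> x') y \<ominus>\<^bsub>F\<^esub> (e x y \<oplus>\<^bsub>F\<^esub> e x' y) | x x' y.
         x \<in> carrier M \<and> x' \<in> carrier M \<and> y \<in> carrier N} \<union>
      {e x (y \<oplus>\<^bsub>N\<^esub> y') \<ominus>\<^bsub>F\<^esub> (e x y \<oplus>\<^bsub>F\<^esub> e x y') | x y y'.
         x \<in> carrier M \<and> y \<in> carrier N \<and> y' \<in> carrier N} \<union>
      {e (a \<odot>\<^bsub>M\<^esub> x) y \<ominus>\<^bsub>F\<^esub> a \<odot>\<^bsub>F\<^esub> e x y | a x y.
         a \<in> carrier R \<and> x \<in> carrier M \<and> y \<in> carrier N} \<union>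
      {e x (a \<odot>\<^bsub>N\<^esub> y) \<ominus>\<^bsub>F\<^esub> a \<odot>\<^bsub>F\<^esub> e x y | a x y.
         a \<in> carrier R \<and> x \<in> carrier M \<and> y \<in> carrier N})"

definition tensor_kernel ::
    "('a, 'r) ring_scheme \<Rightarrow> ('a, 'b) module \<Rightarrow> ('a, 'c) module \<Rightarrow> ('b \<times> 'c \<Rightarrow> 'a) set"
  where "tensor_kernel R M N =
    span_of R (free_module R (carrier M \<times> carrier N)) (tensor_relations R M N)"

definition tensor_module ::
    "('a, 'r) ring_scheme \<Rightarrow> ('a, 'b) module \<Rightarrow> ('a, 'c) module \<Rightarrow> ('a, ('b \<times> 'c \<Rightarrow> 'a) set) module"
  where "tensor_module R M N =
    quotient_module (free_module R (carrier M \<times> carrier N)) (tensor_kernel R M N)"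

definition pure_tensor ::
    "('a, 'r) ring_scheme \<Rightarrow> ('a, 'b) module \<Rightarrow> ('a, 'c) module \<Rightarrow> 'b \<Rightarrow> 'c \<Rightarrow> ('b \<times> 'c \<Rightarrow> 'a) set"
  where "pure_tensor R M N x y =
    tensor_kernel R M N +>\<^bsub>free_module R (carrier M \<times> carrier N)\<^esub> basis_vector R (x, y)"

text \<open>For \<open>f : M \<rightarrow> M'\<close>, the induced map of \<open>M \<otimes> N\<close> to \<open>M' \<otimes> N\<close>: the unique linear map
  sending each \<open>x \<otimes> y\<close> to \<open>f x \<otimes> y\<close>. Extensionality pins down its values outside the carrier.\<close>

definition tensor_map ::
    "('a, 'r) ring_scheme \<Rightarrow> ('a, 'b) module \<Rightarrow> ('a, 'd) module \<Rightarrow> ('a, 'c) module \<Rightarrow> ('b \<Rightarrow> 'd) \<Rightarrow>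
     ('b \<times> 'c \<Rightarrow> 'a) set \<Rightarrow> ('d \<times> 'c \<Rightarrow> 'a) set"
  where "tensor_map R M M' N f =
    (THE h. h \<in> module_hom R (tensor_module R M N) (tensor_module R M' N) \<and>
       h \<in> extensional (carrier (tensor_module R M N)) \<and>
       (\<forall>x \<in> carrier M. \<forall>y \<in> carrier N. h (pure_tensor R M N x y) = pure_tensor R M' N (f x) y))"

section \<open>Resolutions, Tor and projective dimension\<close>

text \<open>In all complexes below, \<open>d n\<close> is the differential from degree \<open>n + 1\<close> to degree \<open>n\<close>.\<close>

definition projective_resolution ::
    "('a, 'r) ring_scheme \<Rightarrow> ('a, 'm) module \<Rightarrow>
     (nat \<Rightarrow> ('a, 'p) module) \<Rightarrow> (nat \<Rightarrow> 'p \<Rightarrow> 'p) \<Rightarrow> ('p \<Rightarrow> 'm) \<Rightarrow> bool"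
  where "projective_resolution R M P d \<epsilon> \<longleftrightarrow>
    (\<forall>n. projective_module R (P n)) \<and>
    (\<forall>n. d n \<in> module_hom R (P (Suc n)) (P n)) \<and>
    \<epsilon> \<in> module_hom R (P 0) M \<and>
    \<epsilon> ` carrier (P 0) = carrier M \<and>
    d 0 ` carrier (P (Suc 0)) = {x \<in> carrier (P 0). \<epsilon> x = \<zero>\<^bsub>M\<^esub>} \<and>
    (\<forall>n. d (Suc n) ` carrier (P (Suc (Suc n))) = {x \<in> carrier (P (Suc n)). d n x = \<zero>\<^bsub>P n\<^esub>})"

fun cycles :: "(nat \<Rightarrow> ('a, 'c) module) \<Rightarrow> (nat \<Rightarrow> 'c \<Rightarrow> 'c) \<Rightarrow> nat \<Rightarrow> 'c set"
  where
    "cycles C d 0 = carrier (C 0)"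
  | "cycles C d (Suc n) = {x \<in> carrier (C (Suc n)). d n x = \<zero>\<^bsub>C n\<^esub>}"

definition homology_module ::
    "(nat \<Rightarrow> ('a, 'c) module) \<Rightarrow> (nat \<Rightarrow> 'c \<Rightarrow> 'c) \<Rightarrow> nat \<Rightarrow> ('a, 'c set) module"
  where "homology_module C d n =
    quotient_module ((C n)\<lparr>carrier := cycles C d n\<rparr>) (d n ` carrier (C (Suc n)))"

text \<open>HOL has no quantification over types inside a definition, so resolutions of a module with
  elements in \<open>'m\<close> over a ring with elements in \<open>'a\<close> are taken with elements in the following
  type. This is no restriction. The type \<open>('m \<times> 'a) list\<close> is infinite and at least as large as
  \<open>'m\<close> and \<open>'a\<close>; hence so are the carriers of free modules with basis in it, up to embedding, and
  every module with elements in \<open>'m\<close> has a free resolution \<open>P\<close> in this type. If its projective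
  dimension is at most \<open>n\<close>, then truncating \<open>P\<close> at the (projective) \<open>n\<close>-th syzygy, a submodule of
  \<open>P (n - 1)\<close>, gives a resolution of length \<open>n\<close> in the same type.\<close>

type_synonym ('a, 'm) resolution_element = "('m \<times> 'a) list \<Rightarrow> 'a"

definition chosen_resolution ::
    "('a, 'r) ring_scheme \<Rightarrow> ('a, 'm) module \<Rightarrow>
     (nat \<Rightarrow> ('a, ('a, 'm) resolution_element) module) \<times>
     (nat \<Rightarrow> ('a, 'm) resolution_element \<Rightarrow> ('a, 'm) resolution_element) \<times>
     (('a, 'm) resolution_element \<Rightarrow> 'm)"
  where "chosen_resolution R M = (SOME (P, d, \<epsilon>). projective_resolution R M P d \<epsilon>)"

definition Tor ::
    "('a, 'r) ring_scheme \<Rightarrow> nat \<Rightarrow> ('a, 'm) module \<Rightarrow> ('a, 'n) module \<Rightarrow>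
     ('a, (('a, 'm) resolution_element \<times> 'n \<Rightarrow> 'a) set set) module"
  where "Tor R n M N =
    (case chosen_resolution R M of (P, d, \<epsilon>) \<Rightarrow>
      homology_module (\<lambda>i. tensor_module R (P i) N)
        (\<lambda>i. tensor_map R (P (Suc i)) (P i) N (d i)) n)"

definition zero_module :: "('a, 'b) module \<Rightarrow> bool"
  where "zero_module M \<longleftrightarrow> carrier M = {\<zero>\<^bsub>M\<^esub>}"

text \<open>The projective dimension is \<open>\<infinity>\<close> if there is no finite projective resolution; that of the
  zero module is \<open>0\<close>.\<close>

definition proj_dim :: "('a, 'r) ring_scheme \<Rightarrow> ('a, 'm) module \<Rightarrow> enat"
  where "proj_dim R M = Inf {enat n | n.
    \<exists>(P :: nat \<Rightarrow> ('a, ('a, 'm) resolution_element) module) d \<epsilon>.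
      projective_resolution R M P d \<epsilon> \<and> (\<forall>i > n. zero_module (P i))}"

end

theory Submission
  imports Defs
begin

text \<open>The maximal ideal of \<open>R\<close> is \<open>I \<oplus> J\<close> with \<open>I = \<mm> \<times> 0\<close>, \<open>J = 0 \<times> \<nn>\<close> and \<open>I J = 0\<close>. Therefore a kernel of a
  map of free modules that lies in \<open>(I \<oplus> J) F\<close>, such as a second syzygy in a minimal resolution, is
  the direct sum of its parts in \<open>I F\<close> and \<open>J F\<close>, which are killed by \<open>J\<close> and \<open>I\<close> respectively.

  If \<open>C \<noteq> 0\<close> is killed by \<open>J\<close> and \<open>F\<close> is its minimal free cover, then the syzygy of \<open>C\<close> has the nonzero
  summand \<open>J F\<close>, which is killed by \<open>I\<close>. So if the second syzygy of \<open>N\<close> is nonzero, shifting dimensions on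
  the side of \<open>N\<close> turns the vanishing of \<open>Tor\<close> in one odd and one even degree into the vanishing of
  \<open>Tor\<^sub>3(M, C)\<close> for some \<open>C \<noteq> 0\<close> killed by \<open>J\<close> and also for some \<open>C \<noteq> 0\<close> killed by \<open>I\<close>.

  Say \<open>J C = 0\<close>, let \<open>K\<close> be the second syzygy of \<open>M\<close> and \<open>e\<close> a minimal generator of the cover of \<open>K\<close> that is
  mapped into the part of \<open>K\<close> killed by \<open>J\<close>. Then \<open>J e\<close> lies in the third syzygy, and \<open>z e \<otimes> c\<close>, for
  \<open>z \<in> J\<close> and a minimal generator \<open>c\<close> of \<open>C\<close>, is a nonzero element of \<open>Tor\<^sub>1(K, C) = Tor\<^sub>3(M, C)\<close>
  unless \<open>z\<close> is in the square of the maximal ideal. By Nakayama this excludes such an \<open>e\<close>; by symmetry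
  \<open>K = 0\<close>, so that \<open>M\<close> has projective dimension at most one.\<close>

text \<open>\<open>Tor\<close> is the homology of \<open>P \<otimes> N\<close> for an unspecified
  resolution \<open>P\<close> of \<open>M\<close>, but the shifts take place on the side of
  \<open>N\<close>. Neither balancing of \<open>Tor\<close> nor long exact sequences are developed:
  from the relations of \<open>N\<close> on, every module on that side is a submodule
  \<open>L\<close> of a finite free module, \<open>L \<otimes> P\<close> becomes the concrete
  complex \<open>LP\<close> inside a power of \<open>P\<close>, and each shift is a diagram chase
  with coordinate vectors. As \<open>P\<close> need not be minimal or even free, the last step
  compares it with a minimal free presentation of \<open>M\<close> by chain maps and a homotopy.

  The bounds on \<open>i\<close> and \<open>j\<close> count degrees. Passing to the second syzygy of
  \<open>N\<close> leaves the degrees \<open>2 * i - 1\<close> and \<open>2 * j - 2\<close>. Each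
  further shift lowers the degree by one and exchanges \<open>I\<close> and \<open>J\<close>. An
  even number of shifts leads from \<open>2 * i - 1\<close> to 3 and keeps the ideal; an odd number
  leads from \<open>2 * j - 2\<close> to 3 and exchanges it. So the two parities together reach
  degree 3 for both ideals.\<close>

lemma (in abelian_group) minus_add_cancel:
  assumes "x \<in> carrier G" "y \<in> carrier G"
  shows "(x \<ominus> y) \<oplus> y = x"
  using assms by (simp add: minus_eq a_assoc l_neg)

lemma (in abelian_group) minus_zero_iff:
  assumes "x \<in> carrier G" "y \<in> carrier G"
  shows "x \<ominus> y = \<zero> \<longleftrightarrow> x = y"
  using assms by (metis minus_add_cancel l_zero minus_eq r_neg)

section \<open>Linear maps between modules\<close>

lemma module_homI:
  assumes "\<And>x. x \<in> carrier M \<Longrightarrow> h x \<in> carrier N"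
    and "\<And>x y. x \<in> carrier M \<Longrightarrow> y \<in> carrier M \<Longrightarrow> h (x \<oplus>\<^bsub>M\<^esub> y) = h x \<oplus>\<^bsub>N\<^esub> h y"
    and "\<And>a x. a \<in> carrier R \<Longrightarrow> x \<in> carrier M \<Longrightarrow> h (a \<odot>\<^bsub>M\<^esub> x) = a \<odot>\<^bsub>N\<^esub> h x"
  shows "h \<in> module_hom R M N"
  using assms unfolding module_hom_def by auto

lemma module_homD:
  assumes "h \<in> module_hom R M N"
  shows "x \<in> carrier M \<Longrightarrow> h x \<in> carrier N"
    and "x \<in> carrier M \<Longrightarrow> y \<in> carrier M \<Longrightarrow> h (x \<oplus>\<^bsub>M\<^esub> y) = h x \<oplus>\<^bsub>N\<^esub> h y"
    and "a \<in> carrier R \<Longrightarrow> x \<in> carrier M \<Longrightarrow> h (a \<odot>\<^bsub>M\<^esub> x) = a \<odot>\<^bsub>N\<^esub> h x"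
  using assms unfolding module_hom_def by auto

lemma module_hom_comp:
  assumes "f \<in> module_hom R M N" "g \<in> module_hom R N K"
  shows "(\<lambda>x. g (f x)) \<in> module_hom R M K"
  using module_homD[OF assms(1)] module_homD[OF assms(2)] by (intro module_homI) auto

text \<open>Summing over the support of the coefficient vector avoids naming a basis: the same
  \<open>lin R V x\<close> acts on \<open>Free B\<close> for every \<open>B\<close>. With
  \<open>V = Free C\<close> it multiplies a row vector by the matrix with rows
  \<open>x b\<close>.\<close>

definition lin :: "('a, 'r) ring_scheme \<Rightarrow> ('a, 'b) module \<Rightarrow> ('x \<Rightarrow> 'b) \<Rightarrow> ('x \<Rightarrow> 'a) \<Rightarrow> 'b"
  where "lin R V x v = finsum V (\<lambda>b. smult V (v b) (x b)) {b. v b \<noteq> \<zero>\<^bsub>R\<^esub>}"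

context cring
begin

abbreviation Free :: "'x set \<Rightarrow> ('a, 'x \<Rightarrow> 'a) module" where "Free B \<equiv> free_module R B"

abbreviation Vec :: "'x set \<Rightarrow> ('x \<Rightarrow> 'a) set" where "Vec B \<equiv> carrier (Free B)"

abbreviation \<e> :: "'x \<Rightarrow> 'x \<Rightarrow> 'a" where "\<e> \<equiv> basis_vector R"

abbreviation Hom :: "('a, 'u) module \<Rightarrow> ('a, 'v) module \<Rightarrow> ('u \<Rightarrow> 'v) set" where "Hom \<equiv> module_hom R"

text \<open>The kernel of the matrix with rows \<open>G b\<close>, \<open>b \<in> B\<close>, acting on row vectors.\<close>

abbreviation Ker :: "'x set \<Rightarrow> 'y set \<Rightarrow> ('x \<Rightarrow> 'y \<Rightarrow> 'a) \<Rightarrow> ('x \<Rightarrow> 'a) set"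
  where "Ker B C G \<equiv> {v \<in> Vec B. lin R (Free C) G v = (\<lambda>_. \<zero>)}"

lemma module_hom_zero:
  assumes "module R M" "module R N" "h \<in> Hom M N"
  shows "h \<zero>\<^bsub>M\<^esub> = \<zero>\<^bsub>N\<^esub>"
proof -
  interpret M: module R M by fact
  interpret N: module R N by fact
  show ?thesis
    using module_homD(3)[OF assms(3), of \<zero> "\<zero>\<^bsub>M\<^esub>"] module_homD(1)[OF assms(3)] by simp
qed

lemma module_hom_minus:
  assumes "module R M" "module R N" "h \<in> Hom M N" "x \<in> carrier M" "y \<in> carrier M"
  shows "h (x \<ominus>\<^bsub>M\<^esub> y) = h x \<ominus>\<^bsub>N\<^esub> h y"
proof -
  interpret M: module R M by fact
  interpret N: module R N by fact
  have "h (x \<ominus>\<^bsub>M\<^esub> y) = h (x \<oplus>\<^bsub>M\<^esub> (\<ominus> \<one>) \<odot>\<^bsub>M\<^esub> y)"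
    using assms by (simp add: M.minus_eq M.smult_l_minus)
  also have "\<dots> = h x \<oplus>\<^bsub>N\<^esub> (\<ominus> \<one>) \<odot>\<^bsub>N\<^esub> h y"
    using assms module_homD[OF assms(3)] by simp
  also have "\<dots> = h x \<ominus>\<^bsub>N\<^esub> h y"
    using assms module_homD[OF assms(3)] by (simp add: N.minus_eq N.smult_l_minus)
  finally show ?thesis .
qed

lemma module_hom_finsum:
  assumes "module R M" "module R N" "h \<in> Hom M N" "finite A"
    "\<And>i. i \<in> A \<Longrightarrow> f i \<in> carrier M"
  shows "h (\<Oplus>\<^bsub>M\<^esub>i\<in>A. f i) = (\<Oplus>\<^bsub>N\<^esub>i\<in>A. h (f i))"
  using assms(4,5)
proof (induction A rule: finite_induct)
  case empty
  interpret M: module R M by fact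
  interpret N: module R N by fact
  show ?case using assms module_hom_zero by simp
next
  case (insert a A)
  interpret M: module R M by fact
  interpret N: module R N by fact
  show ?case
    using insert module_homD[OF assms(3)] by (simp add: Pi_def M.finsum_closed)
qed

lemma module_hom_add:
  assumes "module R M" "module R N" "f \<in> Hom M N" "g \<in> Hom M N"
  shows "(\<lambda>x. f x \<oplus>\<^bsub>N\<^esub> g x) \<in> Hom M N"
proof -
  interpret M: module R M by fact
  interpret N: module R N by fact
  show ?thesis
    using module_homD[OF assms(3)] module_homD[OF assms(4)]
    by (intro module_homI) (auto simp: N.a_ac N.smult_r_distr)
qed

lemma module_hom_diff:
  assumes "module R M" "module R N" "f \<in> Hom M N" "g \<in> Hom M N"
  shows "(\<lambda>x. f x \<ominus>\<^bsub>N\<^esub> g x) \<in> Hom M N"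
proof -
  interpret M: module R M by fact
  interpret N: module R N by fact
  have "(\<lambda>x. (\<ominus> \<one>) \<odot>\<^bsub>N\<^esub> g x) \<in> Hom M N"
    using module_homD[OF assms(4)]
    by (intro module_homI) (auto simp: N.smult_r_distr N.smult_assoc1[symmetric] m_comm)
  from module_hom_add[OF assms(1-3) this] have "(\<lambda>x. f x \<oplus>\<^bsub>N\<^esub> (\<ominus> \<one>) \<odot>\<^bsub>N\<^esub> g x) \<in> Hom M N" .
  moreover have "f x \<ominus>\<^bsub>N\<^esub> g x = f x \<oplus>\<^bsub>N\<^esub> (\<ominus> \<one>) \<odot>\<^bsub>N\<^esub> g x" if "x \<in> carrier M" for x
    using that module_homD[OF assms(4)] by (simp add: N.minus_eq N.smult_l_minus)
  ultimately show ?thesis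
    unfolding module_hom_def by (auto simp: Pi_def)
qed

lemma submodule_kernel:
  assumes "module R M" "module R N" "h \<in> Hom M N"
  shows "submodule {x \<in> carrier M. h x = \<zero>\<^bsub>N\<^esub>} R M"
proof -
  interpret M: module R M by fact
  interpret N: module R N by fact
  show ?thesis
  proof (rule M.submoduleI)
    fix a assume "a \<in> {x \<in> carrier M. h x = \<zero>\<^bsub>N\<^esub>}"
    then show "\<ominus>\<^bsub>M\<^esub> a \<in> {x \<in> carrier M. h x = \<zero>\<^bsub>N\<^esub>}"
      using module_hom_minus[OF assms, of "\<zero>\<^bsub>M\<^esub>" a] module_hom_zero[OF assms]
      by (auto simp: M.minus_eq N.minus_eq)
  qed (use module_homD[OF assms(3)] module_hom_zero[OF assms] in auto)
qed

lemma submodule_image: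
  assumes "module R M" "module R N" "h \<in> Hom M N"
  shows "submodule (h ` carrier M) R N"
proof -
  interpret M: module R M by fact
  interpret N: module R N by fact
  show ?thesis
  proof (rule N.submoduleI)
    show "h ` carrier M \<subseteq> carrier N" using module_homD[OF assms(3)] by auto
    show "\<zero>\<^bsub>N\<^esub> \<in> h ` carrier M" using module_hom_zero[OF assms] by (metis M.zero_closed imageI)
  next
    fix a assume "a \<in> h ` carrier M"
    then obtain x where "x \<in> carrier M" "a = h x" by auto
    then show "\<ominus>\<^bsub>N\<^esub> a \<in> h ` carrier M"
      using module_hom_minus[OF assms, of "\<zero>\<^bsub>M\<^esub>" x] module_hom_zero[OF assms] module_homD[OF assms(3)]
      by (auto simp: M.minus_eq N.minus_eq intro!: image_eqI[of _ _ "\<ominus>\<^bsub>M\<^esub> x"])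
  next
    fix a b assume "a \<in> h ` carrier M" "b \<in> h ` carrier M"
    then show "a \<oplus>\<^bsub>N\<^esub> b \<in> h ` carrier M"
      using module_homD[OF assms(3)] by (smt (verit) M.a_closed imageE image_eqI)
  next
    fix a b assume "a \<in> carrier R" "b \<in> h ` carrier M"
    then show "a \<odot>\<^bsub>N\<^esub> b \<in> h ` carrier M"
      using module_homD[OF assms(3)] by (smt (verit) M.smult_closed imageE image_eqI)
  qed
qed

lemma submodule_zero_closed:
  assumes "module R M" "submodule H R M"
  shows "\<zero>\<^bsub>M\<^esub> \<in> H"
  using subgroup.one_closed[OF submodule.axioms(1)[OF assms(2)]] by simp

lemma submodule_minus:
  assumes "module R M" "submodule H R M" "x \<in> H" "y \<in> H"
  shows "x \<ominus>\<^bsub>M\<^esub> y \<in> H"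
  using module.submoduleE[OF assms(1,2)] assms(3,4) by (simp add: a_minus_def)

lemma submodule_finsum:
  assumes "module R M" "submodule H R M" "finite A" "\<And>i. i \<in> A \<Longrightarrow> f i \<in> H"
  shows "(\<Oplus>\<^bsub>M\<^esub>i\<in>A. f i) \<in> H"
  using assms(3,4)
proof (induction A rule: finite_induct)
  case empty
  interpret M: module R M by fact
  show ?case using submodule_zero_closed[OF assms(1,2)] by simp
next
  case (insert a A)
  interpret M: module R M by fact
  have "f i \<in> carrier M" if "i \<in> insert a A" for i
    using that insert M.submoduleE(1)[OF assms(2)] by auto
  then show ?case
    using insert M.submoduleE[OF assms(2)] by (simp add: Pi_def)
qed

subsection \<open>Free modules\<close>

lemma free_carrier:
  "f \<in> Vec B \<longleftrightarrow>
    (\<forall>x. f x \<in> carrier R) \<and> finite {x. f x \<noteq> \<zero>} \<and> {x. f x \<noteq> \<zero>} \<subseteq> B"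
  by (simp add: free_module_def)

lemma free_simps [simp]:
  "f \<oplus>\<^bsub>Free B\<^esub> g = (\<lambda>x. f x \<oplus> g x)"
  "\<zero>\<^bsub>Free B\<^esub> = (\<lambda>x. \<zero>)"
  "a \<odot>\<^bsub>Free B\<^esub> f = (\<lambda>x. a \<otimes> f x)"
  by (simp_all add: free_module_def)

lemma free_closed: "f \<in> Vec B \<Longrightarrow> f x \<in> carrier R"
  by (simp add: free_carrier)

lemma free_outside: "f \<in> Vec B \<Longrightarrow> x \<notin> B \<Longrightarrow> f x = \<zero>"
  by (auto simp: free_carrier)

lemma free_finiteI:
  assumes "finite B" "\<And>x. f x \<in> carrier R" "\<And>x. x \<notin> B \<Longrightarrow> f x = \<zero>"
  shows "f \<in> Vec B"
  using assms by (auto simp: free_carrier intro: finite_subset[of _ B])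

lemma module_free: "module R (Free B)"
proof (rule moduleI)
  show "abelian_group (Free B)"
  proof (rule abelian_groupI)
    fix f assume f: "f \<in> Vec B"
    then have "(\<lambda>x. \<ominus> f x) \<in> Vec B"
      unfolding free_carrier by (auto intro: rev_finite_subset)
    moreover have "(\<lambda>x. \<ominus> f x \<oplus> f x) = (\<lambda>x. \<zero>)"
      using free_closed[OF f] by (simp add: l_neg)
    ultimately show "\<exists>y\<in>Vec B. y \<oplus>\<^bsub>Free B\<^esub> f = \<zero>\<^bsub>Free B\<^esub>"
      by auto
  next
    fix f g assume "f \<in> Vec B" "g \<in> Vec B"
    moreover have "{x. f x \<oplus> g x \<noteq> \<zero>} \<subseteq> {x. f x \<noteq> \<zero>} \<union> {x. g x \<noteq> \<zero>}" by auto
    ultimately show "f \<oplus>\<^bsub>Free B\<^esub> g \<in> Vec B"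
      by (auto simp: free_carrier intro: finite_subset)
  qed (auto simp: free_carrier a_ac)
next
  fix a f assume "a \<in> carrier R" "f \<in> Vec B"
  moreover have "{x. a \<otimes> f x \<noteq> \<zero>} \<subseteq> {x. f x \<noteq> \<zero>}" using \<open>a \<in> carrier R\<close> by auto
  ultimately show "a \<odot>\<^bsub>Free B\<^esub> f \<in> Vec B"
    by (auto simp: free_carrier intro: finite_subset)
qed (auto simp: free_carrier l_distr r_distr m_assoc is_cring)

lemma free_minus:
  assumes "f \<in> Vec B" "g \<in> Vec B"
  shows "f \<ominus>\<^bsub>Free B\<^esub> g = (\<lambda>x. f x \<ominus> g x)"
proof -
  interpret F: module R "Free B" by (rule module_free)
  have "f \<ominus>\<^bsub>Free B\<^esub> g = f \<oplus>\<^bsub>Free B\<^esub> (\<ominus> \<one>) \<odot>\<^bsub>Free B\<^esub> g"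
    using assms F.smult_l_minus[of \<one> g] by (simp add: F.minus_eq del: free_simps)
  also have "\<dots> = (\<lambda>x. f x \<ominus> g x)"
    using assms[THEN free_closed] by (auto simp: minus_eq l_minus)
  finally show ?thesis .
qed

lemma free_finsum:
  assumes "finite A" "\<And>i. i \<in> A \<Longrightarrow> f i \<in> Vec B"
  shows "(\<Oplus>\<^bsub>Free B\<^esub>i\<in>A. f i) x = (\<Oplus>i\<in>A. f i x)"
  using assms
proof (induction A rule: finite_induct)
  case empty
  interpret F: module R "Free B" by (rule module_free)
  show ?case by simp
next
  case (insert a A)
  interpret F: module R "Free B" by (rule module_free)
  have f: "f i x \<in> carrier R" if "i \<in> insert a A" for i
    using insert.prems[OF that] by (rule free_closed)
  have "(\<Oplus>i\<in>insert a A. f i x) = f a x \<oplus> (\<Oplus>i\<in>A. f i x)"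
    by (rule finsum_insert) (use insert.hyps f in auto)
  then show ?case using insert by (simp add: Pi_def)
qed

lemma basis_vector_closed [simp]: "b \<in> B \<Longrightarrow> \<e> b \<in> Vec B"
  by (auto simp: free_carrier basis_vector_def intro: finite_subset[of _ "{b}"])

lemma lin_eq:
  assumes "module R V" "finite A" "{b. v b \<noteq> \<zero>} \<subseteq> A"
    "\<And>b. b \<in> A \<Longrightarrow> x b \<in> carrier V" "\<And>b. v b \<in> carrier R"
  shows "lin R V x v = (\<Oplus>\<^bsub>V\<^esub>b\<in>A. v b \<odot>\<^bsub>V\<^esub> x b)"
proof -
  interpret V: module R V by fact
  show ?thesis unfolding lin_def
    by (rule V.add.finprod_mono_neutral_cong_left) (use assms in auto)
qed

lemma lin_free_eq:
  assumes "module R V" "finite B" "\<And>b. b \<in> B \<Longrightarrow> x b \<in> carrier V" "v \<in> Vec B"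
  shows "lin R V x v = (\<Oplus>\<^bsub>V\<^esub>b\<in>B. v b \<odot>\<^bsub>V\<^esub> x b)"
  using assms by (intro lin_eq) (auto simp: free_carrier)

lemma lin_hom:
  assumes "module R V" "\<And>b. b \<in> B \<Longrightarrow> x b \<in> carrier V"
  shows "lin R V x \<in> Hom (Free B) V"
proof (rule module_homI)
  interpret V: module R V by fact
  interpret F: module R "Free B" by (rule module_free)
  note [simp] = free_carrier
  fix v assume v: "v \<in> Vec B"
  then show "lin R V x v \<in> carrier V"
    unfolding lin_def using assms(2) by (intro V.finsum_closed) auto
  { fix w assume w: "w \<in> Vec B"
    let ?A = "{b. v b \<noteq> \<zero>} \<union> {b. w b \<noteq> \<zero>}"
    have A: "finite ?A" "?A \<subseteq> B" using v w by auto
    have x: "x b \<in> carrier V" if "b \<in> ?A" for b using A that assms(2) by auto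
    have "lin R V x (v \<oplus>\<^bsub>Free B\<^esub> w) = (\<Oplus>\<^bsub>V\<^esub>b\<in>?A. (v b \<oplus> w b) \<odot>\<^bsub>V\<^esub> x b)"
      using A x v w by (subst lin_eq[OF assms(1), of ?A]) auto
    also have "\<dots> = (\<Oplus>\<^bsub>V\<^esub>b\<in>?A. v b \<odot>\<^bsub>V\<^esub> x b \<oplus>\<^bsub>V\<^esub> w b \<odot>\<^bsub>V\<^esub> x b)"
      by (rule V.finsum_cong') (use x v w in \<open>auto simp: V.smult_l_distr\<close>)
    also have "\<dots> = lin R V x v \<oplus>\<^bsub>V\<^esub> lin R V x w"
    proof -
      have "lin R V x v = (\<Oplus>\<^bsub>V\<^esub>b\<in>?A. v b \<odot>\<^bsub>V\<^esub> x b)" "lin R V x w = (\<Oplus>\<^bsub>V\<^esub>b\<in>?A. w b \<odot>\<^bsub>V\<^esub> x b)"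
        by (rule lin_eq[OF assms(1)]; use A x v w in auto)+
      then show ?thesis using x v w by (subst V.finsum_addf) auto
    qed
    finally show "lin R V x (v \<oplus>\<^bsub>Free B\<^esub> w) = lin R V x v \<oplus>\<^bsub>V\<^esub> lin R V x w" . }
  { fix a assume a: "a \<in> carrier R"
    let ?A = "{b. v b \<noteq> \<zero>}"
    have A: "finite ?A" "?A \<subseteq> B" using v by auto
    have x: "x b \<in> carrier V" if "b \<in> ?A" for b using A that assms(2) by auto
    have "lin R V x (a \<odot>\<^bsub>Free B\<^esub> v) = (\<Oplus>\<^bsub>V\<^esub>b\<in>?A. (a \<otimes> v b) \<odot>\<^bsub>V\<^esub> x b)"
      using A x v a by (subst lin_eq[OF assms(1), of ?A]) auto
    also have "\<dots> = (\<Oplus>\<^bsub>V\<^esub>b\<in>?A. a \<odot>\<^bsub>V\<^esub> (v b \<odot>\<^bsub>V\<^esub> x b))"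
      by (rule V.finsum_cong') (use x v a in \<open>auto simp: V.smult_assoc1\<close>)
    also have "\<dots> = a \<odot>\<^bsub>V\<^esub> lin R V x v"
      unfolding lin_def using A x v a by (subst V.finsum_smult_ldistr) auto
    finally show "lin R V x (a \<odot>\<^bsub>Free B\<^esub> v) = a \<odot>\<^bsub>V\<^esub> lin R V x v" . }
qed

lemma lin_basis:
  assumes "module R V" "x b \<in> carrier V"
  shows "lin R V x (\<e> b) = x b"
proof -
  interpret V: module R V by fact
  have e: "\<e> b c \<in> carrier R" for c by (simp add: basis_vector_def)
  have "lin R V x (\<e> b) = (\<Oplus>\<^bsub>V\<^esub>c\<in>{b}. \<e> b c \<odot>\<^bsub>V\<^esub> x c)"
  proof (rule lin_eq[OF assms(1)])
    show "{c. \<e> b c \<noteq> \<zero>} \<subseteq> {b}" by (auto simp: basis_vector_def)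
  qed (use assms(2) e in simp_all)
  also have "\<dots> = \<e> b b \<odot>\<^bsub>V\<^esub> x b \<oplus>\<^bsub>V\<^esub> \<zero>\<^bsub>V\<^esub>"
    using V.finsum_insert[of "{}" b "\<lambda>c. \<e> b c \<odot>\<^bsub>V\<^esub> x c"] assms(2) e by simp
  also have "\<dots> = x b"
    using assms(2) by (simp add: basis_vector_def)
  finally show ?thesis .
qed

lemma lin_basis_expand:
  assumes "v \<in> Vec B"
  shows "lin R (Free B) (\<e>) v = v"
proof
  fix c
  have fin: "finite {b. v b \<noteq> \<zero>}" and sub: "{b. v b \<noteq> \<zero>} \<subseteq> B" using assms by (auto simp: free_carrier)
  interpret F: module R "Free B" by (rule module_free)
  have "v b \<odot>\<^bsub>Free B\<^esub> \<e> b \<in> Vec B"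
    if "b \<in> {b. v b \<noteq> \<zero>}" for b
    using that sub by (intro F.smult_closed free_closed[OF assms] basis_vector_closed) auto
  from free_finsum[OF fin this, of _ c]
  have "lin R (Free B) (\<e>) v c = (\<Oplus>b\<in>{b. v b \<noteq> \<zero>}. v b \<otimes> \<e> b c)"
    unfolding lin_def by simp
  also have "\<dots> = (\<Oplus>b\<in>{b. v b \<noteq> \<zero>}. if c = b then v b else \<zero>)"
    by (rule finsum_cong') (use free_closed[OF assms] in \<open>auto simp: basis_vector_def\<close>)
  also have "\<dots> = v c"
  proof (cases "v c = \<zero>")
    case True
    have "(\<Oplus>b\<in>{b. v b \<noteq> \<zero>}. if c = b then v b else \<zero>) = (\<Oplus>b\<in>{b. v b \<noteq> \<zero>}. \<zero>)"
      by (rule finsum_cong') (use True in auto)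
    then show ?thesis using True finsum_zero by simp
  next
    case False
    show ?thesis
      by (rule finsum_singleton) (use False fin free_closed[OF assms] in auto)
  qed
  finally show "lin R (Free B) (\<e>) v c = v c" .
qed

lemma hom_lin:
  assumes "module R V" "h \<in> Hom (Free B) V" "v \<in> Vec B"
  shows "h v = lin R V (\<lambda>b. h (\<e> b)) v"
proof -
  have fin: "finite {b. v b \<noteq> \<zero>}" and sub: "{b. v b \<noteq> \<zero>} \<subseteq> B" using assms by (auto simp: free_carrier)
  interpret F: module R "Free B" by (rule module_free)
  interpret V: module R V by fact
  have e: "\<e> b \<in> Vec B" if "v b \<noteq> \<zero>" for b
    using sub that by auto
  have "h v = h (lin R (Free B) (\<e>) v)"
    using lin_basis_expand[OF assms(3)] by simp
  also have "\<dots> = (\<Oplus>\<^bsub>V\<^esub>b\<in>{b. v b \<noteq> \<zero>}. h (v b \<odot>\<^bsub>Free B\<^esub> \<e> b))"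
    unfolding lin_def
    by (rule module_hom_finsum[OF module_free assms(1,2) fin], rule F.smult_closed)
      (use e free_closed[OF assms(3)] in auto)
  also have "\<dots> = (\<Oplus>\<^bsub>V\<^esub>b\<in>{b. v b \<noteq> \<zero>}. v b \<odot>\<^bsub>V\<^esub> h (\<e> b))"
    by (rule V.finsum_cong')
      (use e free_closed[OF assms(3)] module_homD[OF assms(2)] in \<open>auto simp del: free_simps\<close>)
  finally show ?thesis by (simp add: lin_def)
qed

lemma hom_free_eqI:
  assumes "module R V" "h \<in> Hom (Free B) V" "g \<in> Hom (Free B) V"
    "\<And>b. b \<in> B \<Longrightarrow> h (\<e> b) = g (\<e> b)" "v \<in> Vec B"
  shows "h v = g v"
proof -
  interpret V: module R V by fact
  have sub: "{b. v b \<noteq> \<zero>} \<subseteq> B" using assms by (auto simp: free_carrier)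
  have "(\<Oplus>\<^bsub>V\<^esub>b\<in>{b. v b \<noteq> \<zero>}. v b \<odot>\<^bsub>V\<^esub> h (\<e> b)) =
    (\<Oplus>\<^bsub>V\<^esub>b\<in>{b. v b \<noteq> \<zero>}. v b \<odot>\<^bsub>V\<^esub> g (\<e> b))"
    by (rule V.finsum_cong') (use sub assms(4) free_closed[OF assms(5)] module_homD(1)[OF assms(3)] in auto)
  then show ?thesis
    using hom_lin[OF assms(1,2,5)] hom_lin[OF assms(1,3,5)] by (simp add: lin_def)
qed

lemma span_of_mono: "A \<subseteq> B \<Longrightarrow> span_of R V A \<subseteq> span_of R V B"
  unfolding span_of_def by auto

lemma span_of_superset: "A \<subseteq> span_of R V A"
  unfolding span_of_def by auto

lemma span_of_least: "submodule H R V \<Longrightarrow> A \<subseteq> H \<Longrightarrow> span_of R V A \<subseteq> H"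
  unfolding span_of_def by auto

text \<open>Links the span, an intersection of submodules, with linear combinations: the image of
  the free module is a submodule containing all \<open>x b\<close>, and every submodule containing
  them is closed under the finite sums in \<open>lin\<close>.\<close>

lemma span_of_lin:
  assumes "module R V" "x ` B \<subseteq> carrier V"
  shows "span_of R V (x ` B) = lin R V x ` Vec B"
proof -
  interpret V: module R V by fact
  have x: "x b \<in> carrier V" if "b \<in> B" for b using assms that by auto
  note h = lin_hom[OF assms(1) x]
  show ?thesis
  proof
    have "x b \<in> lin R V x ` Vec B" if "b \<in> B" for b
      using lin_basis[of V x b, OF assms(1) x[OF that]] basis_vector_closed[OF that]
      by (intro image_eqI[of _ _ "\<e> b"]) auto
    then have "x ` B \<subseteq> lin R V x ` Vec B" by auto
    then show "span_of R V (x ` B) \<subseteq> lin R V x ` Vec B"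
      using span_of_least[OF submodule_image[OF module_free assms(1) h]] by simp
  next
    show "lin R V x ` Vec B \<subseteq> span_of R V (x ` B)"
      unfolding span_of_def
    proof (intro subsetI InterI, elim imageE CollectE conjE, hypsubst)
      fix v H assume v: "v \<in> Vec B" and H: "submodule H R V" "x ` B \<subseteq> H"
      have "finite {b. v b \<noteq> \<zero>}" "{b. v b \<noteq> \<zero>} \<subseteq> B" using v by (auto simp: free_carrier)
      then show "lin R V x v \<in> H"
        unfolding lin_def
        using free_closed[OF v] H(2) V.submoduleE(4)[OF H(1)]
        by (intro submodule_finsum[OF assms(1) H(1)]) blast+
    qed
  qed
qed

lemma submodule_span_of:
  assumes "module R V" "A \<subseteq> carrier V"
  shows "submodule (span_of R V A) R V"
proof -
  have "span_of R V A = lin R V (\<lambda>x. x) ` Vec A"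
    using span_of_lin[OF assms(1), of "\<lambda>x. x" A] assms by simp
  then show ?thesis
    using submodule_image[OF module_free assms(1) lin_hom[OF assms(1)]] assms
    by (metis subset_iff)
qed

subsection \<open>Projective modules\<close>

lemma projective_free: "projective_module R (Free (B :: 'x set))"
proof -
  \<comment> \<open>\<open>projective_module\<close> asks for a basis in the element type of the
    module, so \<open>B\<close> is copied to the set of its basis vectors.\<close>
  let ?B = "\<e> ` B"
  define s where "s = lin R (Free ?B) (\<lambda>b::'x. \<e> (\<e> b))"
  define r where "r = lin R (Free B) (\<lambda>b::'x \<Rightarrow> 'a. b)"
  have s: "s \<in> Hom (Free B) (Free ?B)"
    unfolding s_def by (rule lin_hom[OF module_free]) auto
  have r: "r \<in> Hom (Free ?B) (Free B)"
    unfolding r_def by (rule lin_hom[OF module_free]) auto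
  have "r (s x) = x" if "x \<in> Vec B" for x
  proof (rule hom_free_eqI[OF module_free, of "\<lambda>x. r (s x)" B B "\<lambda>x. x"])
    show "(\<lambda>x. r (s x)) \<in> Hom (Free B) (Free B)"
      using module_hom_comp[OF s r] .
    show "(\<lambda>x. x) \<in> Hom (Free B) (Free B)"
      by (rule module_homI) auto
    fix b assume b: "b \<in> B"
    have "s (\<e> b) = \<e> (\<e> b)"
      unfolding s_def using b by (subst lin_basis[OF module_free]) auto
    then show "r (s (\<e> b)) = \<e> b"
      unfolding r_def using lin_basis[OF module_free, of "\<lambda>b. b" "\<e> b" B] b by simp
  qed fact
  then show ?thesis unfolding projective_module_def using module_free s r by blast
qed

text \<open>\<open>P\<close> is a retract of a free module: \<open>f \<circ> r\<close> is lifted on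
  basis vectors, extended linearly and composed with \<open>s\<close>. Only the image of
  \<open>f\<close> has to lie in that of \<open>d\<close>; thus maps into a kernel are lifted
  without turning the kernel into a module of its own.\<close>

lemma projective_lift:
  fixes P :: "('a, 'p) module"
  assumes P: "projective_module R P" and V: "module R V" and Y: "module R Y"
    and f: "f \<in> Hom P Y" and d: "d \<in> Hom V Y"
    and sub: "\<And>p. p \<in> carrier P \<Longrightarrow> f p \<in> d ` carrier V"
  obtains g where "g \<in> Hom P V" "\<And>p. p \<in> carrier P \<Longrightarrow> d (g p) = f p"
proof -
  obtain B :: "'p set" and s r where s: "s \<in> Hom P (Free B)"
    and r: "r \<in> Hom (Free B) P" and rs: "\<And>x. x \<in> carrier P \<Longrightarrow> r (s x) = x"
    using P unfolding projective_module_def by blast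
  have "\<forall>b\<in>B. \<exists>x\<in>carrier V. d x = f (r (\<e> b))"
    using sub module_homD(1)[OF r] by (metis basis_vector_closed image_iff)
  then obtain x where x: "\<And>b. b \<in> B \<Longrightarrow> x b \<in> carrier V \<and> d (x b) = f (r (\<e> b))"
    by metis
  then have h: "lin R V x \<in> Hom (Free B) V" by (auto intro: lin_hom[OF V])
  have "d (lin R V x v) = f (r v)" if "v \<in> Vec B" for v
    by (rule hom_free_eqI[OF Y module_hom_comp[OF h d] module_hom_comp[OF r f] _ that])
      (use x lin_basis[OF V, of x] in simp)
  then have "d (lin R V x (s p)) = f p" if "p \<in> carrier P" for p
    using that rs module_homD(1)[OF s] by auto
  with module_hom_comp[OF s h] show thesis using that by blast
qed

end

text \<open>For a submodule \<open>L\<close> of a free module, \<open>LP\<close> is the submodule of a power of \<open>P\<close> generated by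
  the \<open>l p\<close>. It replaces \<open>L \<otimes> P\<close>, to which it is isomorphic for flat \<open>P\<close>.\<close>

inductive_set LP :: "('a, 'r) ring_scheme \<Rightarrow> ('x \<Rightarrow> 'a) set \<Rightarrow> ('a, 'p) module \<Rightarrow> ('x \<Rightarrow> 'p) set"
  for R L P where
  LP_zero: "(\<lambda>j. \<zero>\<^bsub>P\<^esub>) \<in> LP R L P"
| LP_step: "l \<in> L \<Longrightarrow> p \<in> carrier P \<Longrightarrow> u \<in> LP R L P \<Longrightarrow>
    (\<lambda>j. l j \<odot>\<^bsub>P\<^esub> p \<oplus>\<^bsub>P\<^esub> u j) \<in> LP R L P"

text \<open>This is \<open>lin R (Free C) G\<close> tensored with \<open>P\<close>: a row vector
  \<open>p\<close> with entries in \<open>P\<close> times the matrix with rows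
  \<open>G t\<close>.\<close>

definition act :: "('a, 'p) module \<Rightarrow> 'y set \<Rightarrow> ('y \<Rightarrow> 'x \<Rightarrow> 'a) \<Rightarrow> ('y \<Rightarrow> 'p) \<Rightarrow> 'x \<Rightarrow> 'p"
  where "act P A G p = (\<lambda>j. finsum P (\<lambda>t. smult P (G t j) (p t)) A)"

text \<open>Exactness of the complex \<open>LP\<close> in degree \<open>m + 1\<close>. If \<open>P\<close> resolves \<open>M\<close> and \<open>L\<close> is the module of
  relations of \<open>N\<close>, it says that \<open>Tor\<close> of \<open>M\<close> and \<open>N\<close> vanishes in degree \<open>m + 2\<close>.\<close>

definition exact_at :: "('a, 'r) ring_scheme \<Rightarrow> (nat \<Rightarrow> ('a, 'p) module) \<Rightarrow> (nat \<Rightarrow> 'p \<Rightarrow> 'p) \<Rightarrow>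
    nat \<Rightarrow> ('x \<Rightarrow> 'a) set \<Rightarrow> bool"
  where "exact_at R P d m L \<longleftrightarrow> (\<forall>u \<in> LP R L (P (Suc m)). (\<forall>j. d m (u j) = \<zero>\<^bsub>P m\<^esub>) \<longrightarrow>
    (\<exists>u' \<in> LP R L (P (Suc (Suc m))). \<forall>j. u j = d (Suc m) (u' j)))"

section \<open>The modules \<open>LP\<close> and their exactness properties\<close>

context cring
begin

lemma submodule_free_subset: "submodule L R (Free C) \<Longrightarrow> L \<subseteq> Vec C"
  using module.submoduleE(1)[OF module_free] by blast

lemma LP_closed:
  assumes "module R P" "L \<subseteq> Vec C" "u \<in> LP R L P"
  shows "u j \<in> carrier P"
proof -
  interpret P: module R P by fact
  show ?thesis using assms(3)
  proof (induction arbitrary: j)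
    case (LP_step l p u)
    have "l j \<in> carrier R" using LP_step(1) assms(2) free_closed by (meson subsetD)
    then show ?case using LP_step by simp
  qed simp
qed

lemma LP_outside:
  assumes "module R P" "L \<subseteq> Vec C" "u \<in> LP R L P" "j \<notin> C"
  shows "u j = \<zero>\<^bsub>P\<^esub>"
proof -
  interpret P: module R P by fact
  show ?thesis using assms(3)
  proof induction
    case LP_zero
    then show ?case by simp
  next
    case (LP_step l p u)
    have "l j = \<zero>" using LP_step(1) assms(2,4) free_outside by (meson subsetD)
    then show ?case using LP_step by simp
  qed
qed

lemma LP_add:
  assumes "module R P" "L \<subseteq> Vec C" "u \<in> LP R L P" "w \<in> LP R L P"
  shows "(\<lambda>j. u j \<oplus>\<^bsub>P\<^esub> w j) \<in> LP R L P"
proof -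
  interpret P: module R P by fact
  have w: "w j \<in> carrier P" for j using LP_closed[OF assms(1,2,4)] .
  show ?thesis using assms(3)
  proof induction
    case LP_zero
    then show ?case using assms(4) w by simp
  next
    case (LP_step l p u)
    have "l j \<in> carrier R" for j using LP_step(1) assms free_closed by (meson subsetD)
    moreover have "u j \<in> carrier P" for j using LP_closed[OF assms(1,2) LP_step(3)] .
    ultimately have "(\<lambda>j. l j \<odot>\<^bsub>P\<^esub> p \<oplus>\<^bsub>P\<^esub> u j \<oplus>\<^bsub>P\<^esub> w j) = (\<lambda>j. l j \<odot>\<^bsub>P\<^esub> p \<oplus>\<^bsub>P\<^esub> (u j \<oplus>\<^bsub>P\<^esub> w j))"
      using w LP_step by (simp add: P.a_assoc)
    then show ?case using LP.LP_step[OF LP_step(1,2,4)] by simp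
  qed
qed

lemma LP_single:
  assumes "module R P" "L \<subseteq> Vec C" "l \<in> L" "p \<in> carrier P"
  shows "(\<lambda>j. l j \<odot>\<^bsub>P\<^esub> p) \<in> LP R L P"
proof -
  interpret P: module R P by fact
  have "l j \<in> carrier R" for j using assms(2,3) free_closed by (meson subsetD)
  then show ?thesis using LP_step[OF assms(3,4) LP_zero] assms by simp
qed

lemma LP_smult:
  assumes "module R P" "L \<subseteq> Vec C" "u \<in> LP R L P" "a \<in> carrier R"
  shows "(\<lambda>j. a \<odot>\<^bsub>P\<^esub> u j) \<in> LP R L P"
proof -
  interpret P: module R P by fact
  show ?thesis using assms(3)
  proof induction
    case LP_zero
    then show ?case using LP.LP_zero[of P R L] assms by simp
  next
    case (LP_step l p u)
    have l: "l j \<in> carrier R" for j using LP_step(1) assms free_closed by (meson subsetD)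
    moreover have "u j \<in> carrier P" for j using LP_closed[OF assms(1,2) LP_step(3)] .
    ultimately have "(\<lambda>j. a \<odot>\<^bsub>P\<^esub> (l j \<odot>\<^bsub>P\<^esub> p \<oplus>\<^bsub>P\<^esub> u j)) = (\<lambda>j. l j \<odot>\<^bsub>P\<^esub> (a \<odot>\<^bsub>P\<^esub> p) \<oplus>\<^bsub>P\<^esub> (a \<odot>\<^bsub>P\<^esub> u j))"
      using LP_step assms by (simp add: P.smult_r_distr P.smult_assoc1[symmetric] m_comm)
    then show ?case using LP.LP_step[OF LP_step(1) _ LP_step(4), of "a \<odot>\<^bsub>P\<^esub> p"] LP_step(2) assms by simp
  qed
qed

lemma LP_minus:
  assumes "module R P" "L \<subseteq> Vec C" "u \<in> LP R L P" "w \<in> LP R L P"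
  shows "(\<lambda>j. u j \<ominus>\<^bsub>P\<^esub> w j) \<in> LP R L P"
proof -
  interpret P: module R P by fact
  have "u j \<in> carrier P" "w j \<in> carrier P" for j
    using LP_closed[OF assms(1,2,3)] LP_closed[OF assms(1,2,4)] by auto
  then show ?thesis
    using LP_add[OF assms(1-3) LP_smult[OF assms(1,2,4), of "\<ominus> \<one>"]]
    by (simp add: P.minus_eq P.smult_l_minus)
qed

lemma LP_finsum:
  assumes "module R P" "L \<subseteq> Vec C" "finite A" "\<And>t. t \<in> A \<Longrightarrow> f t \<in> LP R L P"
  shows "(\<lambda>j. \<Oplus>\<^bsub>P\<^esub>t\<in>A. f t j) \<in> LP R L P"
  using assms(3,4)
proof (induction A rule: finite_induct)
  case empty
  interpret P: module R P by fact
  show ?case using LP_zero[of P R L] by simp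
next
  case (insert a A)
  interpret P: module R P by fact
  have "f t j \<in> carrier P" if "t \<in> insert a A" for t j
    using LP_closed[OF assms(1,2) insert.prems[OF that]] .
  then have "(\<lambda>j. \<Oplus>\<^bsub>P\<^esub>t\<in>insert a A. f t j) = (\<lambda>j. f a j \<oplus>\<^bsub>P\<^esub> (\<Oplus>\<^bsub>P\<^esub>t\<in>A. f t j))"
    using insert.hyps by (intro ext P.finsum_insert) auto
  then show ?case using LP_add[OF assms(1,2)] insert by simp
qed

lemma LP_hom:
  assumes "module R P" "module R Q" "h \<in> Hom P Q" "L \<subseteq> Vec C"
    "u \<in> LP R L P"
  shows "(\<lambda>j. h (u j)) \<in> LP R L Q"
  using assms(5)
proof induction
  case LP_zero
  then show ?case using LP.LP_zero[of Q R L] module_hom_zero[OF assms(1-3)] by simp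
next
  case (LP_step l p u)
  interpret P: module R P by fact
  have l: "l j \<in> carrier R" for j using LP_step(1) assms free_closed by (meson subsetD)
  moreover have "u j \<in> carrier P" for j using LP_closed[OF assms(1,4) LP_step(3)] .
  ultimately have "(\<lambda>j. h (l j \<odot>\<^bsub>P\<^esub> p \<oplus>\<^bsub>P\<^esub> u j)) = (\<lambda>j. l j \<odot>\<^bsub>Q\<^esub> h p \<oplus>\<^bsub>Q\<^esub> h (u j))"
    using LP_step by (simp add: module_homD[OF assms(3)])
  then show ?case using LP.LP_step[OF LP_step(1) _ LP_step(4)] module_homD(1)[OF assms(3)] LP_step by simp
qed

lemma LP_mono: "L \<subseteq> L' \<Longrightarrow> u \<in> LP R L P \<Longrightarrow> u \<in> LP R L' P"
  by (rotate_tac, induction rule: LP.induct) (auto intro: LP.intros)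

lemma act_in_LP:
  assumes "module R P" "L \<subseteq> Vec C" "finite A"
    "\<And>t. t \<in> A \<Longrightarrow> G t \<in> L" "\<And>t. t \<in> A \<Longrightarrow> p t \<in> carrier P"
  shows "act P A G p \<in> LP R L P"
  unfolding act_def
  by (rule LP_finsum[OF assms(1-3)]) (rule LP_single[OF assms(1,2)], use assms in auto)

lemma act_closed:
  assumes "module R P" "\<And>t. t \<in> A \<Longrightarrow> G t \<in> Vec C" "\<And>t. t \<in> A \<Longrightarrow> p t \<in> carrier P"
  shows "act P A G p j \<in> carrier P"
proof -
  interpret P: module R P by fact
  show ?thesis unfolding act_def
    by (rule P.finsum_closed) (use free_closed[OF assms(2)] assms(3) in auto)
qed

lemma act_hom:
  assumes "module R P" "module R Q" "h \<in> Hom P Q" "finite A"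
    "\<And>t. t \<in> A \<Longrightarrow> G t \<in> Vec C" "\<And>t. t \<in> A \<Longrightarrow> p t \<in> carrier P"
  shows "h (act P A G p j) = act Q A G (\<lambda>t. h (p t)) j"
proof -
  interpret P: module R P by fact
  interpret Q: module R Q by fact
  have G: "G t j \<in> carrier R" if "t \<in> A" for t using free_closed[OF assms(5)[OF that]] .
  have "h (act P A G p j) = (\<Oplus>\<^bsub>Q\<^esub>t\<in>A. h (G t j \<odot>\<^bsub>P\<^esub> p t))"
    unfolding act_def by (rule module_hom_finsum[OF assms(1-4)]) (use G assms(6) in auto)
  also have "\<dots> = act Q A G (\<lambda>t. h (p t)) j"
    unfolding act_def
    by (rule Q.finsum_cong') (use G assms(6) module_homD[OF assms(3)] in auto)
  finally show ?thesis .
qed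

lemma act_add:
  assumes "module R P" "finite A"
    "\<And>t. t \<in> A \<Longrightarrow> G t \<in> Vec C" "\<And>t. t \<in> A \<Longrightarrow> p t \<in> carrier P"
     "\<And>t. t \<in> A \<Longrightarrow> q t \<in> carrier P"
  shows "act P A G (\<lambda>t. p t \<oplus>\<^bsub>P\<^esub> q t) j = act P A G p j \<oplus>\<^bsub>P\<^esub> act P A G q j"
proof -
  interpret P: module R P by fact
  have G: "G t j \<in> carrier R" if "t \<in> A" for t using free_closed[OF assms(3)[OF that]] .
  have "act P A G (\<lambda>t. p t \<oplus>\<^bsub>P\<^esub> q t) j = (\<Oplus>\<^bsub>P\<^esub>t\<in>A. (G t j \<odot>\<^bsub>P\<^esub> p t) \<oplus>\<^bsub>P\<^esub> (G t j \<odot>\<^bsub>P\<^esub> q t))"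
    unfolding act_def
    by (rule P.finsum_cong') (use G assms in \<open>auto simp: P.smult_r_distr\<close>)
  also have "\<dots> = act P A G p j \<oplus>\<^bsub>P\<^esub> act P A G q j"
    unfolding act_def by (rule P.finsum_addf) (use G assms in auto)
  finally show ?thesis .
qed

lemma lin_free_pointwise:
  assumes "finite A" "\<And>t. t \<in> A \<Longrightarrow> G t \<in> Vec C" "v \<in> Vec A"
  shows "lin R (Free C) G v j = (\<Oplus>t\<in>A. v t \<otimes> G t j)"
proof -
  interpret F: module R "Free C" by (rule module_free)
  have "v t \<odot>\<^bsub>Free C\<^esub> G t \<in> Vec C" if "t \<in> A" for t
    by (rule F.smult_closed) (use that assms free_closed[OF assms(3)] in auto)
  from free_finsum[OF assms(1) this, of _ j] show ?thesis
    using lin_free_eq[OF module_free assms(1,2,3)] by simp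
qed

lemma act_smult:
  assumes "module R P" "finite A"
    "\<And>t. t \<in> A \<Longrightarrow> G t \<in> Vec C" "v \<in> Vec A" "p \<in> carrier P"
  shows "act P A G (\<lambda>t. v t \<odot>\<^bsub>P\<^esub> p) j = lin R (Free C) G v j \<odot>\<^bsub>P\<^esub> p"
proof -
  interpret P: module R P by fact
  have G: "G t j \<in> carrier R" if "t \<in> A" for t using free_closed[OF assms(3)[OF that]] .
  have v: "v t \<in> carrier R" for t using free_closed[OF assms(4)] .
  have "(\<Oplus>t\<in>A. v t \<otimes> G t j) \<odot>\<^bsub>P\<^esub> p = (\<Oplus>\<^bsub>P\<^esub>t\<in>A. (v t \<otimes> G t j) \<odot>\<^bsub>P\<^esub> p)"
    using assms(2) G
  proof (induction A rule: finite_induct)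
    case empty
    then show ?case using assms by simp
  next
    case (insert a A)
    then show ?case using v assms(5) by (simp add: Pi_def P.smult_l_distr)
  qed
  also have "\<dots> = (\<Oplus>\<^bsub>P\<^esub>t\<in>A. G t j \<odot>\<^bsub>P\<^esub> (v t \<odot>\<^bsub>P\<^esub> p))"
    by (rule P.finsum_cong') (use G v assms(5) in \<open>auto simp: P.smult_assoc1[symmetric] m_comm\<close>)
  finally show ?thesis using lin_free_pointwise[OF assms(2-4), where j = j] by (simp add: act_def)
qed

text \<open>Let \<open>K\<close> be the kernel and \<open>H\<close> the image of the matrix
  \<open>G\<close>. Together with \<open>LP_act\<close> and \<open>LP_flat\<close> this stands for
  exactness of \<open>K \<otimes> P \<rightarrow> P^A \<rightarrow> H \<otimes> P \<rightarrow>
  0\<close>: here the composite vanishes, \<open>LP_act\<close> is surjectivity,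
  \<open>LP_flat\<close> exactness in the middle.\<close>

lemma LP_kernel:
  assumes "module R P" "finite A" "\<And>t. t \<in> A \<Longrightarrow> G t \<in> Vec C"
    and "u \<in> LP R (Ker A C G) P"
  shows "act P A G u j = \<zero>\<^bsub>P\<^esub>"
proof -
  interpret P: module R P by fact
  let ?L = "Ker A C G"
  have L: "?L \<subseteq> Vec A" by auto
  show ?thesis using assms(4)
  proof induction
    case LP_zero
    have "act P A G (\<lambda>j. \<zero>\<^bsub>P\<^esub>) j = (\<Oplus>\<^bsub>P\<^esub>t\<in>A. \<zero>\<^bsub>P\<^esub>)"
      unfolding act_def by (rule P.finsum_cong') (use free_closed[OF assms(3)] in auto)
    then show ?case by (simp add: P.finsum_zero)
  next
    case (LP_step l p u)
    have "act P A G (\<lambda>j. l j \<odot>\<^bsub>P\<^esub> p \<oplus>\<^bsub>P\<^esub> u j) j = act P A G (\<lambda>j. l j \<odot>\<^bsub>P\<^esub> p) j \<oplus>\<^bsub>P\<^esub> act P A G u j"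
      using LP_step free_closed[of l A] LP_closed[OF assms(1) L LP_step(3)]
      by (intro act_add[OF assms(1-3)]) auto
    then show ?case using LP_step act_smult[OF assms(1-3)] by simp
  qed
qed

lemma LP_act:
  assumes "module R P" "finite A" "\<And>t. t \<in> A \<Longrightarrow> G t \<in> Vec C"
    and "u \<in> LP R (lin R (Free C) G ` Vec A) P"
  obtains q where "\<And>t. q t \<in> carrier P" "u = act P A G q"
proof -
  interpret P: module R P by fact
  have "\<exists>q. (\<forall>t. q t \<in> carrier P) \<and> u = act P A G q" using assms(4)
  proof induction
    case LP_zero
    have "act P A G (\<lambda>j. \<zero>\<^bsub>P\<^esub>) j = (\<Oplus>\<^bsub>P\<^esub>t\<in>A. \<zero>\<^bsub>P\<^esub>)" for j
      unfolding act_def by (rule P.finsum_cong') (use free_closed[OF assms(3)] in auto)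
    then show ?case by (intro exI[of _ "\<lambda>_. \<zero>\<^bsub>P\<^esub>"]) (auto simp: P.finsum_zero)
  next
    case (LP_step l p u)
    then obtain q v where q: "\<And>t. q t \<in> carrier P" "u = act P A G q"
      and v: "v \<in> Vec A" "l = lin R (Free C) G v" by auto
    have "act P A G (\<lambda>t. v t \<odot>\<^bsub>P\<^esub> p \<oplus>\<^bsub>P\<^esub> q t) j = l j \<odot>\<^bsub>P\<^esub> p \<oplus>\<^bsub>P\<^esub> u j" for j
      using act_add[OF assms(1-3), where p = "\<lambda>t. v t \<odot>\<^bsub>P\<^esub> p" and q = q and j = j] act_smult[OF assms(1-3) v(1) LP_step(2)]
        q v LP_step(2) free_closed[OF v(1)] by simp
    then show ?case using q free_closed[OF v(1)] LP_step(2)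
      by (intro exI[of _ "\<lambda>t. v t \<odot>\<^bsub>P\<^esub> p \<oplus>\<^bsub>P\<^esub> q t"]) auto
  qed
  then show thesis using that by blast
qed

text \<open>Flatness of \<open>P\<close>: the functor \<open>L \<mapsto> LP\<close> preserves kernels. On a free module this is
  checked one coordinate at a time.\<close>

lemma LP_flat:
  fixes P :: "('a, 'p) module"
  assumes "projective_module R P" "finite A" "\<And>t. t \<in> A \<Longrightarrow> G t \<in> Vec C"
    and "\<And>t. x t \<in> carrier P" "\<And>t. t \<notin> A \<Longrightarrow> x t = \<zero>\<^bsub>P\<^esub>" "\<And>j. act P A G x j = \<zero>\<^bsub>P\<^esub>"
  shows "x \<in> LP R (Ker A C G) P"
    (is "x \<in> LP R ?L P")
proof -
  have P: "module R P" using assms(1) unfolding projective_module_def by auto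
  obtain B :: "'p set" and s r where s: "s \<in> Hom P (Free B)"
    and r: "r \<in> Hom (Free B) P" and rs: "\<And>x. x \<in> carrier P \<Longrightarrow> r (s x) = x"
    using assms(1) unfolding projective_module_def by blast
  interpret P: module R P by fact
  interpret F: module R "Free B" by (rule module_free)
  have sx: "s (x t) \<in> Vec B" for t using assms(4) module_homD(1)[OF s] by auto
  define Y where "Y = (\<Union>t\<in>A. {b. s (x t) b \<noteq> \<zero>})"
  have Y: "finite Y" "Y \<subseteq> B" unfolding Y_def using sx assms(2) by (auto simp: free_carrier)
  \<comment> \<open>\<open>h b\<close> collects the \<open>b\<close>-th coordinates of all
    \<open>s (x t)\<close>. Each \<open>h b\<close> is a relation over the ring itself, and
    \<open>x\<close> is recovered from the finitely many nonzero ones as the combination of the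
    \<open>h b\<close> with the elements \<open>r (\<e> b)\<close> of \<open>P\<close>.\<close>
  define h where "h b = (\<lambda>t. s (x t) b)" for b
  have s0: "s \<zero>\<^bsub>P\<^esub> = (\<lambda>_. \<zero>)" using module_hom_zero[OF P module_free s] by simp
  have hF: "h b \<in> Vec A" for b
    by (rule free_finiteI[OF assms(2)]) (use sx[THEN free_closed] assms(5) s0 in \<open>auto simp: h_def\<close>)
  have hL: "h b \<in> ?L" for b
  proof -
    have "lin R (Free C) G (h b) j = \<zero>" for j
    proof -
      have G: "G t j \<in> carrier R" if "t \<in> A" for t using free_closed[OF assms(3)[OF that]] .
      have "\<zero> = s (act P A G x j) b" using assms(6) s0 by simp
      also have "\<dots> = act (Free B) A G (\<lambda>t. s (x t)) j b"
        using act_hom[OF P module_free s assms(2,3)] assms(4) by simp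
      also have "\<dots> = (\<Oplus>t\<in>A. (G t j \<odot>\<^bsub>Free B\<^esub> s (x t)) b)"
        unfolding act_def
        by (rule free_finsum[OF assms(2) F.smult_closed]) (use G sx in auto)
      also have "\<dots> = (\<Oplus>t\<in>A. h b t \<otimes> G t j)"
        by (rule finsum_cong') (use G sx[THEN free_closed] in \<open>auto simp: h_def m_comm\<close>)
      finally show ?thesis using lin_free_pointwise[OF assms(2,3) hF] by simp
    qed
    then show ?thesis using hF by auto
  qed
  have "x t = act P Y h (\<lambda>b. r (\<e> b)) t" for t
  proof (cases "t \<in> A")
    case True
    have "x t = r (s (x t))" using rs assms(4) by simp
    also have "\<dots> = lin R P (\<lambda>b. r (\<e> b)) (s (x t))"
      by (rule hom_lin[OF P r sx])
    also have "\<dots> = (\<Oplus>\<^bsub>P\<^esub>b\<in>Y. s (x t) b \<odot>\<^bsub>P\<^esub> r (\<e> b))"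
    proof (rule lin_eq[OF P Y(1)])
      show "{b. s (x t) b \<noteq> \<zero>} \<subseteq> Y" using True by (auto simp: Y_def)
    qed (use Y module_homD(1)[OF r] free_closed[OF sx] in auto)
    finally show ?thesis by (simp add: act_def h_def)
  next
    case False
    have "act P Y h (\<lambda>b. r (\<e> b)) t = (\<Oplus>\<^bsub>P\<^esub>b\<in>Y. \<zero>\<^bsub>P\<^esub>)"
      unfolding act_def
      by (rule P.finsum_cong') (use Y False assms(5) s0 module_homD(1)[OF r] in \<open>auto simp: h_def subset_eq\<close>)
    then show ?thesis using False assms(5) by (simp add: P.finsum_zero)
  qed
  then have "x = act P Y h (\<lambda>b. r (\<e> b))" by auto
  also have "\<dots> \<in> LP R ?L P"
    by (rule act_in_LP[OF P _ Y(1) hL, of A]) (use Y module_homD(1)[OF r] in auto)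
  finally show ?thesis .
qed

end

section \<open>Dimension shifting and direct summands\<close>

locale projective_complex = cring R for R (structure) +
  fixes P :: "nat \<Rightarrow> ('a, 'p) module" and d :: "nat \<Rightarrow> 'p \<Rightarrow> 'p"
  assumes projective: "projective_module R (P n)"
    and d_hom: "d n \<in> Hom (P (Suc n)) (P n)"
    and exact: "d (Suc n) ` carrier (P (Suc (Suc n))) = {x \<in> carrier (P (Suc n)). d n x = \<zero>\<^bsub>P n\<^esub>}"
begin

lemma module_P: "module R (P n)"
  using projective unfolding projective_module_def by auto

lemma d_d: "x \<in> carrier (P (Suc (Suc n))) \<Longrightarrow> d n (d (Suc n) x) = \<zero>\<^bsub>P n\<^esub>"
  using exact by auto

text \<open>Exactness of \<open>P\<close> is applied in each coordinate, so the lift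
  \<open>x\<close> need not lie in \<open>LP\<close> over \<open>L\<close>. Outside \<open>A\<close>
  it is set to zero, as \<open>LP_flat\<close> and \<open>tensor_exact_LP\<close> demand.\<close>

lemma lift_cycle:
  assumes L: "L \<subseteq> Vec A" and u: "u \<in> LP R L (P (Suc m))" and du: "\<forall>j. d m (u j) = \<zero>\<^bsub>P m\<^esub>"
  obtains x where "\<And>j. x j \<in> carrier (P (Suc (Suc m)))"
    "\<And>j. j \<notin> A \<Longrightarrow> x j = \<zero>\<^bsub>P (Suc (Suc m))\<^esub>" "\<And>j. d (Suc m) (x j) = u j"
proof -
  interpret P2: module R "P (Suc (Suc m))" by (rule module_P)
  have "\<exists>x\<in>carrier (P (Suc (Suc m))). d (Suc m) x = u j" for j
    using exact[of m] du LP_closed[OF module_P L u, of j] by (metis (mono_tags, lifting) image_iff mem_Collect_eq)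
  then obtain x where x: "\<And>j. x j \<in> carrier (P (Suc (Suc m)))" "\<And>j. d (Suc m) (x j) = u j" by metis
  show thesis
    by (rule that[of "\<lambda>j. if j \<in> A then x j else \<zero>\<^bsub>P (Suc (Suc m))\<^esub>"])
      (use x LP_outside[OF module_P L u] module_hom_zero[OF module_P module_P d_hom] in auto)
qed

text \<open>The chase along the connecting map of \<open>0 \<rightarrow> K \<rightarrow> Free A
  \<rightarrow> H \<rightarrow> 0\<close>, with \<open>K\<close> and \<open>H\<close> the kernel and
  image of \<open>G\<close>: a cycle \<open>u\<close> over \<open>K\<close> lifts to
  \<open>x\<close> over \<open>Free A\<close>, whose image \<open>y\<close> over \<open>H\<close> is
  a cycle one degree higher. As \<open>y\<close> is a boundary, subtracting a boundary
  \<open>q\<close> from \<open>x\<close> brings it into \<open>K\<close> by flatness, without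
  changing its image \<open>u\<close>.\<close>

lemma exact_at_shift:
  assumes A: "finite A" and G: "\<And>t. t \<in> A \<Longrightarrow> G t \<in> Vec C"
    and ex: "exact_at R P d (Suc m) (lin R (Free C) G ` Vec A)"
  shows "exact_at R P d m (Ker A C G)"
    (is "exact_at R P d m ?L")
  unfolding exact_at_def
proof (intro ballI impI)
  let ?H = "lin R (Free C) G ` Vec A"
  have L: "?L \<subseteq> Vec A" by auto
  have lh: "lin R (Free C) G \<in> Hom (Free A) (Free C)"
    by (rule lin_hom[OF module_free G])
  have H: "?H \<subseteq> Vec C" using module_homD(1)[OF lh] by auto
  have GH: "G t \<in> ?H" if "t \<in> A" for t
    using lin_basis[of "Free C" G, OF module_free G[OF that]] basis_vector_closed[OF that] by (metis image_eqI)
  fix u assume u: "u \<in> LP R ?L (P (Suc m))" and du: "\<forall>j. d m (u j) = \<zero>\<^bsub>P m\<^esub>"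
  interpret P2: module R "P (Suc (Suc m))" by (rule module_P)
  interpret P1: module R "P (Suc m)" by (rule module_P)
  obtain x where x: "\<And>j. x j \<in> carrier (P (Suc (Suc m)))"
    and x_out: "\<And>j. j \<notin> A \<Longrightarrow> x j = \<zero>\<^bsub>P (Suc (Suc m))\<^esub>" and dx: "\<And>j. d (Suc m) (x j) = u j"
    using lift_cycle[OF L u du] by blast
  define y where "y = act (P (Suc (Suc m))) A G x"
  have y: "y \<in> LP R ?H (P (Suc (Suc m)))"
    unfolding y_def by (rule act_in_LP[OF module_P H A GH x])
  have "d (Suc m) (y j) = \<zero>\<^bsub>P (Suc m)\<^esub>" for j
    using act_hom[OF module_P module_P d_hom A G x, of "\<lambda>t. t"] LP_kernel[OF module_P A G u] dx
    by (simp add: y_def)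
  then obtain y' where y': "y' \<in> LP R ?H (P (Suc (Suc (Suc m))))" "\<And>j. y j = d (Suc (Suc m)) (y' j)"
    using ex y unfolding exact_at_def by blast
  obtain q0 where q0: "\<And>t. q0 t \<in> carrier (P (Suc (Suc (Suc m))))" "y' = act (P (Suc (Suc (Suc m)))) A G q0"
    using LP_act[OF module_P A G y'(1)] by blast
  \<comment> \<open>The values of \<open>q0\<close> outside \<open>A\<close> are arbitrary; they are
    cut off so that \<open>z\<close> below meets the support condition of
    \<open>LP_flat\<close>.\<close>
  define q where "q t = (if t \<in> A then d (Suc (Suc m)) (q0 t) else \<zero>\<^bsub>P (Suc (Suc m))\<^esub>)" for t
  have q: "q t \<in> carrier (P (Suc (Suc m)))" for t using q0 module_homD(1)[OF d_hom] by (auto simp: q_def)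
  have dq: "d (Suc m) (q t) = \<zero>\<^bsub>P (Suc m)\<^esub>" for t
    using q0 d_d module_hom_zero[OF module_P module_P d_hom] by (auto simp: q_def)
  have yq: "y j = act (P (Suc (Suc m))) A G q j" for j
  proof -
    have "y j = act (P (Suc (Suc m))) A G (\<lambda>t. d (Suc (Suc m)) (q0 t)) j"
      using y'(2) q0 act_hom[OF module_P module_P d_hom A G] by simp
    also have "\<dots> = act (P (Suc (Suc m))) A G q j"
      unfolding act_def
      by (rule P2.finsum_cong') (use q free_closed[OF G] in \<open>auto simp: q_def\<close>)
    finally show ?thesis .
  qed
  define z where "z t = x t \<ominus>\<^bsub>P (Suc (Suc m))\<^esub> q t" for t
  have z: "z t \<in> carrier (P (Suc (Suc m)))" for t using x q by (simp add: z_def)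
  have "z \<in> LP R ?L (P (Suc (Suc m)))"
  proof (rule LP_flat[OF projective A G z])
    fix t assume "t \<notin> A" then show "z t = \<zero>\<^bsub>P (Suc (Suc m))\<^esub>"
      using x_out by (simp add: z_def q_def P2.minus_eq)
  next
    fix j
    have "y j = act (P (Suc (Suc m))) A G (\<lambda>t. z t \<oplus>\<^bsub>P (Suc (Suc m))\<^esub> q t) j"
      unfolding y_def z_def using P2.minus_add_cancel x q by simp
    also have "\<dots> = act (P (Suc (Suc m))) A G z j \<oplus>\<^bsub>P (Suc (Suc m))\<^esub> y j"
      using act_add[OF module_P A G] z q yq by simp
    finally have eq: "y j = act (P (Suc (Suc m))) A G z j \<oplus>\<^bsub>P (Suc (Suc m))\<^esub> y j" .
    have "y j \<in> carrier (P (Suc (Suc m)))" unfolding y_def by (rule act_closed[OF module_P G x])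
    moreover have "act (P (Suc (Suc m))) A G z j \<in> carrier (P (Suc (Suc m)))"
      by (rule act_closed[OF module_P G z])
    ultimately show "act (P (Suc (Suc m))) A G z j = \<zero>\<^bsub>P (Suc (Suc m))\<^esub>"
      using eq P2.add.r_cancel_one'[of "y j" "act (P (Suc (Suc m))) A G z j"] by simp
  qed
  moreover have "u j = d (Suc m) (z j)" for j
    unfolding z_def using module_hom_minus[OF module_P module_P d_hom x q] dx dq
      LP_closed[OF module_P L u] by (simp add: P1.minus_eq)
  ultimately show "\<exists>u'\<in>LP R ?L (P (Suc (Suc m))). \<forall>j. u j = d (Suc m) (u' j)" by blast
qed

text \<open>\<open>P n\<close> is only projective, so its elements have coordinates through an
  embedding \<open>s\<close> into a free module. In these coordinates an element of
  \<open>LP\<close> over vectors in \<open>I\<close> stays in \<open>I\<close>.\<close>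

lemma LP_in_ideal:
  fixes C :: "'x set"
  assumes I: "ideal I R" and L: "L \<subseteq> Vec C" "\<And>l j. l \<in> L \<Longrightarrow> l j \<in> I"
    and u: "u \<in> LP R L (P n)" and s: "s \<in> Hom (P n) (Free B)"
  shows "s (u j) b \<in> I"
  using u
proof induction
  case LP_zero
  then show ?case
    using module_hom_zero[OF module_P module_free s] additive_subgroup.zero_closed[OF ideal.axioms(1)[OF I]] by simp
next
  case (LP_step l p u)
  interpret Pn: module R "P n" by (rule module_P)
  have "l j \<in> carrier R" using LP_step(1) L(1) free_closed by (meson subsetD)
  then have "s (l j \<odot>\<^bsub>P n\<^esub> p \<oplus>\<^bsub>P n\<^esub> u j) b = l j \<otimes> s p b \<oplus> s (u j) b"
    using LP_step LP_closed[OF module_P L(1) LP_step(3), of j] by (simp add: module_homD[OF s])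
  moreover have "l j \<otimes> s p b \<in> I"
    using LP_step L(2) free_closed[OF module_homD(1)[OF s LP_step(2)]] by (intro ideal.I_r_closed[OF I]) auto
  ultimately show ?case
    using LP_step additive_subgroup.a_closed[OF ideal.axioms(1)[OF I]] by simp
qed

text \<open>If \<open>u\<close> over the \<open>I\<close>-part is the boundary of
  \<open>f + g\<close>, with \<open>f\<close> over the \<open>I\<close>-part and \<open>g\<close>
  over the \<open>J\<close>-part, then the boundary of \<open>g\<close> equals \<open>u\<close>
  minus that of \<open>f\<close>. Hence its coordinates lie in both \<open>I\<close> and
  \<open>J\<close>, so it is zero and \<open>f\<close> alone bounds \<open>u\<close>.\<close>

lemma exact_at_part:
  fixes L :: "('x \<Rightarrow> 'a) set"
  assumes I: "ideal I R" and J: "ideal J R" and IJ: "I \<inter> J = {\<zero>}"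
    and L: "L \<subseteq> Vec C"
    and dec: "\<And>l. l \<in> L \<Longrightarrow> \<exists>f\<in>L. \<exists>g\<in>L. (\<forall>j. f j \<in> I \<and> g j \<in> J \<and> l j = f j \<oplus> g j)"
    and ex: "exact_at R P d m L"
  shows "exact_at R P d m {l \<in> L. \<forall>j. l j \<in> I}"
  unfolding exact_at_def
proof (intro ballI impI)
  let ?LI = "{l \<in> L. \<forall>j. l j \<in> I}" and ?LJ = "{l \<in> L. \<forall>j. l j \<in> J}"
  have LI: "?LI \<subseteq> Vec C" and LJ: "?LJ \<subseteq> Vec C" using L by auto
  interpret P1: module R "P (Suc m)" by (rule module_P)
  interpret P2: module R "P (Suc (Suc m))" by (rule module_P)
  have split: "\<exists>f\<in>LP R ?LI (P n). \<exists>g\<in>LP R ?LJ (P n). \<forall>j. w j = f j \<oplus>\<^bsub>P n\<^esub> g j"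
    if "w \<in> LP R L (P n)" for w n
    using that
  proof induction
    case LP_zero
    interpret Pn: module R "P n" by (rule module_P)
    show ?case by (rule bexI[OF _ LP.LP_zero], rule bexI[OF _ LP.LP_zero]) simp
  next
    case (LP_step l p u)
    interpret Pn: module R "P n" by (rule module_P)
    obtain f g where fg: "f \<in> LP R ?LI (P n)" "g \<in> LP R ?LJ (P n)" "\<And>j. u j = f j \<oplus>\<^bsub>P n\<^esub> g j"
      using LP_step by auto
    obtain f' g' where fg': "f' \<in> ?LI" "g' \<in> ?LJ" "\<And>j. l j = f' j \<oplus> g' j"
      using dec[OF LP_step(1)] by auto
    have "f' j \<in> carrier R" "g' j \<in> carrier R" "f j \<in> carrier (P n)" "g j \<in> carrier (P n)" for j
      using fg'(1,2) LI LJ free_closed[of f'] free_closed[of g'] LP_closed[OF module_P LI fg(1)]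
        LP_closed[OF module_P LJ fg(2)] by (meson subsetD)+
    then have "l j \<odot>\<^bsub>P n\<^esub> p \<oplus>\<^bsub>P n\<^esub> u j = (f' j \<odot>\<^bsub>P n\<^esub> p \<oplus>\<^bsub>P n\<^esub> f j) \<oplus>\<^bsub>P n\<^esub> (g' j \<odot>\<^bsub>P n\<^esub> p \<oplus>\<^bsub>P n\<^esub> g j)" for j
      using fg fg' LP_step(2) by (simp add: Pn.smult_l_distr Pn.a_ac)
    then show ?case
      by (intro bexI[OF _ LP.LP_step[OF fg'(1) LP_step(2) fg(1)]]
        bexI[OF _ LP.LP_step[OF fg'(2) LP_step(2) fg(2)]]) simp
  qed
  fix u assume u: "u \<in> LP R ?LI (P (Suc m))" and du: "\<forall>j. d m (u j) = \<zero>\<^bsub>P m\<^esub>"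
  have "u \<in> LP R L (P (Suc m))" by (rule LP_mono[OF _ u]) auto
  then obtain w where w: "w \<in> LP R L (P (Suc (Suc m)))" "\<And>j. u j = d (Suc m) (w j)"
    using ex du unfolding exact_at_def by blast
  obtain f g where fg: "f \<in> LP R ?LI (P (Suc (Suc m)))" "g \<in> LP R ?LJ (P (Suc (Suc m)))"
     "\<And>j. w j = f j \<oplus>\<^bsub>P (Suc (Suc m))\<^esub> g j"
    using split[OF w(1)] by auto
  note fc = LP_closed[OF module_P LI fg(1)] and gc = LP_closed[OF module_P LJ fg(2)]
  note uc = LP_closed[OF module_P LI u]
  have df: "(\<lambda>j. d (Suc m) (f j)) \<in> LP R ?LI (P (Suc m))"
    by (rule LP_hom[OF module_P module_P d_hom LI fg(1)])
  have dg: "(\<lambda>j. d (Suc m) (g j)) \<in> LP R ?LJ (P (Suc m))"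
    by (rule LP_hom[OF module_P module_P d_hom LJ fg(2)])
  note dfc = LP_closed[OF module_P LI df] and dgc = LP_closed[OF module_P LJ dg]
  have sum: "u j = d (Suc m) (f j) \<oplus>\<^bsub>P (Suc m)\<^esub> d (Suc m) (g j)" for j
    using w(2) fg(3) fc gc module_homD(2)[OF d_hom] by simp
  then have dg_eq: "d (Suc m) (g j) = u j \<ominus>\<^bsub>P (Suc m)\<^esub> d (Suc m) (f j)" for j
    using dfc dgc by (metis P1.a_comm P1.add.inv_solve_right P1.minus_eq uc)
  have dg_I: "(\<lambda>j. d (Suc m) (g j)) \<in> LP R ?LI (P (Suc m))"
    unfolding dg_eq by (rule LP_minus[OF module_P LI u df])
  obtain B :: "'p set" and s r where s: "s \<in> Hom (P (Suc m)) (Free B)"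
    and r: "r \<in> Hom (Free B) (P (Suc m))" and rs: "\<And>x. x \<in> carrier (P (Suc m)) \<Longrightarrow> r (s x) = x"
    using projective[of "Suc m"] unfolding projective_module_def by blast
  have "d (Suc m) (g j) = \<zero>\<^bsub>P (Suc m)\<^esub>" for j
  proof -
    have "s (d (Suc m) (g j)) b = \<zero>" for b
      using LP_in_ideal[OF I LI _ dg_I s, of j b] LP_in_ideal[OF J LJ _ dg s, of j b] IJ by auto
    then have "s (d (Suc m) (g j)) = \<zero>\<^bsub>Free B\<^esub>" by auto
    then show ?thesis using rs[OF dgc] module_hom_zero[OF module_free module_P r] by metis
  qed
  then have "u j = d (Suc m) (f j)" for j using sum dfc by simp
  then show "\<exists>u'\<in>LP R ?LI (P (Suc (Suc m))). \<forall>j. u j = d (Suc m) (u' j)" using fg(1) by blast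
qed

end

context cring
begin

text \<open>The module axioms pass along a surjection that respects the operations. As
  \<open>Q\<close> is not yet known to be a module, nothing ties its zero to its addition, and
  compatibility with zero is a separate assumption.\<close>

lemma module_surj:
  assumes "module R M" "h ` carrier M = carrier Q" "h \<zero>\<^bsub>M\<^esub> = \<zero>\<^bsub>Q\<^esub>"
    "\<And>x y. x \<in> carrier M \<Longrightarrow> y \<in> carrier M \<Longrightarrow> h (x \<oplus>\<^bsub>M\<^esub> y) = h x \<oplus>\<^bsub>Q\<^esub> h y"
    "\<And>a x. a \<in> carrier R \<Longrightarrow> x \<in> carrier M \<Longrightarrow> h (a \<odot>\<^bsub>M\<^esub> x) = a \<odot>\<^bsub>Q\<^esub> h x"
  shows "module R Q"
proof -
  interpret M: module R M by fact
  have rep: "\<exists>x\<in>carrier M. q = h x" if "q \<in> carrier Q" for q using that assms(2) by auto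
  have cl: "h x \<in> carrier Q" if "x \<in> carrier M" for x using that assms(2) by auto
  note hs = assms(4,5)[symmetric]
  show ?thesis
  proof (rule moduleI)
    show "abelian_group Q"
    proof (rule abelian_groupI)
      fix q assume "q \<in> carrier Q"
      then obtain x where x: "x \<in> carrier M" "q = h x" using rep by blast
      then have "h (\<ominus>\<^bsub>M\<^esub> x) \<oplus>\<^bsub>Q\<^esub> q = \<zero>\<^bsub>Q\<^esub>" using hs assms(3) by (simp add: M.l_neg)
      then show "\<exists>y\<in>carrier Q. y \<oplus>\<^bsub>Q\<^esub> q = \<zero>\<^bsub>Q\<^esub>"
        by (intro bexI[of _ "h (\<ominus>\<^bsub>M\<^esub> x)"] cl M.a_inv_closed x(1))
    next
      show "\<zero>\<^bsub>Q\<^esub> \<in> carrier Q" using cl[OF M.zero_closed] assms(3) by simp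
    next
      fix p q r assume p: "p \<in> carrier Q" and q: "q \<in> carrier Q" and r: "r \<in> carrier Q"
      obtain x where "x \<in> carrier M" "p = h x" using rep[OF p] by blast
      moreover obtain y where "y \<in> carrier M" "q = h y" using rep[OF q] by blast
      moreover obtain z where "z \<in> carrier M" "r = h z" using rep[OF r] by blast
      ultimately show "p \<oplus>\<^bsub>Q\<^esub> q \<oplus>\<^bsub>Q\<^esub> r = p \<oplus>\<^bsub>Q\<^esub> (q \<oplus>\<^bsub>Q\<^esub> r)" by (simp add: hs M.a_assoc)
    next
      fix p q assume p: "p \<in> carrier Q" and q: "q \<in> carrier Q"
      obtain x y where x: "x \<in> carrier M" "p = h x" "y \<in> carrier M" "q = h y"
        using rep[OF p] rep[OF q] by blast
      then show "p \<oplus>\<^bsub>Q\<^esub> q = q \<oplus>\<^bsub>Q\<^esub> p" by (simp add: hs M.a_comm)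
      show "p \<oplus>\<^bsub>Q\<^esub> q \<in> carrier Q" using x cl by (simp add: hs)
    next
      fix p assume "p \<in> carrier Q"
      then obtain x where x: "x \<in> carrier M" "p = h x" using rep by blast
      then show "\<zero>\<^bsub>Q\<^esub> \<oplus>\<^bsub>Q\<^esub> p = p" by (simp add: hs assms(3)[symmetric])
    qed
  next
    fix a p assume a: "a \<in> carrier R" and "p \<in> carrier Q"
    then obtain x where x: "x \<in> carrier M" "p = h x" using rep by blast
    show "a \<odot>\<^bsub>Q\<^esub> p \<in> carrier Q" using a x cl by (simp add: hs)
    { fix b assume "b \<in> carrier R"
      then show "(a \<oplus> b) \<odot>\<^bsub>Q\<^esub> p = a \<odot>\<^bsub>Q\<^esub> p \<oplus>\<^bsub>Q\<^esub> b \<odot>\<^bsub>Q\<^esub> p" "a \<otimes> b \<odot>\<^bsub>Q\<^esub> p = a \<odot>\<^bsub>Q\<^esub> (b \<odot>\<^bsub>Q\<^esub> p)"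
        using a x by (simp_all add: hs M.smult_l_distr M.smult_assoc1) }
    { fix q assume "q \<in> carrier Q"
      then obtain y where "y \<in> carrier M" "q = h y" using rep by blast
      then show "a \<odot>\<^bsub>Q\<^esub> (p \<oplus>\<^bsub>Q\<^esub> q) = a \<odot>\<^bsub>Q\<^esub> p \<oplus>\<^bsub>Q\<^esub> a \<odot>\<^bsub>Q\<^esub> q"
        using a x by (simp add: hs M.smult_r_distr) }
  next
    fix p assume "p \<in> carrier Q"
    then obtain x where x: "x \<in> carrier M" "p = h x" using rep by blast
    then show "\<one> \<odot>\<^bsub>Q\<^esub> p = p" by (simp add: hs)
  qed (rule is_cring)
qed

subsection \<open>Quotient modules\<close>

lemma submodule_abelian_subgroup:
  assumes "module R M" "submodule H R M"
  shows "abelian_subgroup H M"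
  using assms by (intro abelian_subgroupI3 additive_subgroupI submodule.axioms(1) module.axioms(2)) 

lemma quotient_module_carrier:
  "carrier (quotient_module M H) = (\<lambda>x. H +>\<^bsub>M\<^esub> x) ` carrier M"
  by (auto simp: quotient_module_def A_RCOSETS_def RCOSETS_def a_r_coset_def)

lemma coset_eq_iff:
  assumes "module R M" "submodule H R M" "x \<in> carrier M" "y \<in> carrier M"
  shows "H +>\<^bsub>M\<^esub> x = H +>\<^bsub>M\<^esub> y \<longleftrightarrow> x \<ominus>\<^bsub>M\<^esub> y \<in> H"
proof -
  interpret M: module R M by fact
  interpret H: abelian_subgroup H M using submodule_abelian_subgroup assms by blast
  have "H +>\<^bsub>M\<^esub> x = H +>\<^bsub>M\<^esub> y \<longleftrightarrow> x \<in> H +>\<^bsub>M\<^esub> y"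
    using H.a_rcos_self[OF assms(3)] M.a_repr_independence[OF _ assms(4)] H.a_subgroup by metis
  also have "\<dots> \<longleftrightarrow> x \<ominus>\<^bsub>M\<^esub> y \<in> H"
    using H.a_rcos_module[OF assms(4,3)] by (simp add: M.minus_eq)
  finally show ?thesis .
qed

lemma quotient_cls_add:
  assumes "module R M" "submodule H R M" "x \<in> carrier M" "y \<in> carrier M"
  shows "(H +>\<^bsub>M\<^esub> x) \<oplus>\<^bsub>quotient_module M H\<^esub> (H +>\<^bsub>M\<^esub> y) = H +>\<^bsub>M\<^esub> (x \<oplus>\<^bsub>M\<^esub> y)"
  using abelian_subgroup.a_rcos_sum[OF submodule_abelian_subgroup[OF assms(1,2)] assms(3,4)]
  by (simp add: quotient_module_def)

text \<open>The scalar multiple of a coset is defined as a union over all representatives; the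
  cosets in this union coincide because \<open>H\<close> is closed under scalars.\<close>

lemma quotient_cls_smult:
  assumes "module R M" "submodule H R M" "a \<in> carrier R" "x \<in> carrier M"
  shows "a \<odot>\<^bsub>quotient_module M H\<^esub> (H +>\<^bsub>M\<^esub> x) = H +>\<^bsub>M\<^esub> (a \<odot>\<^bsub>M\<^esub> x)"
proof -
  interpret M: module R M by fact
  interpret H: abelian_subgroup H M using submodule_abelian_subgroup assms by blast
  have "H +>\<^bsub>M\<^esub> (a \<odot>\<^bsub>M\<^esub> y) = H +>\<^bsub>M\<^esub> (a \<odot>\<^bsub>M\<^esub> x)" if "y \<in> H +>\<^bsub>M\<^esub> x" for y
  proof -
    have y: "y \<in> carrier M" using H.a_elemrcos_carrier[OF assms(4) that] .
    have "H +>\<^bsub>M\<^esub> y = H +>\<^bsub>M\<^esub> x" using M.a_repr_independence[OF that assms(4) H.a_subgroup] by simp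
    then have "y \<ominus>\<^bsub>M\<^esub> x \<in> H" using coset_eq_iff[OF assms(1,2) y assms(4)] by simp
    then have "a \<odot>\<^bsub>M\<^esub> (y \<ominus>\<^bsub>M\<^esub> x) \<in> H" using M.submoduleE(4)[OF assms(2)] assms by auto
    moreover have "a \<odot>\<^bsub>M\<^esub> (y \<ominus>\<^bsub>M\<^esub> x) = a \<odot>\<^bsub>M\<^esub> y \<ominus>\<^bsub>M\<^esub> a \<odot>\<^bsub>M\<^esub> x"
      using assms y by (simp add: M.minus_eq M.smult_r_distr M.smult_r_minus)
    ultimately show ?thesis using coset_eq_iff[OF assms(1,2)] assms y by simp
  qed
  moreover have "x \<in> H +>\<^bsub>M\<^esub> x" using H.a_rcos_self assms by simp
  ultimately have "(\<Union>y\<in>H +>\<^bsub>M\<^esub> x. H +>\<^bsub>M\<^esub> (a \<odot>\<^bsub>M\<^esub> y)) = H +>\<^bsub>M\<^esub> (a \<odot>\<^bsub>M\<^esub> x)" by blast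
  then show ?thesis by (simp add: quotient_module_def)
qed

lemma quotient_zero: "\<zero>\<^bsub>quotient_module M H\<^esub> = H"
  by (simp add: quotient_module_def)

lemma coset_zero:
  assumes "module R M" "submodule H R M"
  shows "H +>\<^bsub>M\<^esub> \<zero>\<^bsub>M\<^esub> = H"
  by (metis abelian_group.a_coset_add_zero assms module.axioms(2) module.submoduleE(1))

lemma module_quotient:
  assumes "module R M" "submodule H R M"
  shows "module R (quotient_module M H)"
  by (rule module_surj[OF assms(1), where h = "\<lambda>x. H +>\<^bsub>M\<^esub> x"])
    (simp_all add: quotient_module_carrier quotient_cls_add[OF assms] quotient_cls_smult[OF assms]
      coset_zero[OF assms] quotient_zero)

lemma quotient_cls_hom:
  assumes "module R M" "submodule H R M"
  shows "(\<lambda>x. H +>\<^bsub>M\<^esub> x) \<in> Hom M (quotient_module M H)"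
  by (rule module_homI)
    (simp_all add: quotient_module_carrier quotient_cls_add[OF assms] quotient_cls_smult[OF assms])

subsection \<open>Tensor products\<close>

lemma tensor_relations_subset:
  assumes "module R M" "module R N"
  shows "tensor_relations R M N \<subseteq> Vec (carrier M \<times> carrier N)"
proof -
  interpret M: module R M by fact
  interpret N: module R N by fact
  interpret F: module R "Free (carrier M \<times> carrier N)" by (rule module_free)
  show ?thesis unfolding tensor_relations_def Let_def
    by (auto simp del: free_simps intro!: F.minus_closed F.a_closed F.smult_closed)
qed

lemma submodule_tensor_kernel:
  assumes "module R M" "module R N"
  shows "submodule (tensor_kernel R M N) R (Free (carrier M \<times> carrier N))"
  unfolding tensor_kernel_def
  by (rule submodule_span_of[OF module_free tensor_relations_subset[OF assms]])

lemma module_tensor: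
  assumes "module R M" "module R N"
  shows "module R (tensor_module R M N)"
  unfolding tensor_module_def by (rule module_quotient[OF module_free submodule_tensor_kernel[OF assms]])

definition tcls :: "('a, 'm) module \<Rightarrow> ('a, 'n) module \<Rightarrow> ('m \<times> 'n \<Rightarrow> 'a) \<Rightarrow> ('m \<times> 'n \<Rightarrow> 'a) set"
  where "tcls M N v = tensor_kernel R M N +>\<^bsub>Free (carrier M \<times> carrier N)\<^esub> v"

lemma tcls_hom:
  assumes "module R M" "module R N"
  shows "tcls M N \<in> Hom (Free (carrier M \<times> carrier N)) (tensor_module R M N)"
  using quotient_cls_hom[OF module_free submodule_tensor_kernel[OF assms]]
  unfolding tcls_def tensor_module_def .

lemma tcls_surj: "carrier (tensor_module R M N) = tcls M N ` Vec (carrier M \<times> carrier N)"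
  unfolding tcls_def tensor_module_def by (rule quotient_module_carrier)

lemma tcls_eq_iff:
  assumes "module R M" "module R N" "v \<in> Vec (carrier M \<times> carrier N)"
    "w \<in> Vec (carrier M \<times> carrier N)"
  shows "tcls M N v = tcls M N w \<longleftrightarrow> v \<ominus>\<^bsub>Free (carrier M \<times> carrier N)\<^esub> w \<in> tensor_kernel R M N"
  unfolding tcls_def by (rule coset_eq_iff[OF module_free submodule_tensor_kernel[OF assms(1,2)] assms(3,4)])

lemma tcls_basis: "tcls M N (\<e> (x, y)) = pure_tensor R M N x y"
  unfolding tcls_def pure_tensor_def by simp

lemma pure_tensor_closed:
  assumes "module R M" "module R N" "x \<in> carrier M" "y \<in> carrier N"
  shows "pure_tensor R M N x y \<in> carrier (tensor_module R M N)"
  using module_homD(1)[OF tcls_hom[OF assms(1,2)], of "\<e> (x, y)"] assms by (simp add: tcls_basis)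

lemma pure_tensor_bilinear:
  assumes "module R M" "module R N"
  shows "\<And>x x' y. x \<in> carrier M \<Longrightarrow> x' \<in> carrier M \<Longrightarrow> y \<in> carrier N \<Longrightarrow>
      pure_tensor R M N (x \<oplus>\<^bsub>M\<^esub> x') y = pure_tensor R M N x y \<oplus>\<^bsub>tensor_module R M N\<^esub> pure_tensor R M N x' y"
    and "\<And>x y y'. x \<in> carrier M \<Longrightarrow> y \<in> carrier N \<Longrightarrow> y' \<in> carrier N \<Longrightarrow>
      pure_tensor R M N x (y \<oplus>\<^bsub>N\<^esub> y') = pure_tensor R M N x y \<oplus>\<^bsub>tensor_module R M N\<^esub> pure_tensor R M N x y'"
    and "\<And>a x y. a \<in> carrier R \<Longrightarrow> x \<in> carrier M \<Longrightarrow> y \<in> carrier N \<Longrightarrow>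
      pure_tensor R M N (a \<odot>\<^bsub>M\<^esub> x) y = a \<odot>\<^bsub>tensor_module R M N\<^esub> pure_tensor R M N x y"
    and "\<And>a x y. a \<in> carrier R \<Longrightarrow> x \<in> carrier M \<Longrightarrow> y \<in> carrier N \<Longrightarrow>
      pure_tensor R M N x (a \<odot>\<^bsub>N\<^esub> y) = a \<odot>\<^bsub>tensor_module R M N\<^esub> pure_tensor R M N x y"
proof -
  interpret M: module R M by fact
  interpret N: module R N by fact
  let ?F = "Free (carrier M \<times> carrier N)"
  interpret F: module R ?F by (rule module_free)
  have b: "\<e> (x, y) \<in> carrier ?F" if "x \<in> carrier M" "y \<in> carrier N" for x y
    using that by simp
  note h = tcls_hom[OF assms]
  have rel: "v \<ominus>\<^bsub>?F\<^esub> w \<in> tensor_relations R M N \<Longrightarrow> v \<in> carrier ?F \<Longrightarrow> w \<in> carrier ?F \<Longrightarrow>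
      tcls M N v = tcls M N w" for v w
    using tcls_eq_iff[OF assms, of v w] span_of_superset[of "tensor_relations R M N" ?F]
    unfolding tensor_kernel_def by blast
  { fix x x' y assume "x \<in> carrier M" "x' \<in> carrier M" "y \<in> carrier N"
    then have "tcls M N (\<e> (x \<oplus>\<^bsub>M\<^esub> x', y))
      = tcls M N (\<e> (x, y) \<oplus>\<^bsub>?F\<^esub> \<e> (x', y))"
      by (intro rel b F.a_closed) (auto simp: tensor_relations_def Let_def simp del: free_simps)
    with \<open>x \<in> carrier M\<close> \<open>x' \<in> carrier M\<close> \<open>y \<in> carrier N\<close>
    show "pure_tensor R M N (x \<oplus>\<^bsub>M\<^esub> x') y = pure_tensor R M N x y \<oplus>\<^bsub>tensor_module R M N\<^esub> pure_tensor R M N x' y"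
      using module_homD(2)[OF h b b] by (simp add: tcls_basis del: free_simps) }
  { fix x y y' assume "x \<in> carrier M" "y \<in> carrier N" "y' \<in> carrier N"
    then have "tcls M N (\<e> (x, y \<oplus>\<^bsub>N\<^esub> y'))
      = tcls M N (\<e> (x, y) \<oplus>\<^bsub>?F\<^esub> \<e> (x, y'))"
      by (intro rel b F.a_closed) (auto simp: tensor_relations_def Let_def simp del: free_simps)
    with \<open>x \<in> carrier M\<close> \<open>y \<in> carrier N\<close> \<open>y' \<in> carrier N\<close>
    show "pure_tensor R M N x (y \<oplus>\<^bsub>N\<^esub> y') = pure_tensor R M N x y \<oplus>\<^bsub>tensor_module R M N\<^esub> pure_tensor R M N x y'"
      using module_homD(2)[OF h b b] by (simp add: tcls_basis del: free_simps) }
  { fix a x y assume "a \<in> carrier R" "x \<in> carrier M" "y \<in> carrier N"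
    then have "tcls M N (\<e> (a \<odot>\<^bsub>M\<^esub> x, y)) = tcls M N (a \<odot>\<^bsub>?F\<^esub> \<e> (x, y))"
      by (intro rel b F.smult_closed) (auto simp: tensor_relations_def Let_def simp del: free_simps)
    with \<open>a \<in> carrier R\<close> \<open>x \<in> carrier M\<close> \<open>y \<in> carrier N\<close>
    show "pure_tensor R M N (a \<odot>\<^bsub>M\<^esub> x) y = a \<odot>\<^bsub>tensor_module R M N\<^esub> pure_tensor R M N x y"
      using module_homD(3)[OF h _ b] by (simp add: tcls_basis del: free_simps) }
  { fix a x y assume "a \<in> carrier R" "x \<in> carrier M" "y \<in> carrier N"
    then have "tcls M N (\<e> (x, a \<odot>\<^bsub>N\<^esub> y)) = tcls M N (a \<odot>\<^bsub>?F\<^esub> \<e> (x, y))"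
      by (intro rel b F.smult_closed) (auto simp: tensor_relations_def Let_def simp del: free_simps)
    with \<open>a \<in> carrier R\<close> \<open>x \<in> carrier M\<close> \<open>y \<in> carrier N\<close>
    show "pure_tensor R M N x (a \<odot>\<^bsub>N\<^esub> y) = a \<odot>\<^bsub>tensor_module R M N\<^esub> pure_tensor R M N x y"
      using module_homD(3)[OF h _ b] by (simp add: tcls_basis del: free_simps) }
qed

lemma tensor_kernel_least:
  assumes "submodule H R (Free (carrier M \<times> carrier N))" "tensor_relations R M N \<subseteq> H"
  shows "tensor_kernel R M N \<subseteq> H"
  unfolding tensor_kernel_def by (rule span_of_least[OF assms])

text \<open>Lift of \<open>f \<otimes> N\<close> to the free modules of which the two tensor
  products are quotients.\<close>

definition push :: "('a, 'n) module \<Rightarrow> ('a, 'q) module \<Rightarrow> ('m \<Rightarrow> 'q) \<Rightarrow> ('m \<times> 'n \<Rightarrow> 'a) \<Rightarrow> 'q \<times> 'n \<Rightarrow> 'a"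
  where "push N M' f = lin R (Free (carrier M' \<times> carrier N)) (\<lambda>(x, y). \<e> (f x, y))"

lemma push_hom:
  assumes "f \<in> Hom M M'"
  shows "push N M' f \<in> Hom (Free (carrier M \<times> carrier N)) (Free (carrier M' \<times> carrier N))"
  unfolding push_def by (rule lin_hom[OF module_free]) (use module_homD(1)[OF assms] in auto)

lemma push_basis:
  assumes "f \<in> Hom M M'" "x \<in> carrier M" "y \<in> carrier N"
  shows "push N M' f (\<e> (x, y)) = \<e> (f x, y)"
  unfolding push_def
  using lin_basis[of "Free (carrier M' \<times> carrier N)" "\<lambda>(x, y). \<e> (f x, y)" "(x, y)", OF module_free]
    module_homD(1)[OF assms(1)] assms by simp

text \<open>Makes the induced map on tensor products well defined: the kernel is generated by four
  kinds of relations, and bilinearity of pure tensors sends each of them to zero.\<close>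

lemma push_kernel:
  assumes M: "module R M" and M': "module R M'" and N: "module R N" and f: "f \<in> Hom M M'"
    and v: "v \<in> tensor_kernel R M N"
  shows "tcls M' N (push N M' f v) = \<zero>\<^bsub>tensor_module R M' N\<^esub>"
proof -
  interpret M: module R M by fact
  interpret M': module R M' by fact
  interpret N: module R N by fact
  let ?F = "Free (carrier M \<times> carrier N)"
  interpret F: module R ?F by (rule module_free)
  interpret T: module R "tensor_module R M' N" by (rule module_tensor[OF M' N])
  let ?g = "\<lambda>v. tcls M' N (push N M' f v)"
  have g: "?g \<in> Hom ?F (tensor_module R M' N)"
    by (rule module_hom_comp[OF push_hom[OF f] tcls_hom[OF M' N]])
  have gb: "?g (\<e> (x, y)) = pure_tensor R M' N (f x) y" if "x \<in> carrier M" "y \<in> carrier N" for x y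
    using push_basis[OF f that] by (simp add: tcls_basis)
  note b = basis_vector_closed[of _ "carrier M \<times> carrier N"]
  have gm: "?g (u \<ominus>\<^bsub>?F\<^esub> w) = \<zero>\<^bsub>tensor_module R M' N\<^esub>"
    if "u \<in> carrier ?F" "w \<in> carrier ?F" "?g u = ?g w" for u w
    using module_hom_minus[OF module_free T.module_axioms g that(1,2)] that module_homD(1)[OF g]
    by (simp add: T.minus_eq T.r_neg)
  note pb = pure_tensor_bilinear[OF M' N]
  have "tensor_relations R M N \<subseteq> {v \<in> carrier ?F. ?g v = \<zero>\<^bsub>tensor_module R M' N\<^esub>}"
  proof
    fix v assume v: "v \<in> tensor_relations R M N"
    have "?g v = \<zero>\<^bsub>tensor_module R M' N\<^esub>"
      using v unfolding tensor_relations_def Let_def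
      apply (elim UnE CollectE exE conjE)
      subgoal
        by (simp del: free_simps, rule gm, simp del: free_simps, intro F.a_closed b, simp_all del: free_simps
            add: module_homD(2)[OF g b b] gb pb module_homD[OF f])
      subgoal
        by (simp del: free_simps, rule gm, simp del: free_simps, intro F.a_closed b, simp_all del: free_simps
            add: module_homD(2)[OF g b b] gb pb module_homD[OF f])
      subgoal
        by (simp del: free_simps, rule gm, simp del: free_simps, intro F.smult_closed b, simp_all del: free_simps
            add: module_homD(3)[OF g _ b] gb pb module_homD[OF f])
      subgoal
        by (simp del: free_simps, rule gm, simp del: free_simps, intro F.smult_closed b, simp_all del: free_simps
            add: module_homD(3)[OF g _ b] gb pb module_homD[OF f])
      done
    then show "v \<in> {v \<in> carrier ?F. ?g v = \<zero>\<^bsub>tensor_module R M' N\<^esub>}"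
      using v tensor_relations_subset[OF M N] by auto
  qed
  from tensor_kernel_least[OF submodule_kernel[OF module_free T.module_axioms g] this] v
  show ?thesis by auto
qed

text \<open>Resolves the definite description in \<open>tensor_map\<close>. The map \<open>h\<close>
  induced by \<open>push\<close> has the required properties; a competitor agrees with it on the
  classes of basis vectors, hence on the carrier, and extensionality settles the other
  values.\<close>

lemma tensor_map_cls:
  assumes M: "module R M" and M': "module R M'" and N: "module R N" and f: "f \<in> Hom M M'"
    and v: "v \<in> Vec (carrier M \<times> carrier N)"
  shows "tensor_map R M M' N f (tcls M N v) = tcls M' N (push N M' f v)"
proof -
  let ?F = "Free (carrier M \<times> carrier N)"
  let ?T = "tensor_module R M N" and ?T' = "tensor_module R M' N"
  interpret F: module R ?F by (rule module_free)
  interpret T: module R ?T by (rule module_tensor[OF M N])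
  interpret T': module R ?T' by (rule module_tensor[OF M' N])
  let ?g = "\<lambda>v. tcls M' N (push N M' f v)"
  have g: "?g \<in> Hom ?F ?T'"
    by (rule module_hom_comp[OF push_hom[OF f] tcls_hom[OF M' N]])
  note c = tcls_hom[OF M N]
  define h where "h = restrict (\<lambda>t. ?g (SOME v. v \<in> carrier ?F \<and> tcls M N v = t)) (carrier ?T)"
  have hc: "h (tcls M N v) = ?g v" if v: "v \<in> carrier ?F" for v
  proof -
    let ?w = "SOME w. w \<in> carrier ?F \<and> tcls M N w = tcls M N v"
    have w: "?w \<in> carrier ?F \<and> tcls M N ?w = tcls M N v" by (rule someI[of _ v]) (use v in simp)
    then have "?w \<ominus>\<^bsub>?F\<^esub> v \<in> tensor_kernel R M N" using tcls_eq_iff[OF M N _ v] by blast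
    then have "?g (?w \<ominus>\<^bsub>?F\<^esub> v) = \<zero>\<^bsub>?T'\<^esub>" by (rule push_kernel[OF M M' N f])
    then have "?g ?w \<ominus>\<^bsub>?T'\<^esub> ?g v = \<zero>\<^bsub>?T'\<^esub>"
      using module_hom_minus[OF module_free T'.module_axioms g _ v] w by simp
    then have "?g ?w = ?g v"
      using iffD1[OF T'.minus_zero_iff[OF module_homD(1)[OF g] module_homD(1)[OF g v]]] w by blast
    then show ?thesis unfolding h_def using module_homD(1)[OF c v] by simp
  qed
  have hh: "h \<in> Hom ?T ?T'"
  proof (rule module_homI)
    fix s t assume "s \<in> carrier ?T" "t \<in> carrier ?T"
    then obtain v w where v: "v \<in> carrier ?F" "s = tcls M N v" and w: "w \<in> carrier ?F" "t = tcls M N w"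
      unfolding tcls_surj by auto
    have "h (s \<oplus>\<^bsub>?T\<^esub> t) = h (tcls M N (v \<oplus>\<^bsub>?F\<^esub> w))"
      using module_homD(2)[OF c v(1) w(1)] v w by simp
    also have "\<dots> = h s \<oplus>\<^bsub>?T'\<^esub> h t"
      using hc[OF F.a_closed[OF v(1) w(1)]] hc v w module_homD(2)[OF g v(1) w(1)] by simp
    finally show "h (s \<oplus>\<^bsub>?T\<^esub> t) = h s \<oplus>\<^bsub>?T'\<^esub> h t" .
  next
    fix s assume "s \<in> carrier ?T"
    then obtain v where v: "v \<in> carrier ?F" "s = tcls M N v" unfolding tcls_surj by auto
    then show "h s \<in> carrier ?T'" using hc module_homD(1)[OF g] by simp
    fix a assume a: "a \<in> carrier R"
    have "h (a \<odot>\<^bsub>?T\<^esub> s) = h (tcls M N (a \<odot>\<^bsub>?F\<^esub> v))"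
      using module_homD(3)[OF c a v(1)] v by simp
    also have "\<dots> = a \<odot>\<^bsub>?T'\<^esub> h s"
      using hc[OF F.smult_closed[OF a v(1)]] hc v module_homD(3)[OF g a v(1)] by simp
    finally show "h (a \<odot>\<^bsub>?T\<^esub> s) = a \<odot>\<^bsub>?T'\<^esub> h s" .
  qed
  have hp: "h (pure_tensor R M N x y) = pure_tensor R M' N (f x) y" if "x \<in> carrier M" "y \<in> carrier N" for x y
    using hc[of "\<e> (x, y)"] that push_basis[OF f that] by (simp add: tcls_basis)
  have "tensor_map R M M' N f = h"
    unfolding tensor_map_def
  proof (rule the_equality)
    show "h \<in> Hom ?T ?T' \<and> h \<in> extensional (carrier ?T) \<and>
       (\<forall>x \<in> carrier M. \<forall>y \<in> carrier N. h (pure_tensor R M N x y) = pure_tensor R M' N (f x) y)"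
      using hh hp by (auto simp: h_def)
  next
    fix k assume k: "k \<in> Hom ?T ?T' \<and> k \<in> extensional (carrier ?T) \<and>
       (\<forall>x \<in> carrier M. \<forall>y \<in> carrier N. k (pure_tensor R M N x y) = pure_tensor R M' N (f x) y)"
    have "k (tcls M N v) = h (tcls M N v)" if v: "v \<in> carrier ?F" for v
    proof (rule hom_free_eqI[OF T'.module_axioms module_hom_comp[OF c, of k] module_hom_comp[OF c hh] _ v])
      show "k \<in> Hom ?T ?T'" using k by simp
      fix b assume "b \<in> carrier M \<times> carrier N"
      then show "k (tcls M N (\<e> b)) = h (tcls M N (\<e> b))"
        using k hp by (cases b) (simp add: tcls_basis)
    qed
    then show "k = h" using k by (intro extensionalityI[of k "carrier ?T"]) (auto simp: tcls_surj h_def)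
  qed
  then show ?thesis using hc[OF v] by simp
qed

text \<open>For a relation \<open>l\<close> the scalars can be moved across: \<open>\<Sum> (l t p
  \<otimes> y t) = p \<otimes> \<Sum> (l t y t) = 0\<close>. So the map
  \<open>P^A \<rightarrow> P \<otimes> N\<close> that takes \<open>x\<close> to
  \<open>\<Sum> (x t \<otimes> y t)\<close> vanishes on \<open>LP\<close>.\<close>

lemma pure_tensor_LP_zero:
  assumes M: "module R M" and N: "module R N" and A: "finite A" and y: "\<And>t. t \<in> A \<Longrightarrow> y t \<in> carrier N"
    and u: "u \<in> LP R {v \<in> Vec A. lin R N y v = \<zero>\<^bsub>N\<^esub>} M"
  shows "(\<Oplus>\<^bsub>tensor_module R M N\<^esub>t\<in>A. pure_tensor R M N (u t) (y t)) = \<zero>\<^bsub>tensor_module R M N\<^esub>"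
  using u
proof induction
  case LP_zero
  interpret M: module R M by fact
  interpret T: module R "tensor_module R M N" by (rule module_tensor[OF M N])
  have "pure_tensor R M N \<zero>\<^bsub>M\<^esub> (y t) = \<zero>\<^bsub>tensor_module R M N\<^esub>" if "t \<in> A" for t
    using pure_tensor_bilinear(3)[OF M N zero_closed M.zero_closed y[OF that]]
      pure_tensor_closed[OF M N M.zero_closed y[OF that]] by simp
  then have "(\<Oplus>\<^bsub>tensor_module R M N\<^esub>t\<in>A. pure_tensor R M N \<zero>\<^bsub>M\<^esub> (y t)) =
    (\<Oplus>\<^bsub>tensor_module R M N\<^esub>t\<in>A. \<zero>\<^bsub>tensor_module R M N\<^esub>)"
    by (intro T.finsum_cong') auto
  then show ?case by (simp add: T.finsum_zero)
next
  case (LP_step l p u)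
  interpret M: module R M by fact
  interpret N: module R N by fact
  interpret T: module R "tensor_module R M N" by (rule module_tensor[OF M N])
  let ?T = "tensor_module R M N"
  have l: "l t \<in> carrier R" for t using LP_step(1) free_closed[of l A] by blast
  have uc: "u t \<in> carrier M" for t by (rule LP_closed[OF M _ LP_step(3), of A]) auto
  note pb = pure_tensor_bilinear[OF M N]
  note pc = pure_tensor_closed[OF M N]
  have hom: "(\<lambda>y. pure_tensor R M N p y) \<in> Hom N ?T"
    using pb pc LP_step(2) by (intro module_homI) auto
  have "(\<Oplus>\<^bsub>?T\<^esub>t\<in>A. pure_tensor R M N (l t \<odot>\<^bsub>M\<^esub> p \<oplus>\<^bsub>M\<^esub> u t) (y t)) =
    (\<Oplus>\<^bsub>?T\<^esub>t\<in>A. pure_tensor R M N p (l t \<odot>\<^bsub>N\<^esub> y t) \<oplus>\<^bsub>?T\<^esub> pure_tensor R M N (u t) (y t))"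
    by (rule T.finsum_cong') (use l uc LP_step(2) y pb pc in auto)
  also have "\<dots> = (\<Oplus>\<^bsub>?T\<^esub>t\<in>A. pure_tensor R M N p (l t \<odot>\<^bsub>N\<^esub> y t)) \<oplus>\<^bsub>?T\<^esub> (\<Oplus>\<^bsub>?T\<^esub>t\<in>A. pure_tensor R M N (u t) (y t))"
    by (rule T.finsum_addf) (use l uc LP_step(2) y pc in auto)
  also have "(\<Oplus>\<^bsub>?T\<^esub>t\<in>A. pure_tensor R M N p (l t \<odot>\<^bsub>N\<^esub> y t)) = pure_tensor R M N p (\<Oplus>\<^bsub>N\<^esub>t\<in>A. l t \<odot>\<^bsub>N\<^esub> y t)"
    by (rule module_hom_finsum[OF N T.module_axioms hom A, symmetric]) (use l y in auto)
  also have "(\<Oplus>\<^bsub>N\<^esub>t\<in>A. l t \<odot>\<^bsub>N\<^esub> y t) = \<zero>\<^bsub>N\<^esub>"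
    using lin_free_eq[OF N A y, where v = l] LP_step(1) by auto
  also have "pure_tensor R M N p \<zero>\<^bsub>N\<^esub> = \<zero>\<^bsub>?T\<^esub>"
    by (rule module_hom_zero[OF N T.module_axioms hom])
  finally show ?case using LP_step(4) by simp
qed

text \<open>Translates exactness of \<open>P \<otimes> N\<close> into the language of
  \<open>LP\<close>, through the identification of \<open>P \<otimes> N\<close> with
  \<open>P^A\<close> modulo \<open>LP\<close> over the relations of \<open>N\<close>. A vector
  \<open>x\<close> that is a cycle modulo \<open>LP\<close> gives a cycle
  \<open>\<Sum> (x t \<otimes> y t)\<close>; this is a boundary, and the inverse map
  \<open>ev\<close> turns it back into a boundary modulo \<open>LP\<close>.\<close>

lemma tensor_exact_LP:
  fixes P1 P2 P3 :: "('a, 'p) module" and N :: "('a, 'n) module" and y :: "'x \<Rightarrow> 'n"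
  assumes P1: "module R P1" and P2: "module R P2" and P3: "module R P3" and N: "module R N"
    and d: "d \<in> Hom P2 P1" and d': "d' \<in> Hom P3 P2"
    and ex: "\<And>Z. Z \<in> carrier (tensor_module R P2 N) \<Longrightarrow>
      tensor_map R P2 P1 N d Z = \<zero>\<^bsub>tensor_module R P1 N\<^esub> \<Longrightarrow>
      \<exists>Y\<in>carrier (tensor_module R P3 N). Z = tensor_map R P3 P2 N d' Y"
    and A: "finite A" and y: "\<And>t. t \<in> A \<Longrightarrow> y t \<in> carrier N"
    and surj: "lin R N y ` Vec A = carrier N"
    and x: "\<And>t. x t \<in> carrier P2" "\<And>t. t \<notin> A \<Longrightarrow> x t = \<zero>\<^bsub>P2\<^esub>"
    and dx: "(\<lambda>t. d (x t)) \<in> LP R {v \<in> Vec A. lin R N y v = \<zero>\<^bsub>N\<^esub>} P1"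
  obtains w where "\<And>t. w t \<in> carrier P3"
    "(\<lambda>t. x t \<ominus>\<^bsub>P2\<^esub> d' (w t)) \<in> LP R {v \<in> Vec A. lin R N y v = \<zero>\<^bsub>N\<^esub>} P2"
proof -
  let ?L = "{v \<in> Vec A. lin R N y v = \<zero>\<^bsub>N\<^esub>}"
  have L: "?L \<subseteq> Vec A" by auto
  let ?F = "Free (carrier P2 \<times> carrier N)"
  let ?F3 = "Free (carrier P3 \<times> carrier N)"
  let ?FA = "Free A"
  interpret P1: module R P1 by fact
  interpret P2: module R P2 by fact
  interpret P3: module R P3 by fact
  interpret N: module R N by fact
  interpret F: module R ?F by (rule module_free)
  interpret FA: module R ?FA by (rule module_free)
  interpret T1: module R "tensor_module R P1 N" by (rule module_tensor[OF P1 N])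
  interpret T2: module R "tensor_module R P2 N" by (rule module_tensor[OF P2 N])
  note ly = lin_hom[OF N y]
  have Lsub: "submodule ?L R ?FA" by (rule submodule_kernel[OF module_free N ly])
  have "\<forall>n\<in>carrier N. \<exists>v\<in>carrier ?FA. lin R N y v = n" unfolding surj[symmetric] by auto
  \<comment> \<open>A section of the cover of \<open>N\<close> as a map of sets. It is not linear in
    general, but its defects of linearity are relations, that is, elements of
    \<open>?L\<close>.\<close>
  then obtain c where c: "\<And>n. n \<in> carrier N \<Longrightarrow> c n \<in> carrier ?FA \<and> lin R N y (c n) = n" by metis
  have cR: "c n j \<in> carrier R" if "n \<in> carrier N" for n j using c[OF that] free_closed[of "c n" A] by blast
  \<comment> \<open>On \<open>p \<otimes> n\<close> this is the \<open>j\<close>-th entry of the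
    vector \<open>c n\<close> times \<open>p\<close>. Modulo \<open>LP\<close> it is inverse to the
    map that takes \<open>x\<close> to \<open>\<Sum> (x t \<otimes> y t)\<close>.\<close>
  define ev where "ev P j = lin R P (\<lambda>(p, n). c n j \<odot>\<^bsub>P\<^esub> p)" for P :: "('a, 'p) module" and j
  have ev_hom: "ev P j \<in> Hom (Free (carrier P \<times> carrier N)) P" if "module R P" for P j
    unfolding ev_def by (rule lin_hom[OF that]) (use cR module.smult_closed[OF that] in auto)
  have ev_basis: "ev P j (\<e> (p, n)) = c n j \<odot>\<^bsub>P\<^esub> p"
    if "module R P" "p \<in> carrier P" "n \<in> carrier N" for P j p n
    unfolding ev_def using lin_basis[OF that(1), of "\<lambda>(p, n). c n j \<odot>\<^bsub>P\<^esub> p" "(p, n)"]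
      cR module.smult_closed[OF that(1)] that by simp
  let ?H = "{v \<in> carrier ?F. (\<lambda>j. ev P2 j v) \<in> LP R ?L P2}"
  note evh = module_homD[OF ev_hom[OF P2]]
  have H: "submodule ?H R ?F"
  proof (rule F.submoduleI)
    show "\<zero>\<^bsub>?F\<^esub> \<in> ?H"
      using module_hom_zero[OF module_free P2 ev_hom[OF P2]] LP_zero F.zero_closed by (simp del: free_simps)
  next
    fix a assume a: "a \<in> ?H"
    have "(\<lambda>j. (\<ominus> \<one>) \<odot>\<^bsub>P2\<^esub> ev P2 j a) \<in> LP R ?L P2"
      by (rule LP_smult[OF P2 L]) (use a in auto)
    then have "(\<lambda>j. ev P2 j ((\<ominus> \<one>) \<odot>\<^bsub>?F\<^esub> a)) \<in> LP R ?L P2"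
      using evh(3)[of "\<ominus> \<one>" a] a by (simp del: free_simps)
    then show "\<ominus>\<^bsub>?F\<^esub> a \<in> ?H" using a F.smult_l_minus[of \<one> a] by (simp del: free_simps)
  next
    fix a b assume "a \<in> ?H" "b \<in> ?H"
    then show "a \<oplus>\<^bsub>?F\<^esub> b \<in> ?H"
      using LP_add[OF P2 L, of "\<lambda>j. ev P2 j a" "\<lambda>j. ev P2 j b"] evh(2)[of a b] by (simp del: free_simps)
  next
    fix a b assume "a \<in> carrier R" "b \<in> ?H"
    then show "a \<odot>\<^bsub>?F\<^esub> b \<in> ?H"
      using LP_smult[OF P2 L, of "\<lambda>j. ev P2 j b" a] evh(3)[of a b] by (simp del: free_simps)
  qed auto
  note b = basis_vector_closed[of _ "carrier P2 \<times> carrier N"]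
  \<comment> \<open>Common form of the four checks that \<open>ev\<close> maps tensor relations into
    \<open>LP\<close>: under \<open>ev\<close> the two sides of a relation differ by a single
    generator \<open>l p\<close>. For linearity in the first argument \<open>l\<close> is zero, for
    linearity in the second it is the defect of \<open>c\<close>.\<close>
  have rel: "u \<ominus>\<^bsub>?F\<^esub> w \<in> ?H" if "u \<in> carrier ?F" "w \<in> carrier ?F" "l \<in> ?L" "p \<in> carrier P2"
    "\<And>j. ev P2 j u = l j \<odot>\<^bsub>P2\<^esub> p \<oplus>\<^bsub>P2\<^esub> ev P2 j w" for u w l p
  proof -
    have "ev P2 j (u \<ominus>\<^bsub>?F\<^esub> w) = l j \<odot>\<^bsub>P2\<^esub> p" for j
      using module_hom_minus[OF module_free P2 ev_hom[OF P2] that(1,2), of j] that(5)[of j]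
        evh(1)[OF that(1), of j] evh(1)[OF that(2), of j] that(3,4) free_closed[of l A j]
      by (simp add: P2.minus_eq P2.a_assoc P2.r_neg)
    then show ?thesis using LP_single[OF P2 L that(3,4)] that(1,2) by simp
  qed
  have zL: "(\<lambda>_. \<zero>) \<in> ?L" using submodule_zero_closed[OF module_free Lsub] by simp
  have eva: "ev P2 j (v \<oplus>\<^bsub>?F\<^esub> w) = ev P2 j v \<oplus>\<^bsub>P2\<^esub> ev P2 j w" if "v \<in> carrier ?F" "w \<in> carrier ?F" for v w j
    using evh(2) that by simp
  have evs: "ev P2 j (a \<odot>\<^bsub>?F\<^esub> v) = a \<odot>\<^bsub>P2\<^esub> ev P2 j v" if "a \<in> carrier R" "v \<in> carrier ?F" for v a j
    using evh(3) that by simp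
  note evb = ev_basis[OF P2]
  have "tensor_relations R P2 N \<subseteq> ?H"
    unfolding tensor_relations_def Let_def
  proof (intro Un_least subsetI)
    fix v assume "v \<in> {\<e> (x \<oplus>\<^bsub>P2\<^esub> x', y) \<ominus>\<^bsub>?F\<^esub> (\<e> (x, y) \<oplus>\<^bsub>?F\<^esub> \<e> (x', y)) |x x' y.
      x \<in> carrier P2 \<and> x' \<in> carrier P2 \<and> y \<in> carrier N}"
    then obtain x x' y where *: "x \<in> carrier P2" "x' \<in> carrier P2" "y \<in> carrier N"
      "v = \<e> (x \<oplus>\<^bsub>P2\<^esub> x', y) \<ominus>\<^bsub>?F\<^esub> (\<e> (x, y) \<oplus>\<^bsub>?F\<^esub> \<e> (x', y))" by auto
    show "v \<in> ?H" unfolding *(4)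
      by (rule rel[of _ _ "\<lambda>_. \<zero>" x], use * in \<open>simp\<close>, rule F.a_closed[OF b b])
        (use * zL cR in \<open>simp_all add: eva evb P2.smult_r_distr del: free_simps\<close>)
  next
    fix v assume "v \<in> {\<e> (x, y \<oplus>\<^bsub>N\<^esub> y') \<ominus>\<^bsub>?F\<^esub> (\<e> (x, y) \<oplus>\<^bsub>?F\<^esub> \<e> (x, y')) |x y y'.
      x \<in> carrier P2 \<and> y \<in> carrier N \<and> y' \<in> carrier N}"
    then obtain x y y' where *: "x \<in> carrier P2" "y \<in> carrier N" "y' \<in> carrier N"
      "v = \<e> (x, y \<oplus>\<^bsub>N\<^esub> y') \<ominus>\<^bsub>?F\<^esub> (\<e> (x, y) \<oplus>\<^bsub>?F\<^esub> \<e> (x, y'))" by auto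
    let ?l = "c (y \<oplus>\<^bsub>N\<^esub> y') \<ominus>\<^bsub>?FA\<^esub> (c y \<oplus>\<^bsub>?FA\<^esub> c y')"
    have cc: "c (y \<oplus>\<^bsub>N\<^esub> y') \<in> carrier ?FA" "c y \<oplus>\<^bsub>?FA\<^esub> c y' \<in> carrier ?FA" "c y \<in> carrier ?FA" "c y' \<in> carrier ?FA"
      using c * by (auto simp del: free_simps)
    have "?l \<in> ?L"
      using cc module_hom_minus[OF module_free N ly cc(1,2)] module_homD(2)[OF ly cc(3,4)] c *
      by (simp add: N.minus_eq N.r_neg del: free_simps)
    moreover have "?l j = c (y \<oplus>\<^bsub>N\<^esub> y') j \<ominus> (c y j \<oplus> c y' j)" for j
      using fun_cong[OF free_minus[OF cc(1,2)], of j] by simp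
    moreover have "((a \<ominus> (e \<oplus> f)) \<odot>\<^bsub>P2\<^esub> x) \<oplus>\<^bsub>P2\<^esub> (e \<odot>\<^bsub>P2\<^esub> x \<oplus>\<^bsub>P2\<^esub> f \<odot>\<^bsub>P2\<^esub> x) = a \<odot>\<^bsub>P2\<^esub> x"
      if "a \<in> carrier R" "e \<in> carrier R" "f \<in> carrier R" for a e f
      using that * minus_add_cancel[of a "e \<oplus> f"] by (simp add: P2.smult_l_distr[symmetric])
    ultimately show "v \<in> ?H" unfolding *(4)
      by (intro rel[of _ _ ?l x] F.a_closed b)
        (use * cR in \<open>simp_all add: eva evb b del: free_simps\<close>)
  next
    fix v assume "v \<in> {\<e> (a \<odot>\<^bsub>P2\<^esub> x, y) \<ominus>\<^bsub>?F\<^esub> a \<odot>\<^bsub>?F\<^esub> \<e> (x, y) |a x y.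
      a \<in> carrier R \<and> x \<in> carrier P2 \<and> y \<in> carrier N}"
    then obtain a x y where *: "a \<in> carrier R" "x \<in> carrier P2" "y \<in> carrier N"
      "v = \<e> (a \<odot>\<^bsub>P2\<^esub> x, y) \<ominus>\<^bsub>?F\<^esub> a \<odot>\<^bsub>?F\<^esub> \<e> (x, y)" by auto
    show "v \<in> ?H" unfolding *(4)
      by (rule rel[of _ _ "\<lambda>_. \<zero>" x], use * in \<open>simp\<close>, rule F.smult_closed[OF _ b])
        (use * zL cR in \<open>simp_all add: evs evb P2.smult_assoc1[symmetric] m_comm del: free_simps\<close>)
  next
    fix v assume "v \<in> {\<e> (x, a \<odot>\<^bsub>N\<^esub> y) \<ominus>\<^bsub>?F\<^esub> a \<odot>\<^bsub>?F\<^esub> \<e> (x, y) |a x y.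
      a \<in> carrier R \<and> x \<in> carrier P2 \<and> y \<in> carrier N}"
    then obtain a x y where *: "a \<in> carrier R" "x \<in> carrier P2" "y \<in> carrier N"
      "v = \<e> (x, a \<odot>\<^bsub>N\<^esub> y) \<ominus>\<^bsub>?F\<^esub> a \<odot>\<^bsub>?F\<^esub> \<e> (x, y)" by auto
    let ?l = "c (a \<odot>\<^bsub>N\<^esub> y) \<ominus>\<^bsub>?FA\<^esub> (a \<odot>\<^bsub>?FA\<^esub> c y)"
    have cc: "c (a \<odot>\<^bsub>N\<^esub> y) \<in> carrier ?FA" "a \<odot>\<^bsub>?FA\<^esub> c y \<in> carrier ?FA" "c y \<in> carrier ?FA"
      using c * by (auto simp del: free_simps)
    have "?l \<in> ?L"
      using cc module_hom_minus[OF module_free N ly cc(1,2)] module_homD(3)[OF ly *(1) cc(3)] c *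
      by (simp add: N.minus_eq N.r_neg del: free_simps)
    moreover have "?l j = c (a \<odot>\<^bsub>N\<^esub> y) j \<ominus> (a \<otimes> c y j)" for j
      using fun_cong[OF free_minus[OF cc(1,2)], of j] by simp
    moreover have "((e \<ominus> (a \<otimes> f)) \<odot>\<^bsub>P2\<^esub> x) \<oplus>\<^bsub>P2\<^esub> (a \<odot>\<^bsub>P2\<^esub> (f \<odot>\<^bsub>P2\<^esub> x)) = e \<odot>\<^bsub>P2\<^esub> x"
      if "e \<in> carrier R" "f \<in> carrier R" for e f
      using that * minus_add_cancel[of e "a \<otimes> f"] by (simp add: P2.smult_l_distr[symmetric] P2.smult_assoc1[symmetric])
    ultimately show "v \<in> ?H" unfolding *(4)
      by (intro rel[of _ _ ?l x] F.smult_closed b)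
        (use * cR in \<open>simp_all add: evs evb b del: free_simps\<close>)
  qed
  from tensor_kernel_least[OF H this] have KH: "tensor_kernel R P2 N \<subseteq> ?H" .
  define f where "f = (\<Oplus>\<^bsub>?F\<^esub>t\<in>A. \<e> (x t, y t))"
  have bx: "\<e> (x t, y t) \<in> carrier ?F" if "t \<in> A" for t using that x y by simp
  have f: "f \<in> carrier ?F" unfolding f_def by (rule F.finsum_closed) (use bx in auto)
  note t2 = tcls_hom[OF P2 N]
  have "tensor_map R P2 P1 N d (tcls P2 N f) = tcls P1 N (push N P1 d f)"
    by (rule tensor_map_cls[OF P2 P1 N d f])
  also have "\<dots> = (\<Oplus>\<^bsub>tensor_module R P1 N\<^esub>t\<in>A. tcls P1 N (push N P1 d (\<e> (x t, y t))))"
    unfolding f_def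
    by (rule module_hom_finsum[OF module_free T1.module_axioms module_hom_comp[OF push_hom[OF d] tcls_hom[OF P1 N]] A bx])
  also have "\<dots> = (\<Oplus>\<^bsub>tensor_module R P1 N\<^esub>t\<in>A. pure_tensor R P1 N (d (x t)) (y t))"
    by (rule T1.finsum_cong')
      (use push_basis[OF d x(1) y] x y pure_tensor_closed[OF P1 N] module_homD(1)[OF d] in \<open>auto simp: tcls_basis\<close>)
  also have "\<dots> = \<zero>\<^bsub>tensor_module R P1 N\<^esub>"
    by (rule pure_tensor_LP_zero[OF P1 N A y dx])
  finally obtain Y where Y: "Y \<in> carrier (tensor_module R P3 N)" "tcls P2 N f = tensor_map R P3 P2 N d' Y"
    using ex[OF module_homD(1)[OF t2 f]] by auto
  obtain g where g: "g \<in> carrier ?F3" "Y = tcls P3 N g" using Y(1) unfolding tcls_surj by auto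
  have pg: "push N P2 d' g \<in> carrier ?F" using module_homD(1)[OF push_hom[OF d'] g(1)] .
  have "tcls P2 N f = tcls P2 N (push N P2 d' g)"
    using Y(2) g tensor_map_cls[OF P3 P2 N d' g(1)] by simp
  then have "f \<ominus>\<^bsub>?F\<^esub> push N P2 d' g \<in> ?H"
    using tcls_eq_iff[OF P2 N f pg] KH by blast
  then have 1: "(\<lambda>j. ev P2 j f \<ominus>\<^bsub>P2\<^esub> ev P2 j (push N P2 d' g)) \<in> LP R ?L P2"
    using module_hom_minus[OF module_free P2 ev_hom[OF P2] f pg] by simp
  define w where "w j = ev P3 j g" for j
  have w: "w j \<in> carrier P3" for j unfolding w_def by (rule module_homD(1)[OF ev_hom[OF P3] g(1)])
  have evpush: "ev P2 j (push N P2 d' g) = d' (w j)" for j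
    unfolding w_def
  proof (rule hom_free_eqI[OF P2 module_hom_comp[OF push_hom[OF d'] ev_hom[OF P2]] module_hom_comp[OF ev_hom[OF P3] d'] _ g(1)])
    fix e assume "e \<in> carrier P3 \<times> carrier N"
    then obtain p n where pn: "e = (p, n)" "p \<in> carrier P3" "n \<in> carrier N" by auto
    then show "ev P2 j (push N P2 d' (\<e> e)) = d' (ev P3 j (\<e> e))"
      using push_basis[OF d' pn(2,3)] ev_basis[OF P3 pn(2,3)] ev_basis[OF P2 module_homD(1)[OF d' pn(2)] pn(3)]
        module_homD(3)[OF d' cR[OF pn(3)] pn(2)] by simp
  qed
  \<comment> \<open>Both \<open>\<e> t\<close> and \<open>c (y t)\<close> represent
    \<open>y t\<close>, so \<open>G t\<close> is a relation. The matrix \<open>G\<close> measures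
    how far \<open>ev\<close> is from recovering \<open>x\<close> from \<open>f\<close>, an error
    that lies in \<open>LP\<close>.\<close>
  define G where "G t = \<e> t \<ominus>\<^bsub>?FA\<^esub> c (y t)" for t
  have GL: "G t \<in> ?L" if t: "t \<in> A" for t
  proof -
    have *: "\<e> t \<in> carrier ?FA" "c (y t) \<in> carrier ?FA" using t c y by auto
    have "lin R N y (G t) = y t \<ominus>\<^bsub>N\<^esub> y t"
      unfolding G_def using module_hom_minus[OF module_free N ly *] lin_basis[of N y t, OF N y[OF t]] c y t by simp
    then show ?thesis using * y[OF t] by (simp add: G_def N.minus_eq N.r_neg)
  qed
  have 2: "act P2 A G x \<in> LP R ?L P2" by (rule act_in_LP[OF P2 L A GL x(1)])
  have evf: "ev P2 j f = act P2 A (\<lambda>t. c (y t)) x j" for j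
  proof -
    have "ev P2 j f = (\<Oplus>\<^bsub>P2\<^esub>t\<in>A. ev P2 j (\<e> (x t, y t)))"
      unfolding f_def by (rule module_hom_finsum[OF module_free P2 ev_hom[OF P2] A bx])
    also have "\<dots> = (\<Oplus>\<^bsub>P2\<^esub>t\<in>A. c (y t) j \<odot>\<^bsub>P2\<^esub> x t)"
      by (rule P2.finsum_cong') (use evb x y cR in auto)
    finally show ?thesis by (simp add: act_def)
  qed
  have xdec: "x j = act P2 A G x j \<oplus>\<^bsub>P2\<^esub> ev P2 j f" for j
  proof -
    have "act P2 A G x j \<oplus>\<^bsub>P2\<^esub> ev P2 j f = (\<Oplus>\<^bsub>P2\<^esub>t\<in>A. G t j \<odot>\<^bsub>P2\<^esub> x t \<oplus>\<^bsub>P2\<^esub> c (y t) j \<odot>\<^bsub>P2\<^esub> x t)"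
      unfolding evf act_def
      by (rule P2.finsum_addf[symmetric]) (use GL free_closed[of "G _" A] x cR y in auto)
    also have "\<dots> = (\<Oplus>\<^bsub>P2\<^esub>t\<in>A. if j = t then x t else \<zero>\<^bsub>P2\<^esub>)"
    proof (rule P2.finsum_cong'[OF refl])
      fix t assume t: "t \<in> A"
      have *: "\<e> t \<in> carrier ?FA" "c (y t) \<in> carrier ?FA" using t c y by auto
      have "G t j \<odot>\<^bsub>P2\<^esub> x t \<oplus>\<^bsub>P2\<^esub> c (y t) j \<odot>\<^bsub>P2\<^esub> x t = (G t j \<oplus> c (y t) j) \<odot>\<^bsub>P2\<^esub> x t"
        using GL[OF t] free_closed[of "G t" A] x cR[OF y[OF t]] by (simp add: P2.smult_l_distr)
      also have "G t j \<oplus> c (y t) j = \<e> t j"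
        unfolding G_def using fun_cong[OF free_minus[OF *], of j]
          minus_add_cancel[OF free_closed[OF *(1)] free_closed[OF *(2)]] by simp
      finally show "G t j \<odot>\<^bsub>P2\<^esub> x t \<oplus>\<^bsub>P2\<^esub> c (y t) j \<odot>\<^bsub>P2\<^esub> x t = (if j = t then x t else \<zero>\<^bsub>P2\<^esub>)"
        using x by (simp add: basis_vector_def)
    qed (use x in auto)
    also have "\<dots> = x j"
    proof (cases "j \<in> A")
      case True
      then show ?thesis using P2.finsum_singleton[OF True A, of x] x by simp
    next
      case False
      have "(\<Oplus>\<^bsub>P2\<^esub>t\<in>A. if j = t then x t else \<zero>\<^bsub>P2\<^esub>) = (\<Oplus>\<^bsub>P2\<^esub>t\<in>A. \<zero>\<^bsub>P2\<^esub>)"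
        by (rule P2.finsum_cong') (use False in auto)
      then show ?thesis using x(2)[OF False] by (simp add: P2.finsum_zero)
    qed
    finally show ?thesis by simp
  qed
  have "(\<lambda>j. act P2 A G x j \<oplus>\<^bsub>P2\<^esub> (ev P2 j f \<ominus>\<^bsub>P2\<^esub> d' (w j))) \<in> LP R ?L P2"
    using LP_add[OF P2 L 2 1] unfolding evpush .
  moreover have "act P2 A G x j \<oplus>\<^bsub>P2\<^esub> (ev P2 j f \<ominus>\<^bsub>P2\<^esub> d' (w j)) = x j \<ominus>\<^bsub>P2\<^esub> d' (w j)" for j
    using LP_closed[OF P2 L 2] evh(1)[OF f] module_homD(1)[OF d' w] xdec[of j]
    by (simp add: P2.minus_eq P2.a_assoc[symmetric])
  ultimately show thesis using that[of w] w by simp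
qed

end

text \<open>The first shift, from \<open>N\<close> to its relations. A cycle \<open>u\<close> over
  the relations lifts through \<open>P\<close> to a vector \<open>x\<close> that is a cycle only
  modulo \<open>LP\<close>, which means a cycle of \<open>P \<otimes> N\<close> one degree higher.
  Removing the boundary given by exactness there moves \<open>x\<close> into \<open>LP\<close> and
  keeps its image \<open>u\<close>.\<close>

lemma (in projective_complex) exact_at_of_tensor:
  fixes N :: "('a, 'n) module" and y :: "'x \<Rightarrow> 'n"
  assumes N: "module R N"
    and ex: "\<And>Z. Z \<in> carrier (tensor_module R (P (Suc (Suc m))) N) \<Longrightarrow>
      tensor_map R (P (Suc (Suc m))) (P (Suc m)) N (d (Suc m)) Z = \<zero>\<^bsub>tensor_module R (P (Suc m)) N\<^esub> \<Longrightarrow>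
      \<exists>Y\<in>carrier (tensor_module R (P (Suc (Suc (Suc m)))) N).
        Z = tensor_map R (P (Suc (Suc (Suc m)))) (P (Suc (Suc m))) N (d (Suc (Suc m))) Y"
    and A: "finite A" and y: "\<And>t. t \<in> A \<Longrightarrow> y t \<in> carrier N"
    and surj: "lin R N y ` Vec A = carrier N"
  shows "exact_at R P d m {v \<in> Vec A. lin R N y v = \<zero>\<^bsub>N\<^esub>}"
    (is "exact_at R P d m ?L")
  unfolding exact_at_def
proof (intro ballI impI)
  have L: "?L \<subseteq> Vec A" by auto
  fix u assume u: "u \<in> LP R ?L (P (Suc m))" and du: "\<forall>j. d m (u j) = \<zero>\<^bsub>P m\<^esub>"
  interpret P1: module R "P (Suc m)" by (rule module_P)
  interpret P2: module R "P (Suc (Suc m))" by (rule module_P)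
  obtain x where x: "\<And>j. x j \<in> carrier (P (Suc (Suc m)))"
    and x_out: "\<And>j. j \<notin> A \<Longrightarrow> x j = \<zero>\<^bsub>P (Suc (Suc m))\<^esub>" and dx: "\<And>j. d (Suc m) (x j) = u j"
    using lift_cycle[OF L u du] by blast
  have dxL: "(\<lambda>t. d (Suc m) (x t)) \<in> LP R ?L (P (Suc m))" using u by (simp add: dx)
  obtain w where w: "\<And>t. w t \<in> carrier (P (Suc (Suc (Suc m))))"
    "(\<lambda>t. x t \<ominus>\<^bsub>P (Suc (Suc m))\<^esub> d (Suc (Suc m)) (w t)) \<in> LP R ?L (P (Suc (Suc m)))"
    using tensor_exact_LP[OF module_P module_P module_P N d_hom d_hom ex A y surj x x_out dxL] by blast
  have "u j = d (Suc m) (x j \<ominus>\<^bsub>P (Suc (Suc m))\<^esub> d (Suc (Suc m)) (w j))" for j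
    using module_hom_minus[OF module_P module_P d_hom x module_homD(1)[OF d_hom w(1)], of j j] d_d[OF w(1), of j] dx
      LP_closed[OF module_P L u, of j] by (simp add: P1.minus_eq)
  then show "\<exists>u'\<in>LP R ?L (P (Suc (Suc m))). \<forall>j. u j = d (Suc m) (u' j)"
    by (intro bexI[OF _ w(2)] allI)
qed

section \<open>Submodules of finite free modules over Noetherian rings\<close>

context cring
begin

lemma submodule_ideal_coord:
  assumes "submodule L R (Free B)"
  shows "ideal ((\<lambda>v. v x) ` L) R"
proof (rule idealI)
  interpret F: module R "Free B" by (rule module_free)
  note L = F.submoduleE[OF assms]
  have sub: "\<zero>\<^bsub>Free B\<^esub> \<in> L" by (rule submodule_zero_closed[OF module_free assms])
  have Lx: "v x \<in> carrier R" if "v \<in> L" for v using L(1) that free_closed[of v B] by blast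
  show "subgroup ((\<lambda>v. v x) ` L) (add_monoid R)"
  proof (rule add.subgroupI)
    show "(\<lambda>v. v x) ` L \<subseteq> carrier R" using Lx by auto
    show "(\<lambda>v. v x) ` L \<noteq> {}" using sub by auto
    fix a assume "a \<in> (\<lambda>v. v x) ` L"
    then obtain v where v: "v \<in> L" "a = v x" by auto
    have "(\<ominus> \<one>) \<odot>\<^bsub>Free B\<^esub> v \<in> L" by (rule L(4)) (use v in auto)
    then have "(\<ominus> \<one>) \<otimes> v x \<in> (\<lambda>v. v x) ` L" by (auto simp: image_iff)
    then show "\<ominus> a \<in> (\<lambda>v. v x) ` L" using Lx v by (simp add: l_minus)
    fix b assume "b \<in> (\<lambda>v. v x) ` L"
    then obtain w where w: "w \<in> L" "b = w x" by auto
    have "v \<oplus>\<^bsub>Free B\<^esub> w \<in> L" by (rule L(5)) (use v w in auto)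
    then show "a \<oplus> b \<in> (\<lambda>v. v x) ` L" using v w by (auto simp: image_iff)
  qed
  fix a r assume "a \<in> (\<lambda>v. v x) ` L" and r: "r \<in> carrier R"
  then obtain v where v: "v \<in> L" "a = v x" by auto
  have "r \<odot>\<^bsub>Free B\<^esub> v \<in> L" by (rule L(4)) (use v r in auto)
  then show "r \<otimes> a \<in> (\<lambda>v. v x) ` L" using v by (auto simp: image_iff)
  then show "a \<otimes> r \<in> (\<lambda>v. v x) ` L" using v Lx r by (simp add: m_comm)
qed (rule ring_axioms)

lemma submodule_coord_zero:
  assumes "submodule L R (Free (insert x B))" "x \<notin> B"
  shows "submodule {v \<in> L. v x = \<zero>} R (Free B)"
proof (rule module.submoduleI[OF module_free])
  interpret F: module R "Free (insert x B)" by (rule module_free)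
  interpret FB: module R "Free B" by (rule module_free)
  note L = F.submoduleE[OF assms(1)]
  show sub: "{v \<in> L. v x = \<zero>} \<subseteq> Vec B"
    using L(1) by (fastforce simp: free_carrier)
  show "\<zero>\<^bsub>Free B\<^esub> \<in> {v \<in> L. v x = \<zero>}"
    using submodule_zero_closed[OF module_free assms(1)] by simp
  fix v assume v: "v \<in> {v \<in> L. v x = \<zero>}"
  have s: "r \<odot>\<^bsub>Free B\<^esub> v \<in> {v \<in> L. v x = \<zero>}" if "r \<in> carrier R" for r
    using L(4)[OF that, of v] v that by simp
  then show "r \<odot>\<^bsub>Free B\<^esub> v \<in> {v \<in> L. v x = \<zero>}" if "r \<in> carrier R" for r using that by blast
  have "v \<in> Vec B" using v sub by blast
  then show "\<ominus>\<^bsub>Free B\<^esub> v \<in> {v \<in> L. v x = \<zero>}"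
    using s[of "\<ominus> \<one>"] FB.smult_l_minus[of \<one> v] by (simp del: free_simps)
  fix w assume w: "w \<in> {v \<in> L. v x = \<zero>}"
  show "v \<oplus>\<^bsub>Free B\<^esub> w \<in> {v \<in> L. v x = \<zero>}"
    using L(5)[of v w] v w by simp
qed

lemma submodule_free_restrict:
  assumes "submodule H R (Free C)" "B \<subseteq> C"
  shows "submodule (H \<inter> Vec B) R (Free B)"
proof (rule module.submoduleI[OF module_free])
  interpret F: module R "Free C" by (rule module_free)
  interpret FB: module R "Free B" by (rule module_free)
  note L = F.submoduleE[OF assms(1)]
  show "\<zero>\<^bsub>Free B\<^esub> \<in> H \<inter> Vec B"
    using submodule_zero_closed[OF module_free assms(1)] FB.zero_closed by simp
  fix v assume v: "v \<in> H \<inter> Vec B"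
  have s: "r \<odot>\<^bsub>Free B\<^esub> v \<in> H \<inter> Vec B" if "r \<in> carrier R" for r
    using L(4)[OF that, of v] v FB.smult_closed[OF that, of v] by simp
  then show "r \<odot>\<^bsub>Free B\<^esub> v \<in> H \<inter> Vec B" if "r \<in> carrier R" for r using that by blast
  show "\<ominus>\<^bsub>Free B\<^esub> v \<in> H \<inter> Vec B"
    using s[of "\<ominus> \<one>"] FB.smult_l_minus[of \<one> v] v by (simp del: free_simps)
  fix w assume w: "w \<in> H \<inter> Vec B"
  show "v \<oplus>\<^bsub>Free B\<^esub> w \<in> H \<inter> Vec B"
    using L(5)[of v w] v w FB.a_closed[of v w] by simp
qed simp

text \<open>Allows statements about modules, such as \<open>nakayama\<close>, to be applied to
  ideals.\<close>

definition regular_module :: "('a, 'a) module"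
  where "regular_module = \<lparr>carrier = carrier R, monoid.mult = (\<otimes>), one = \<one>, ring.zero = \<zero>,
    ring.add = (\<oplus>), smult = (\<otimes>)\<rparr>"

lemma regular_simps [simp]:
  "carrier regular_module = carrier R" "\<zero>\<^bsub>regular_module\<^esub> = \<zero>"
  "x \<oplus>\<^bsub>regular_module\<^esub> y = x \<oplus> y" "a \<odot>\<^bsub>regular_module\<^esub> x = a \<otimes> x"
  by (simp_all add: regular_module_def)

lemma module_regular: "module R regular_module"
proof (rule moduleI)
  show "abelian_group regular_module"
  proof (rule abelian_groupI)
    fix x assume "x \<in> carrier regular_module"
    then show "\<exists>y\<in>carrier regular_module. y \<oplus>\<^bsub>regular_module\<^esub> x = \<zero>\<^bsub>regular_module\<^esub>"
      by (intro bexI[of _ "\<ominus> x"]) (simp_all add: l_neg)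
  qed (auto simp: a_ac)
qed (auto simp: l_distr r_distr m_assoc is_cring)

lemma regular_submodule_iff: "submodule D R regular_module \<longleftrightarrow> ideal D R"
proof
  interpret V: module R regular_module by (rule module_regular)
  assume D: "submodule D R regular_module"
  note E = V.submoduleE[OF D]
  show "ideal D R"
  proof (rule idealI)
    show "subgroup D (add_monoid R)"
    proof (rule add.subgroupI)
      fix a assume a: "a \<in> D"
      have "(\<ominus> \<one>) \<otimes> a \<in> D" using E(4)[of "\<ominus> \<one>" a] a by simp
      then show "\<ominus> a \<in> D" using a E(1) by (simp add: l_minus subset_eq)
    qed (use E in auto)
    fix a x assume a: "a \<in> D" "x \<in> carrier R"
    show "x \<otimes> a \<in> D" using E(4)[of x a] a by simp
    then show "a \<otimes> x \<in> D" using E(1) a by (simp add: m_comm subset_eq)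
  qed (rule ring_axioms)
next
  interpret V: module R regular_module by (rule module_regular)
  assume D: "ideal D R"
  interpret D: ideal D R by fact
  have inv: "\<ominus>\<^bsub>regular_module\<^esub> a = \<ominus> a" if "a \<in> carrier R" for a
    using V.smult_l_minus[of \<one> a] that by (simp add: l_minus)
  show "submodule D R regular_module"
    by (rule V.submoduleI) (auto simp: D.I_l_closed inv)
qed

end

locale noetherian_cring = cring R + noetherian_ring R for R (structure)
begin

text \<open>Induction on the basis. The \<open>x\<close>-coordinates of \<open>L\<close> form a
  finitely generated ideal; lifts \<open>A2\<close> of its generators, together with generators
  \<open>A0\<close> of the vectors with vanishing \<open>x\<close>-coordinate, generate
  \<open>L\<close>.\<close>

lemma noetherian_free:
  assumes "finite B" "submodule L R (Free B)"
  obtains A where "finite A" "A \<subseteq> L" "span_of R (Free B) A = L"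
proof -
  have "\<exists>A. finite A \<and> A \<subseteq> L \<and> span_of R (Free B) A = L"
    using assms
  proof (induction B arbitrary: L rule: finite_induct)
    case empty
    interpret F: module R "Free {}" by (rule module_free)
    have "v = (\<lambda>_. \<zero>)" if "v \<in> L" for v
      using free_outside[of v "{}"] submodule_free_subset[OF empty] that by blast
    then have "L \<subseteq> {\<zero>\<^bsub>Free {}\<^esub>}" by auto
    moreover have "\<zero>\<^bsub>Free {}\<^esub> \<in> span_of R (Free {}) {}"
      by (rule submodule_zero_closed[OF module_free submodule_span_of[OF module_free]]) simp
    moreover have "span_of R (Free {}) {} \<subseteq> L" by (rule span_of_least[OF empty]) simp
    ultimately show ?case by (intro exI[of _ "{}"]) auto
  next
    case (insert x B)
    let ?F = "Free (insert x B)"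
    interpret F: module R ?F by (rule module_free)
    have LF: "L \<subseteq> carrier ?F" using submodule_free_subset[OF insert.prems] .
    obtain A0 where A0: "finite A0" "A0 \<subseteq> {v \<in> L. v x = \<zero>}" "span_of R (Free B) A0 = {v \<in> L. v x = \<zero>}"
      using insert.IH[OF submodule_coord_zero[OF insert.prems insert.hyps(2)]] by auto
    obtain A1 where A1: "finite A1" "A1 \<subseteq> carrier R" "(\<lambda>v. v x) ` L = Idl A1"
      using finetely_gen[OF submodule_ideal_coord[OF insert.prems, of x]] by auto
    have "A1 \<subseteq> (\<lambda>v. v x) ` L" using genideal_self[OF A1(2)] A1(3) by simp
    from finite_subset_image[OF A1(1) this]
    obtain A2 where A2: "finite A2" "A2 \<subseteq> L" "(\<lambda>v. v x) ` A2 = A1" by (elim exE conjE) (rule that, auto)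
    let ?A = "A0 \<union> A2" and ?S = "span_of R ?F (A0 \<union> A2)"
    have AL: "?A \<subseteq> L" using A0 A2 by auto
    have S: "submodule ?S R ?F" by (rule submodule_span_of[OF module_free]) (use AL LF in auto)
    have SL: "?S \<subseteq> L" by (rule span_of_least[OF insert.prems AL])
    have "A1 \<subseteq> (\<lambda>v. v x) ` ?S"
      unfolding A2(3)[symmetric] by (rule image_mono) (use span_of_superset[of ?A ?F] in blast)
    then have "Idl A1 \<subseteq> (\<lambda>v. v x) ` ?S"
      by (rule genideal_minimal[OF submodule_ideal_coord[OF S]])
    moreover have "{v \<in> L. v x = \<zero>} \<subseteq> ?S"
    proof -
      have "span_of R (Free B) A0 \<subseteq> ?S \<inter> Vec B"
        by (rule span_of_least[OF submodule_free_restrict[OF S]])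
          (use span_of_superset[of ?A ?F] A0(2) submodule_free_subset[OF submodule_coord_zero[OF insert.prems insert.hyps(2)]] in auto)
      then show ?thesis using A0(3) by auto
    qed
    ultimately have "L \<subseteq> ?S"
    proof (intro subsetI)
      fix v assume i: "Idl A1 \<subseteq> (\<lambda>v. v x) ` ?S" and k: "{v \<in> L. v x = \<zero>} \<subseteq> ?S" and v: "v \<in> L"
      have "v x \<in> Idl A1" using v A1(3) by auto
      then obtain w where w: "w \<in> ?S" "v x = w x" using i by auto
      have wv: "v \<in> carrier ?F" "w \<in> carrier ?F" using v w SL LF by auto
      have "v \<ominus>\<^bsub>?F\<^esub> w \<in> L" by (rule submodule_minus[OF module_free insert.prems v]) (use w SL in auto)
      moreover have "(v \<ominus>\<^bsub>?F\<^esub> w) x = \<zero>"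
        using fun_cong[OF free_minus[OF wv], of x] w(2) free_closed[OF wv(2)] by (simp add: r_neg minus_eq)
      ultimately have "v \<ominus>\<^bsub>?F\<^esub> w \<in> ?S" using k by auto
      then have "(v \<ominus>\<^bsub>?F\<^esub> w) \<oplus>\<^bsub>?F\<^esub> w \<in> ?S" by (rule F.submoduleE(5)[OF S _ w(1)])
      then show "v \<in> ?S" using F.minus_add_cancel[OF wv] by simp
    qed
    then show ?case using A0(1) A2(1) AL SL by (intro exI[of _ ?A]) auto
  qed
  then show thesis using that by blast
qed

end

section \<open>Local rings with maximal ideal \<open>I \<oplus> J\<close>: minimal covers and
  Nakayama\<close>

locale split_local_ring = noetherian_cring R for R (structure) +
  fixes I J :: "'a set"
  assumes ideal_I: "ideal I R" and ideal_J: "ideal J R" and Int_IJ: "I \<inter> J = {\<zero>}"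
    \<comment> \<open>With \<open>proper\<close>, the nonunits are exactly the elements of the sum
      of \<open>I\<close> and \<open>J\<close>, which makes the ring local with that sum as its
      maximal ideal.\<close>
    and nonunit: "x \<in> carrier R \<Longrightarrow> x \<notin> Units R \<Longrightarrow> \<exists>i\<in>I. \<exists>j\<in>J. x = i \<oplus> j"
    and proper: "i \<in> I \<Longrightarrow> j \<in> J \<Longrightarrow> i \<oplus> j \<notin> Units R"
    and I_nonzero: "I \<noteq> {\<zero>}" and J_nonzero: "J \<noteq> {\<zero>}"
begin

sublocale I: ideal I R by (rule ideal_I)
sublocale J: ideal J R by (rule ideal_J)

definition mx where "mx = I <+>\<^bsub>R\<^esub> J"

lemma mx_iff: "x \<in> mx \<longleftrightarrow> (\<exists>i\<in>I. \<exists>j\<in>J. x = i \<oplus> j)"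
  unfolding mx_def set_add_def' by auto

lemma ideal_mx: "ideal mx R"
  unfolding mx_def by (rule add_ideals[OF ideal_I ideal_J])

sublocale mx: ideal mx R by (rule ideal_mx)

lemma unit_if_notin_mx: "x \<in> carrier R \<Longrightarrow> x \<notin> mx \<Longrightarrow> x \<in> Units R"
  using nonunit[of x] mx_iff[of x] by blast

lemma one_notin_mx: "\<one> \<notin> mx"
  using proper mx_iff Units_one_closed by metis

lemma I_mx: "i \<in> I \<Longrightarrow> i \<in> mx"
  using mx_iff J.zero_closed I.Icarr r_zero by metis

lemma J_mx: "j \<in> J \<Longrightarrow> j \<in> mx"
  using mx_iff I.zero_closed J.Icarr l_zero by metis

lemma mult_IJ: "i \<in> I \<Longrightarrow> j \<in> J \<Longrightarrow> i \<otimes> j = \<zero>"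
  using I.I_r_closed[of i j] J.I_l_closed[of j i] Int_IJ I.Icarr J.Icarr by auto

lemma mult_JI: "i \<in> I \<Longrightarrow> j \<in> J \<Longrightarrow> j \<otimes> i = \<zero>"
  using mult_IJ m_comm I.Icarr J.Icarr by metis

text \<open>The assumptions are symmetric in \<open>I\<close> and \<open>J\<close>. One-sided
  arguments are carried out once and transferred, with \<open>mx_swap\<close> identifying the two
  maximal ideals.\<close>

lemma swap: "split_local_ring R J I"
proof (intro split_local_ring.intro split_local_ring_axioms.intro noetherian_cring_axioms)
  show "x \<in> carrier R \<Longrightarrow> x \<notin> Units R \<Longrightarrow> \<exists>i\<in>J. \<exists>j\<in>I. x = i \<oplus> j" for x
    using nonunit a_comm I.Icarr J.Icarr by metis
  show "i \<in> J \<Longrightarrow> j \<in> I \<Longrightarrow> i \<oplus> j \<notin> Units R" for i j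
    using proper a_comm I.Icarr J.Icarr by metis
qed (use ideal_I ideal_J Int_IJ I_nonzero J_nonzero in auto)

lemma mx_swap: "split_local_ring.mx R J I = mx"
proof -
  have "J <+>\<^bsub>R\<^esub> I = I <+>\<^bsub>R\<^esub> J"
    by (rule set_add_comm) (use I.a_subset J.a_subset in auto)
  then show ?thesis unfolding split_local_ring.mx_def[OF swap] mx_def .
qed

text \<open>For a generating set of least cardinality, a relation with a unit coefficient would
  express one generator by the others. The index set is taken in any given infinite type, so that
  bases can later be chosen in the list type that \<open>resolution_element\<close>
  prescribes.\<close>

lemma minimal_cover:
  assumes V: "module R V" and A: "finite A" "A \<subseteq> carrier V" and inf: "infinite (UNIV :: 'x set)"
  obtains B :: "'x set" and y where "finite B" "\<And>b. b \<in> B \<Longrightarrow> y b \<in> carrier V"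
    "lin R V y ` Vec B = span_of R V A"
    "\<And>v b. v \<in> Vec B \<Longrightarrow> lin R V y v = \<zero>\<^bsub>V\<^esub> \<Longrightarrow> v b \<in> mx"
proof -
  interpret V: module R V by fact
  let ?Q = "\<lambda>n. \<exists>A'. finite A' \<and> A' \<subseteq> carrier V \<and> span_of R V A' = span_of R V A \<and> card A' = n"
  have "?Q (card A)" using A by blast
  then have "?Q (LEAST n. ?Q n)" by (rule LeastI)
  then obtain A' where A': "finite A'" "A' \<subseteq> carrier V" "span_of R V A' = span_of R V A" "card A' = (LEAST n. ?Q n)" by blast
  have min: "card A' \<le> card A''" if "finite A''" "A'' \<subseteq> carrier V" "span_of R V A'' = span_of R V A" for A''
    unfolding A'(4) by (rule Least_le) (use that in blast)
  obtain B :: "'x set" where B: "finite B" "card B = card A'"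
    using infinite_arbitrarily_large[OF inf, of "card A'"] by auto
  \<comment> \<open>Injectivity matters: deleting \<open>y b\<close> from \<open>A'\<close> must
    keep \<open>y t\<close> for all other indices \<open>t\<close>.\<close>
  then obtain y where y: "bij_betw y B A'" using finite_same_card_bij A'(1) by metis
  have yB: "y ` B = A'" using y by (simp add: bij_betw_def)
  have yc: "y b \<in> carrier V" if "b \<in> B" for b using that yB A' by auto
  have "lin R V y ` Vec B = span_of R V A"
    using span_of_lin[OF V, of y B] yB A' by simp
  moreover have "v b \<in> mx" if v: "v \<in> Vec B" "lin R V y v = \<zero>\<^bsub>V\<^esub>" for v b
  proof (rule ccontr)
    assume nb: "v b \<notin> mx"
    then have b: "b \<in> B" using free_outside[OF v(1)] mx.zero_closed by metis
    have vR: "v t \<in> carrier R" for t by (rule free_closed[OF v(1)])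
    have u: "v b \<in> Units R" by (rule unit_if_notin_mx[OF vR nb])
    let ?A = "A' - {y b}" let ?S = "span_of R V ?A"
    have S: "submodule ?S R V" by (rule submodule_span_of[OF V]) (use A' in auto)
    have "y t \<in> ?S" if "t \<in> B - {b}" for t
      using span_of_superset[of ?A V] that y b yB by (auto simp: bij_betw_def inj_on_def)
    then have sum: "(\<Oplus>\<^bsub>V\<^esub>t\<in>B - {b}. v t \<odot>\<^bsub>V\<^esub> y t) \<in> ?S" (is "?s \<in> _")
      using B vR by (intro submodule_finsum[OF V S]) (auto intro!: V.submoduleE(4)[OF S])
    have "\<zero>\<^bsub>V\<^esub> = (\<Oplus>\<^bsub>V\<^esub>t\<in>insert b (B - {b}). v t \<odot>\<^bsub>V\<^esub> y t)"
      using lin_free_eq[OF V B(1) yc v(1)] v(2) b by (simp add: insert_absorb)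
    also have "\<dots> = v b \<odot>\<^bsub>V\<^esub> y b \<oplus>\<^bsub>V\<^esub> ?s"
      by (rule V.finsum_insert) (use B vR yc b in auto)
    finally have "v b \<odot>\<^bsub>V\<^esub> y b = \<ominus>\<^bsub>V\<^esub> ?s"
      using V.submoduleE(1)[OF S] sum vR yc[OF b] by (intro V.minus_equality[symmetric]) (auto simp: V.a_comm)
    then have "v b \<odot>\<^bsub>V\<^esub> y b \<in> ?S" using V.submoduleE(3)[OF S sum] by simp
    then have "inv (v b) \<odot>\<^bsub>V\<^esub> (v b \<odot>\<^bsub>V\<^esub> y b) \<in> ?S" using V.submoduleE(4)[OF S] u by auto
    then have "y b \<in> ?S" using u vR yc[OF b] V.smult_assoc1[of "inv (v b)" "v b" "y b"] by simp
    then have "A' \<subseteq> ?S" using span_of_superset[of ?A V] by auto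
    then have "span_of R V A' \<subseteq> ?S" by (rule span_of_least[OF S])
    moreover have "?S \<subseteq> span_of R V A'" by (rule span_of_mono) auto
    ultimately have "card A' \<le> card ?A" using A' by (intro min) auto
    then show False using A'(1) b yB by (metis card_Diff1_less imageI not_le)
  qed
  ultimately show thesis using yc by (intro that[of B y, OF B(1)]) blast+
qed

lemma minimal_cover_free:
  assumes "finite C" "submodule L R (Free C)" and inf: "infinite (UNIV :: 'x set)"
  obtains B :: "'x set" and G where "finite B" "\<And>b. b \<in> B \<Longrightarrow> G b \<in> L"
    "lin R (Free C) G ` Vec B = L"
    "\<And>v b. v \<in> Vec B \<Longrightarrow> lin R (Free C) G v = (\<lambda>_. \<zero>) \<Longrightarrow> v b \<in> mx"
proof -
  obtain A where A: "finite A" "A \<subseteq> L" "span_of R (Free C) A = L"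
    by (rule noetherian_free[OF assms(1,2)])
  have AF: "A \<subseteq> Vec C" using A(2) submodule_free_subset[OF assms(2)] by auto
  obtain B :: "'x set" and y where y: "finite B" "\<And>b. b \<in> B \<Longrightarrow> y b \<in> Vec C"
    "lin R (Free C) y ` Vec B = L"
    "\<And>v b. v \<in> Vec B \<Longrightarrow> lin R (Free C) y v = \<zero>\<^bsub>Free C\<^esub> \<Longrightarrow> v b \<in> mx"
    using minimal_cover[OF module_free A(1) AF inf] unfolding A(3) by blast
  have "y b \<in> L" if "b \<in> B" for b
    using lin_basis[of "Free C" y b, OF module_free y(2)[OF that]] basis_vector_closed[OF that] y(3)
    by (metis image_eqI)
  then show thesis using y that[of B y] by simp
qed

text \<open>In a minimal cover of \<open>H\<close> the image of a basis vector \<open>\<e> b\<close>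
  is also the image of some \<open>w\<close> with coordinates in \<open>mx\<close>. The difference
  is a relation with coefficient \<open>1 - w b\<close>, which minimality puts into
  \<open>mx\<close>, and then \<open>1\<close> would lie in \<open>mx\<close>. So the cover has an
  empty basis.\<close>

lemma nakayama:
  assumes V: "module R V" and A: "finite A" "A \<subseteq> carrier V" "span_of R V A = H"
    and sub: "H \<subseteq> span_of R V {m \<odot>\<^bsub>V\<^esub> h | m h. m \<in> mx \<and> h \<in> H}"
  shows "H = {\<zero>\<^bsub>V\<^esub>}"
proof -
  interpret V: module R V by fact
  have inf: "infinite (UNIV :: nat set)" by simp
  obtain B :: "nat set" and y where B: "finite B" and yc: "\<And>b. b \<in> B \<Longrightarrow> y b \<in> carrier V"
    and im: "lin R V y ` Vec B = H"
    and min: "\<And>v b. v \<in> Vec B \<Longrightarrow> lin R V y v = \<zero>\<^bsub>V\<^esub> \<Longrightarrow> v b \<in> mx"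
    using minimal_cover[OF V A(1,2) inf] A(3) by metis
  let ?F = "Free B"
  interpret F: module R ?F by (rule module_free)
  note ly = lin_hom[OF V yc]
  let ?W = "{w \<in> carrier ?F. \<forall>b. w b \<in> mx}"
  have W: "submodule ?W R ?F"
  proof (rule F.submoduleI)
    fix a assume a: "a \<in> ?W"
    then have "\<zero>\<^bsub>?F\<^esub> \<ominus>\<^bsub>?F\<^esub> a = (\<lambda>b. \<zero> \<ominus> a b)"
      using free_minus[OF F.zero_closed, of a] by simp
    then have "\<ominus>\<^bsub>?F\<^esub> a = (\<lambda>b. \<zero> \<ominus> a b)" using a F.l_zero[of "\<ominus>\<^bsub>?F\<^esub> a"] by (simp add: F.minus_eq del: free_simps)
    then show "\<ominus>\<^bsub>?F\<^esub> a \<in> ?W" using a F.a_inv_closed[of a] by (simp add: minus_eq)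
  next
    fix a b assume "a \<in> ?W" "b \<in> ?W"
    then show "a \<oplus>\<^bsub>?F\<^esub> b \<in> ?W" using F.a_closed[of a b] by simp
  next
    fix a x assume "a \<in> carrier R" "x \<in> ?W"
    then show "a \<odot>\<^bsub>?F\<^esub> x \<in> ?W" using F.smult_closed[of a x] mx.I_l_closed by simp
  qed (use F.zero_closed in auto)
  have D: "submodule (lin R V y ` ?W) R V"
  proof -
    have m: "module R (?F\<lparr>carrier := ?W\<rparr>)" by (rule submodule.submodule_is_module[OF W module_free])
    have "lin R V y \<in> Hom (?F\<lparr>carrier := ?W\<rparr>) V"
      using module_homD[OF ly] by (intro module_homI) auto
    from submodule_image[OF m V this] show ?thesis by simp
  qed
  have "{m \<odot>\<^bsub>V\<^esub> h | m h. m \<in> mx \<and> h \<in> H} \<subseteq> lin R V y ` ?W"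
  proof clarify
    fix m h assume m: "m \<in> mx" and "h \<in> H"
    then obtain v where v: "v \<in> carrier ?F" "h = lin R V y v" using im by auto
    have mR: "m \<in> carrier R" using m by (rule mx.Icarr)
    have "m \<odot>\<^bsub>V\<^esub> h = lin R V y (m \<odot>\<^bsub>?F\<^esub> v)"
      using module_homD(3)[OF ly mR v(1)] v(2) by simp
    moreover have "m \<odot>\<^bsub>?F\<^esub> v \<in> ?W"
      using F.smult_closed[OF mR v(1)] mx.I_r_closed[OF m free_closed[OF v(1)]] by simp
    ultimately show "m \<odot>\<^bsub>V\<^esub> h \<in> lin R V y ` ?W" by blast
  qed
  then have HW: "H \<subseteq> lin R V y ` ?W" using span_of_least[OF D] sub by blast
  have "B = {}"
  proof (rule ccontr)
    assume "B \<noteq> {}"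
    then obtain b where b: "b \<in> B" by auto
    let ?e = "\<e> b"
    have e: "?e \<in> carrier ?F" using b by simp
    then have "lin R V y ?e \<in> H" using im by blast
    then obtain w where w: "w \<in> carrier ?F" "\<And>c. w c \<in> mx" "lin R V y ?e = lin R V y w" using HW by auto
    have "lin R V y (?e \<ominus>\<^bsub>?F\<^esub> w) = \<zero>\<^bsub>V\<^esub>"
      using module_hom_minus[OF module_free V ly e w(1)] w(3) module_homD(1)[OF ly w(1)]
      by (simp add: V.minus_eq V.r_neg)
    then have "(?e \<ominus>\<^bsub>?F\<^esub> w) b \<in> mx" using min e w(1) by simp
    then have "\<one> \<ominus> w b \<in> mx" using fun_cong[OF free_minus[OF e w(1)], of b] by (simp add: basis_vector_def)
    then have "(\<one> \<ominus> w b) \<oplus> w b \<in> mx" using w(2) by simp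
    then show False using minus_add_cancel[OF one_closed mx.Icarr[OF w(2)]] one_notin_mx by simp
  qed
  then have "carrier ?F = {\<zero>\<^bsub>?F\<^esub>}" using F.zero_closed by (auto simp: free_carrier)
  then show ?thesis using im module_hom_zero[OF module_free V ly] by auto
qed

text \<open>The parts of \<open>v\<close> in \<open>I F\<close> and \<open>J F\<close> are mapped into submodules with intersection \<open>0\<close>.\<close>

lemma kernel_splits:
  assumes A: "finite A" and G: "\<And>t. t \<in> A \<Longrightarrow> G t \<in> Vec C"
    and v: "v \<in> Vec A" "lin R (Free C) G v = (\<lambda>_. \<zero>)" "\<And>t. v t \<in> mx"
  shows "\<exists>f\<in>Ker A C G.
    \<exists>g\<in>Ker A C G.
      \<forall>t. f t \<in> I \<and> g t \<in> J \<and> v t = f t \<oplus> g t"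
proof -
  let ?l = "lin R (Free C) G"
  interpret F: module R "Free A" by (rule module_free)
  have "\<forall>t. \<exists>i j. i \<in> I \<and> j \<in> J \<and> v t = i \<oplus> j" using v(3) mx_iff by blast
  then obtain f' g' where fg0: "\<And>t. f' t \<in> I" "\<And>t. g' t \<in> J" "\<And>t. v t = f' t \<oplus> g' t" by metis
  define f g where "f t = (if t \<in> A then f' t else \<zero>)" and "g t = (if t \<in> A then g' t else \<zero>)" for t
  have fg: "f t \<in> I" "g t \<in> J" "v t = f t \<oplus> g t" for t
    using fg0 free_outside[OF v(1)] by (auto simp: f_def g_def)
  have fF: "f \<in> Vec A" and gF: "g \<in> Vec A"
    by (rule free_finiteI[OF A]; use fg I.Icarr J.Icarr in \<open>auto simp: f_def g_def\<close>)+
  note lh = lin_hom[of "Free C", OF module_free G]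
  have lR: "?l f j \<in> carrier R" "?l g j \<in> carrier R" for j
    using free_closed[OF module_homD(1)[OF lh fF]] free_closed[OF module_homD(1)[OF lh gF]] by auto
  have "v = f \<oplus>\<^bsub>Free A\<^esub> g" using fg(3) by auto
  then have sum: "?l f j \<oplus> ?l g j = \<zero>" for j
    using module_homD(2)[OF lh fF gF] v(2) by (auto dest: fun_cong[of _ _ j])
  have sI: "(\<Oplus>t\<in>D. f t \<otimes> G t j) \<in> I" if "D \<subseteq> A" "finite D" for D j
    using that(2,1)
  proof (induction D rule: finite_induct)
    case (insert t D)
    have "f t \<otimes> G t j \<in> I" if "t \<in> A" for t using fg(1) free_closed[OF G[OF that]] by (rule I.I_r_closed)
    then show ?case using insert I.Icarr by (auto simp: Pi_def subset_eq)
  qed simp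
  have sJ: "(\<Oplus>t\<in>D. g t \<otimes> G t j) \<in> J" if "D \<subseteq> A" "finite D" for D j
    using that(2,1)
  proof (induction D rule: finite_induct)
    case (insert t D)
    have "g t \<otimes> G t j \<in> J" if "t \<in> A" for t using fg(2) free_closed[OF G[OF that]] by (rule J.I_r_closed)
    then show ?case using insert J.Icarr by (auto simp: Pi_def subset_eq)
  qed simp
  have fI: "?l f j \<in> I" and gJ: "?l g j \<in> J" for j
    using sI[OF subset_refl A, of j] sJ[OF subset_refl A, of j]
      lin_free_pointwise[where j = j, OF A G fF] lin_free_pointwise[where j = j, OF A G gF] by auto
  have eq: "?l f j = \<ominus> ?l g j" for j using sum lR by (metis minus_equality)
  have "?l f j \<in> J" for j unfolding eq using gJ by simp
  then have f0: "?l f j = \<zero>" for j using fI Int_IJ by auto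
  have g0: "?l g j = \<zero>" for j using sum[of j] f0[of j] lR by simp
  have "f \<in> {v \<in> Vec A. ?l v = (\<lambda>_. \<zero>)}" "g \<in> {v \<in> Vec A. ?l v = (\<lambda>_. \<zero>)}"
    using fF gF f0 g0 by auto
  then show ?thesis using fg by (intro bexI[of _ f] bexI[of _ g]) auto
qed

end

subsection \<open>Free resolutions\<close>

context noetherian_cring
begin

lemma free_cover:
  assumes "finite C" "submodule L R (Free C)" and inf: "infinite (UNIV :: 'x set)"
  obtains B :: "'x set" and h where "finite B" "h \<in> Hom (Free B) (Free C)"
    "h ` Vec B = L"
proof -
  obtain A where A: "finite A" "A \<subseteq> L" "span_of R (Free C) A = L"
    by (rule noetherian_free[OF assms(1,2)])
  have AF: "A \<subseteq> Vec C" using A(2) submodule_free_subset[OF assms(2)] by auto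
  obtain B :: "'x set" where B: "finite B" "card B = card A"
    using infinite_arbitrarily_large[OF inf, of "card A"] by auto
  then obtain y where "bij_betw y B A" using finite_same_card_bij A(1) by metis
  then have yB: "y ` B = A" by (simp add: bij_betw_def)
  then have yc: "y b \<in> Vec C" if "b \<in> B" for b using that AF by auto
  show thesis
    by (rule that[OF B(1) lin_hom[OF module_free yc]])
      (use span_of_lin[OF module_free, of y B C] yB AF A(3) in auto)
qed

text \<open>The choice in \<open>chosen_resolution\<close> is meaningful only if a resolution exists
  in the prescribed type. Finite free modules supply one, since the Noetherian condition keeps every
  syzygy finitely generated.\<close>

lemma resolution_exists:
  fixes M :: "('a, 'm) module"
  assumes M: "module R M" and fg: "finitely_generated R M" and inf: "infinite (UNIV :: 'x set)"
  shows "\<exists>(P :: nat \<Rightarrow> ('a, 'x \<Rightarrow> 'a) module) d \<epsilon>. projective_resolution R M P d \<epsilon>"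
proof -
  interpret M: module R M by fact
  obtain A where A: "finite A" "A \<subseteq> carrier M" "span_of R M A = carrier M"
    using fg unfolding finitely_generated_def by auto
  obtain B0 :: "'x set" where B0: "finite B0" "card B0 = card A"
    using infinite_arbitrarily_large[OF inf, of "card A"] by auto
  then obtain y where "bij_betw y B0 A" using finite_same_card_bij A(1) by metis
  then have yB: "y ` B0 = A" by (simp add: bij_betw_def)
  then have yc: "y b \<in> carrier M" if "b \<in> B0" for b using that A by auto
  let ?\<epsilon> = "lin R M y"
  have \<epsilon>: "?\<epsilon> \<in> Hom (Free B0) M" by (rule lin_hom[OF M yc])
  have \<epsilon>_surj: "?\<epsilon> ` Vec B0 = carrier M"
    using span_of_lin[OF M, of y B0] yB A by simp
  \<comment> \<open>A state of the recursion is the basis of the current free module with the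
    submodule that the next map has to cover. The condition at \<open>n = 0\<close> ties the start
    to the kernel of the augmentation.\<close>
  let ?P = "\<lambda>(n::nat) (s :: 'x set \<times> ('x \<Rightarrow> 'a) set). finite (fst s) \<and> submodule (snd s) R (Free (fst s))
     \<and> (n = 0 \<longrightarrow> s = (B0, {x \<in> Vec B0. ?\<epsilon> x = \<zero>\<^bsub>M\<^esub>}))"
  let ?Q = "\<lambda>(n::nat) s s'. \<exists>h. h \<in> Hom (Free (fst s')) (Free (fst s)) \<and>
     h ` Vec (fst s') = snd s \<and>
     snd s' = {x \<in> Vec (fst s'). h x = \<zero>\<^bsub>Free (fst s)\<^esub>}"
  have "\<exists>f. \<forall>n. ?P n (f n) \<and> ?Q n (f n) (f (Suc n))"
  proof (rule dependent_nat_choice)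
    show "\<exists>s. ?P 0 s"
      using B0 submodule_kernel[OF module_free M \<epsilon>]
      by (intro exI[of _ "(B0, {x \<in> Vec B0. ?\<epsilon> x = \<zero>\<^bsub>M\<^esub>})"]) auto
  next
    fix s n assume s: "?P n s"
    then have s': "finite (fst s)" "submodule (snd s) R (Free (fst s))" by blast+
    obtain B :: "'x set" and h where Bh: "finite B" "h \<in> Hom (Free B) (Free (fst s))"
      "h ` Vec B = snd s"
      by (rule free_cover[OF s' inf])
    show "\<exists>s'. ?P (Suc n) s' \<and> ?Q n s s'"
      by (intro exI[of _ "(B, {x \<in> Vec B. h x = \<zero>\<^bsub>Free (fst s)\<^esub>})"] conjI exI[of _ h])
        (use Bh submodule_kernel[OF module_free module_free Bh(2)] in auto)
  qed
  then obtain f where f: "\<And>n. ?P n (f n)" "\<And>n. ?Q n (f n) (f (Suc n))" by blast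
  from f(2) have "\<forall>n. \<exists>h. h \<in> Hom (Free (fst (f (Suc n)))) (Free (fst (f n))) \<and>
     h ` Vec (fst (f (Suc n))) = snd (f n) \<and>
     snd (f (Suc n)) = {x \<in> Vec (fst (f (Suc n))). h x = \<zero>\<^bsub>Free (fst (f n))\<^esub>}"
    by (rule allI)
  from choice[OF this] obtain d where d0: "\<forall>n. d n \<in> Hom (Free (fst (f (Suc n)))) (Free (fst (f n))) \<and>
     d n ` Vec (fst (f (Suc n))) = snd (f n) \<and>
     snd (f (Suc n)) = {x \<in> Vec (fst (f (Suc n))). d n x = \<zero>\<^bsub>Free (fst (f n))\<^esub>}"
    by (rule exE)
  have d: "d n \<in> Hom (Free (fst (f (Suc n)))) (Free (fst (f n)))"
    "d n ` Vec (fst (f (Suc n))) = snd (f n)"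
    "snd (f (Suc n)) = {x \<in> Vec (fst (f (Suc n))). d n x = \<zero>\<^bsub>Free (fst (f n))\<^esub>}" for n
    using d0 by (simp_all del: free_simps)
  have f0: "f 0 = (B0, {x \<in> Vec B0. ?\<epsilon> x = \<zero>\<^bsub>M\<^esub>})" using f(1)[of 0] by simp
  have "projective_resolution R M (\<lambda>n. Free (fst (f n))) d ?\<epsilon>"
    unfolding projective_resolution_def
    using projective_free d \<epsilon> \<epsilon>_surj f0 by auto
  then show ?thesis by blast
qed

end

text \<open>The witness is \<open>0 \<rightarrow> Free B1 \<rightarrow> Free B0 \<rightarrow>
  M\<close>. The bases consist of lists because \<open>proj_dim\<close> ranges over resolutions with
  elements in \<open>resolution_element\<close>.\<close>

lemma (in cring) proj_dim_le_1:
  fixes M :: "('a, 'm) module" and B0 B1 :: "('m \<times> 'a) list set"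
  assumes M: "module R M"
    and e0: "e0 \<in> Hom (Free B0) M" "e0 ` Vec B0 = carrier M"
    and e1: "e1 \<in> Hom (Free B1) (Free B0)"
      "e1 ` Vec B1 = {v \<in> Vec B0. e0 v = \<zero>\<^bsub>M\<^esub>}"
    and inj: "{v \<in> Vec B1. e1 v = (\<lambda>_. \<zero>)} = {\<lambda>_. \<zero>}"
  shows "proj_dim R M \<le> 1"
proof -
  let ?B = "\<lambda>n::nat. if n = 0 then B0 else if n = 1 then B1 else {}"
  let ?P = "\<lambda>n. Free (?B n)"
  let ?d = "\<lambda>n. if n = 0 then e1 else (\<lambda>_ _. \<zero>)"
  have E: "Vec ({} :: ('m \<times> 'a) list set) = {\<lambda>_. \<zero>}"
    by (auto simp: free_carrier)
  have z: "(\<lambda>_ _. \<zero>) \<in> Hom (Free B) (Free C)" for B C :: "('m \<times> 'a) list set"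
    by (rule module_homI) (auto simp: free_carrier)
  have "projective_resolution R M ?P ?d e0"
    unfolding projective_resolution_def
    using projective_free e0 e1 z inj E by auto
  moreover have "\<forall>i>1. zero_module (?P i)" unfolding zero_module_def using E by simp
  ultimately have "enat 1 \<in> {enat n | n. \<exists>(P :: nat \<Rightarrow> ('a, ('a, 'm) resolution_element) module) d \<epsilon>.
      projective_resolution R M P d \<epsilon> \<and> (\<forall>i > n. zero_module (P i))}" by blast
  then show ?thesis unfolding proj_dim_def one_enat_def by (rule Inf_lower)
qed

lemma (in cring) zero_quotient_moduleD:
  assumes "zero_module (quotient_module (C\<lparr>carrier := Z\<rparr>) H)" "module R C" "\<zero>\<^bsub>C\<^esub> \<in> H" "x \<in> Z" "Z \<subseteq> carrier C"
  shows "x \<in> H"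
proof -
  interpret C: module R C by fact
  have "H +>\<^bsub>C\<lparr>carrier := Z\<rparr>\<^esub> x \<in> carrier (quotient_module (C\<lparr>carrier := Z\<rparr>) H)"
    unfolding quotient_module_carrier using assms(4) by auto
  then have "H +>\<^bsub>C\<lparr>carrier := Z\<rparr>\<^esub> x = H"
    using assms(1) unfolding zero_module_def by (simp add: quotient_zero)
  moreover have "\<zero>\<^bsub>C\<^esub> \<oplus>\<^bsub>C\<^esub> x \<in> H +>\<^bsub>C\<lparr>carrier := Z\<rparr>\<^esub> x"
    using assms(3) by (auto simp: a_r_coset_def r_coset_def)
  ultimately show ?thesis using assms(4,5) C.l_zero by auto
qed

text \<open>The chosen resolution is obtained once and for all degrees \<open>n\<close>, so that the
  vanishing of \<open>Tor\<close> in an odd and in an even degree speaks about one and the same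
  complex.\<close>

lemma (in noetherian_cring) Tor_vanishing:
  fixes M :: "('a, 'm) module" and N :: "('a, 'n) module"
  assumes M: "module R M" and fg: "finitely_generated R M" and N: "module R N"
  obtains P :: "nat \<Rightarrow> ('a, ('a, 'm) resolution_element) module" and d \<epsilon>
  where "projective_resolution R M P d \<epsilon>"
    "\<And>n Z. zero_module (Tor R (Suc n) M N) \<Longrightarrow> Z \<in> carrier (tensor_module R (P (Suc n)) N) \<Longrightarrow>
      tensor_map R (P (Suc n)) (P n) N (d n) Z = \<zero>\<^bsub>tensor_module R (P n) N\<^esub> \<Longrightarrow>
      \<exists>Y\<in>carrier (tensor_module R (P (Suc (Suc n))) N).
        Z = tensor_map R (P (Suc (Suc n))) (P (Suc n)) N (d (Suc n)) Y"
proof -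
  obtain P :: "nat \<Rightarrow> ('a, ('a, 'm) resolution_element) module" and d \<epsilon>
    where ch: "chosen_resolution R M = (P, d, \<epsilon>)" by (metis prod_cases3)
  have inf: "infinite (UNIV :: ('m \<times> 'a) list set)" by (rule infinite_UNIV_listI)
  obtain P' :: "nat \<Rightarrow> ('a, ('a, 'm) resolution_element) module" and d' \<epsilon>'
    where "projective_resolution R M P' d' \<epsilon>'"
    using resolution_exists[OF M fg inf] by blast
  then have "(\<lambda>(P, d, \<epsilon>). projective_resolution R M P d \<epsilon>) (P', d', \<epsilon>')" by simp
  then have "(\<lambda>(P, d, \<epsilon>). projective_resolution R M P d \<epsilon>) (chosen_resolution R M)"
    unfolding chosen_resolution_def by (rule someI)
  then have res: "projective_resolution R M P d \<epsilon>" by (simp add: ch)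
  show thesis
  proof (rule that[OF res])
    fix n Z
    assume zero: "zero_module (Tor R (Suc n) M N)"
      and Z: "Z \<in> carrier (tensor_module R (P (Suc n)) N)"
        "tensor_map R (P (Suc n)) (P n) N (d n) Z = \<zero>\<^bsub>tensor_module R (P n) N\<^esub>"
    let ?C = "\<lambda>i. tensor_module R (P i) N" and ?D = "\<lambda>i. tensor_map R (P (Suc i)) (P i) N (d i)"
    have mP: "module R (P i)" and dh: "d i \<in> Hom (P (Suc i)) (P i)" for i
      using res unfolding projective_resolution_def projective_module_def by auto
    have C: "module R (?C i)" for i by (rule module_tensor[OF mP N])
    interpret F: module R "Free (carrier (P (Suc (Suc n))) \<times> carrier N)" by (rule module_free)
    interpret C2: module R "?C (Suc (Suc n))" by (rule C)
    have t0: "tcls (P i) N \<zero>\<^bsub>Free (carrier (P i) \<times> carrier N)\<^esub> = \<zero>\<^bsub>?C i\<^esub>" for i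
      by (rule module_hom_zero[OF module_free C tcls_hom[OF mP N]])
    have "?D (Suc n) \<zero>\<^bsub>?C (Suc (Suc n))\<^esub> = \<zero>\<^bsub>?C (Suc n)\<^esub>"
      using tensor_map_cls[OF mP mP N dh F.zero_closed] t0
        module_hom_zero[OF module_free module_free push_hom[OF dh]] by metis
    then have z: "\<zero>\<^bsub>?C (Suc n)\<^esub> \<in> ?D (Suc n) ` carrier (?C (Suc (Suc n)))"
      using C2.zero_closed by (metis image_eqI)
    have "zero_module (quotient_module ((?C (Suc n))\<lparr>carrier := cycles ?C ?D (Suc n)\<rparr>)
        (?D (Suc n) ` carrier (?C (Suc (Suc n)))))"
      using zero unfolding Tor_def ch homology_module_def by simp
    from zero_quotient_moduleD[OF this C z] Z
    have "Z \<in> ?D (Suc n) ` carrier (?C (Suc (Suc n)))" by auto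
    then show "\<exists>Y\<in>carrier (?C (Suc (Suc n))). Z = ?D (Suc n) Y" by blast
  qed
qed

lemma (in cring) submodule_free_ideal_part:
  assumes "ideal K R" "submodule L R (Free C)"
  shows "submodule {l \<in> L. \<forall>j. l j \<in> K} R (Free C)"
proof -
  interpret K: ideal K R by fact
  interpret F: module R "Free C" by (rule module_free)
  note E = F.submoduleE[OF assms(2)]
  have s: "a \<odot>\<^bsub>Free C\<^esub> l \<in> {l \<in> L. \<forall>j. l j \<in> K}" if "a \<in> carrier R" "l \<in> {l \<in> L. \<forall>j. l j \<in> K}" for a l
    using E(4)[of a l] that K.I_l_closed by simp
  show ?thesis
  proof (rule F.submoduleI)
    fix l assume l: "l \<in> {l \<in> L. \<forall>j. l j \<in> K}"
    then have "l \<in> Vec C" using E(1) by blast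
    then show "\<ominus>\<^bsub>Free C\<^esub> l \<in> {l \<in> L. \<forall>j. l j \<in> K}"
      using s[of "\<ominus> \<one>" l] l F.smult_l_minus[of \<one> l] by (simp del: free_simps)
    fix l' assume "l' \<in> {l \<in> L. \<forall>j. l j \<in> K}"
    then show "l \<oplus>\<^bsub>Free C\<^esub> l' \<in> {l \<in> L. \<forall>j. l j \<in> K}"
      using E(5)[of l l'] l by simp
  qed (use s E(1) submodule_zero_closed[OF module_free assms(2)] in auto)
qed

lemma (in ring) ideal_finsum:
  assumes "ideal K R" "finite A" "\<And>i. i \<in> A \<Longrightarrow> f i \<in> K"
  shows "(\<Oplus>i\<in>A. f i) \<in> K"
proof -
  interpret K: ideal K R by fact
  show ?thesis using assms(2,3)
  proof (induction A rule: finite_induct)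
    case (insert a A)
    then show ?case using K.Icarr by (simp add: Pi_def)
  qed simp
qed

section \<open>Minimal presentations and the square of the maximal ideal\<close>

context split_local_ring
begin

text \<open>An exact sequence \<open>Free B1 \<rightarrow> Free B0 \<rightarrow> V \<rightarrow>
  0\<close>, so that \<open>Ker B1 B0 G\<close> is a second syzygy of \<open>V\<close>. Its
  coordinates lie in \<open>mx\<close>, which is what lets it split into its parts over
  \<open>I\<close> and over \<open>J\<close>.\<close>

definition min_pres :: "('a, 'm) module \<Rightarrow> 'x set \<Rightarrow> ('x \<Rightarrow> 'm) \<Rightarrow> 'y set \<Rightarrow> ('y \<Rightarrow> 'x \<Rightarrow> 'a) \<Rightarrow> bool"
  where "min_pres V B0 y B1 G \<longleftrightarrow>
    finite B0 \<and> (\<forall>b\<in>B0. y b \<in> carrier V) \<and> lin R V y ` Vec B0 = carrier V \<and>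
    finite B1 \<and> (\<forall>b\<in>B1. G b \<in> Vec B0) \<and>
    lin R (Free B0) G ` Vec B1 = {v \<in> Vec B0. lin R V y v = \<zero>\<^bsub>V\<^esub>} \<and>
    (\<forall>v\<in>Ker B1 B0 G. \<forall>b. v b \<in> mx)"

lemma min_presD:
  assumes "min_pres V B0 y B1 G"
  shows "finite B0" "\<And>b. b \<in> B0 \<Longrightarrow> y b \<in> carrier V" "lin R V y ` Vec B0 = carrier V"
    "finite B1" "\<And>b. b \<in> B1 \<Longrightarrow> G b \<in> Vec B0"
    "lin R (Free B0) G ` Vec B1 = {v \<in> Vec B0. lin R V y v = \<zero>\<^bsub>V\<^esub>}"
    "\<And>v b. v \<in> Ker B1 B0 G \<Longrightarrow> v b \<in> mx"
  using assms unfolding min_pres_def by simp_all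

lemma submodule_Ker:
  assumes "\<And>b. b \<in> B \<Longrightarrow> G b \<in> Vec C"
  shows "submodule (Ker B C G) R (Free B)"
proof -
  have "lin R (Free C) G \<in> Hom (Free B) (Free C)" by (rule lin_hom[OF module_free assms])
  from submodule_kernel[OF module_free module_free this] show ?thesis by simp
qed

lemma min_pres_proj_dim:
  fixes V :: "('a, 'm) module" and B0 B1 :: "('m \<times> 'a) list set"
  assumes V: "module R V" and pres: "min_pres V B0 y B1 G" and "Ker B1 B0 G = {\<lambda>_. \<zero>}"
  shows "proj_dim R V \<le> 1"
proof (rule proj_dim_le_1[OF V _ min_presD(3)[OF pres] _ min_presD(6)[OF pres] assms(3)])
  show "lin R V y \<in> Hom (Free B0) V" by (rule lin_hom[OF V min_presD(2)[OF pres]])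
  show "lin R (Free B0) G \<in> Hom (Free B1) (Free B0)" by (rule lin_hom[OF module_free min_presD(5)[OF pres]])
qed

lemma min_pres_splits:
  assumes "min_pres V B0 y B1 G" "v \<in> Ker B1 B0 G"
  shows "\<exists>f\<in>Ker B1 B0 G. \<exists>g\<in>Ker B1 B0 G. \<forall>t. f t \<in> I \<and> g t \<in> J \<and> v t = f t \<oplus> g t"
  by (rule kernel_splits[OF min_presD(4,5)[OF assms(1)]]) (use min_presD(7)[OF assms(1)] assms(2) in auto)

lemma ex_min_pres:
  assumes V: "module R V" and fg: "finitely_generated R V" and inf: "infinite (UNIV :: 'x set)"
  shows "\<exists>(B0 :: 'x set) y (B1 :: 'x set) G. min_pres V B0 y B1 G"
proof -
  obtain A where A: "finite A" "A \<subseteq> carrier V" "span_of R V A = carrier V"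
    using fg unfolding finitely_generated_def by auto
  obtain B0 :: "'x set" and y where y: "finite B0" "\<And>b. b \<in> B0 \<Longrightarrow> y b \<in> carrier V"
    "lin R V y ` Vec B0 = span_of R V A"
    "\<And>v b. v \<in> Vec B0 \<Longrightarrow> lin R V y v = \<zero>\<^bsub>V\<^esub> \<Longrightarrow> v b \<in> mx"
    using minimal_cover[OF V A(1,2) inf] by blast
  have K: "submodule {v \<in> Vec B0. lin R V y v = \<zero>\<^bsub>V\<^esub>} R (Free B0)"
    by (rule submodule_kernel[OF module_free V lin_hom[OF V y(2)]])
  obtain B1 :: "'x set" and G where G: "finite B1"
    "\<And>b. b \<in> B1 \<Longrightarrow> G b \<in> {v \<in> Vec B0. lin R V y v = \<zero>\<^bsub>V\<^esub>}"
    "lin R (Free B0) G ` Vec B1 = {v \<in> Vec B0. lin R V y v = \<zero>\<^bsub>V\<^esub>}"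
    "\<And>v b. v \<in> Vec B1 \<Longrightarrow> lin R (Free B0) G v = (\<lambda>_. \<zero>) \<Longrightarrow> v b \<in> mx"
    using minimal_cover_free[OF y(1) K inf] by blast
  show ?thesis unfolding min_pres_def
    by (rule exI[of _ B0], rule exI[of _ y], rule exI[of _ B1], rule exI[of _ G])
      (use y(1-3) G A(3) in auto)
qed

text \<open>The square of \<open>mx\<close> lies in \<open>I + mx J\<close>, as one sees by
  splitting one factor. Since \<open>J\<close> meets \<open>I\<close> in zero, \<open>J\<close>
  inside the square would give \<open>J = mx J\<close> and then \<open>J = 0\<close> by Nakayama.
  Containment in the square is phrased through all ideals that contain the products, which avoids a
  product of ideals.\<close>

lemma J_not_in_square:
  assumes J: "\<And>Q'. ideal Q' R \<Longrightarrow> (\<And>m m'. m \<in> mx \<Longrightarrow> m' \<in> mx \<Longrightarrow> m \<otimes> m' \<in> Q') \<Longrightarrow> J \<subseteq> Q'"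
  shows False
proof -
  let ?V = regular_module
  interpret V: module R ?V by (rule module_regular)
  obtain A where A: "A \<subseteq> carrier R" "finite A" "J = Idl A" using finetely_gen[OF ideal_J] by auto
  have "ideal (span_of R ?V A) R"
    using submodule_span_of[OF module_regular, of A] A(1) by (simp add: regular_submodule_iff)
  then have "Idl A \<subseteq> span_of R ?V A" by (rule genideal_minimal) (rule span_of_superset)
  moreover have "span_of R ?V A \<subseteq> Idl A"
    by (rule span_of_least) (use genideal_ideal[OF A(1)] genideal_self[OF A(1)] regular_submodule_iff in auto)
  ultimately have span: "span_of R ?V A = J" using A(3) by auto
  let ?G = "{m \<odot>\<^bsub>?V\<^esub> h | m h. m \<in> mx \<and> h \<in> J}"
  let ?D = "span_of R ?V ?G"
  have GJ: "?G \<subseteq> J" using J.I_l_closed mx.Icarr by auto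
  have D: "ideal ?D R"
    using submodule_span_of[OF module_regular, of ?G] GJ J.a_subset by (auto simp: regular_submodule_iff)
  interpret D: ideal ?D R by (rule D)
  have DJ: "?D \<subseteq> J" by (rule span_of_least) (use GJ ideal_J regular_submodule_iff in auto)
  have mJ: "m \<otimes> j \<in> ?D" if "m \<in> mx" "j \<in> J" for m j
    using span_of_superset[of ?G ?V] that by auto
  let ?Q = "I <+>\<^bsub>R\<^esub> ?D"
  have "J \<subseteq> ?Q"
  proof (rule J)
    show "ideal ?Q R" by (rule add_ideals[OF ideal_I D])
    fix m m' assume m: "m \<in> mx" "m' \<in> mx"
    then obtain i j where ij: "i \<in> I" "j \<in> J" "m' = i \<oplus> j" using mx_iff by auto
    have "m \<otimes> m' = m \<otimes> i \<oplus> m \<otimes> j" using ij m mx.Icarr I.Icarr J.Icarr by (simp add: r_distr)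
    moreover have "m \<otimes> i \<in> I" using ij m mx.Icarr by (simp add: I.I_l_closed)
    ultimately show "m \<otimes> m' \<in> ?Q" using mJ[OF m(1) ij(2)] by (auto simp: set_add_def')
  qed
  have "J \<subseteq> ?D"
  proof
    fix z assume z: "z \<in> J"
    then obtain i s where eqs: "i \<in> I" "s \<in> ?D" "z = i \<oplus> s" using \<open>J \<subseteq> ?Q\<close> by (auto simp: set_add_def')
    have c: "i \<in> carrier R" "s \<in> carrier R" using eqs I.Icarr D.Icarr by auto
    have "i = z \<ominus> s" using c eqs(3) by (simp add: minus_eq a_assoc r_neg)
    moreover have "z \<ominus> s \<in> J" using z eqs(2) DJ by (auto simp: minus_eq)
    ultimately have "i = \<zero>" using eqs(1) Int_IJ by auto
    then show "z \<in> ?D" using eqs c by simp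
  qed
  then have "J = {\<zero>\<^bsub>?V\<^esub>}" by (intro nakayama[OF module_regular A(2) _ span]) (use A(1) in auto)
  then show False using J_nonzero by simp
qed

end

section \<open>Shifting between modules killed by \<open>J\<close> and modules killed by
  \<open>I\<close>\<close>

locale split_complex = split_local_ring +
  fixes P d
  assumes complex: "projective_complex R P d"
begin

sublocale projective_complex R P d by (rule complex)

text \<open>The type argument fixes the index type of the free modules.\<close>

definition nz_exact :: "'x itself \<Rightarrow> _ set \<Rightarrow> nat \<Rightarrow> bool"
  where "nz_exact _ K m \<longleftrightarrow> (\<exists>(C :: 'x set) L. finite C \<and> submodule L R (Free C) \<and> L \<noteq> {\<lambda>_. \<zero>} \<and>
    (\<forall>l \<in> L. \<forall>j. l j \<in> K) \<and> exact_at R P d m L)"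

lemma swap_complex: "split_complex R J I P d"
  by (intro split_complex.intro split_complex_axioms.intro swap complex)

text \<open>\<open>J\<close> annihilates \<open>L\<close>, so every multiple of a basis vector by an
  element of \<open>J\<close> is a relation of the cover. Minimality puts all relations into
  \<open>mx\<close>, where \<open>kernel_splits\<close> applies.\<close>

lemma exact_at_minimal_syzygy:
  fixes C :: "'x set"
  assumes inf: "infinite (UNIV :: 'x set)" and C: "finite C" "submodule L R (Free C)" "L \<noteq> {\<lambda>_. \<zero>}"
    and LI: "\<forall>l\<in>L. \<forall>j. l j \<in> I" and ex: "exact_at R P d (Suc m) L"
  obtains A :: "'x set" and L' where "finite A" "A \<noteq> {}" "submodule L' R (Free A)"
    "\<And>l t. l \<in> L' \<Longrightarrow> l t \<in> mx" "\<And>z t. z \<in> J \<Longrightarrow> t \<in> A \<Longrightarrow> (\<lambda>s. if s = t then z else \<zero>) \<in> L'"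
    "exact_at R P d m L'"
    "\<And>l. l \<in> L' \<Longrightarrow> \<exists>f\<in>L'. \<exists>g\<in>L'. \<forall>j. f j \<in> I \<and> g j \<in> J \<and> l j = f j \<oplus> g j"
proof -
  obtain A :: "'x set" and G where A: "finite A" and GL: "\<And>b. b \<in> A \<Longrightarrow> G b \<in> L"
    and im: "lin R (Free C) G ` Vec A = L"
    and min: "\<And>v b. v \<in> Vec A \<Longrightarrow> lin R (Free C) G v = (\<lambda>_. \<zero>) \<Longrightarrow> v b \<in> mx"
    using minimal_cover_free[OF C(1,2) inf] by blast
  let ?F = "Free A"
  interpret F: module R ?F by (rule module_free)
  let ?L = "{v \<in> carrier ?F. lin R (Free C) G v = (\<lambda>_. \<zero>)}"
  have G: "G b \<in> Vec C" if "b \<in> A" for b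
    using GL[OF that] submodule_free_subset[OF C(2)] by blast
  have lh: "lin R (Free C) G \<in> Hom ?F (Free C)"
    by (rule lin_hom[OF module_free G])
  have sub: "submodule ?L R ?F" using submodule_kernel[OF module_free module_free lh] by simp
  have ne: "A \<noteq> {}"
  proof
    assume "A = {}"
    then have "carrier ?F = {\<zero>\<^bsub>?F\<^esub>}" using F.zero_closed by (auto simp: free_carrier)
    then have "L = {\<lambda>_. \<zero>}" using im module_hom_zero[OF module_free module_free lh] by auto
    then show False using C(3) by simp
  qed
  have zt: "(\<lambda>s. if s = t then z else \<zero>) \<in> ?L" if z: "z \<in> J" and t: "t \<in> A" for z t
  proof -
    have zR: "z \<in> carrier R" using z by (rule J.Icarr)
    have bt: "\<e> t \<in> carrier ?F" using t by simp
    have eq: "(\<lambda>s. if s = t then z else \<zero>) = z \<odot>\<^bsub>?F\<^esub> \<e> t"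
      using zR by (auto simp: basis_vector_def)
    have "lin R (Free C) G (z \<odot>\<^bsub>?F\<^esub> \<e> t) = z \<odot>\<^bsub>Free C\<^esub> G t"
      using module_homD(3)[OF lh zR bt] lin_basis[of "Free C" G t, OF module_free G[OF t]] by simp
    also have "\<dots> = (\<lambda>_. \<zero>)" using mult_JI[OF LI[rule_format, OF GL[OF t]] z] by simp
    finally show ?thesis unfolding eq using F.smult_closed[OF zR bt] by blast
  qed
  have exL: "exact_at R P d m ?L" by (rule exact_at_shift[OF A G]) (use ex im in auto)
  have dec: "\<exists>f\<in>?L. \<exists>g\<in>?L. \<forall>j. f j \<in> I \<and> g j \<in> J \<and> l j = f j \<oplus> g j" if l: "l \<in> ?L" for l
  proof -
    have "l \<in> carrier ?F" "lin R (Free C) G l = (\<lambda>_. \<zero>)" "\<And>t. l t \<in> mx" using l min by auto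
    from kernel_splits[OF A G this] show ?thesis .
  qed
  show thesis
    by (rule that[OF A ne sub _ zt exL dec]) (use min in auto)
qed

text \<open>The \<open>J\<close>-part of the minimal syzygy is a direct summand, so it inherits
  exactness one degree lower. It is nonzero because it contains \<open>z\<close> times a basis
  vector for a nonzero \<open>z\<close> in \<open>J\<close>.\<close>

lemma nz_exact_step:
  assumes inf: "infinite (UNIV :: 'x set)" and nz: "nz_exact TYPE('x) I (Suc m)"
  shows "nz_exact TYPE('x) J m"
proof -
  obtain C :: "'x set" and L where C: "finite C" "submodule L R (Free C)" "L \<noteq> {\<lambda>_. \<zero>}"
    and LI: "\<forall>l\<in>L. \<forall>j. l j \<in> I" and ex: "exact_at R P d (Suc m) L"
    using nz unfolding nz_exact_def by blast
  obtain A :: "'x set" and L' where A: "finite A" "A \<noteq> {}" "submodule L' R (Free A)"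
    "\<And>l t. l \<in> L' \<Longrightarrow> l t \<in> mx" "\<And>z t. z \<in> J \<Longrightarrow> t \<in> A \<Longrightarrow> (\<lambda>s. if s = t then z else \<zero>) \<in> L'"
    "exact_at R P d m L'"
    "\<And>l. l \<in> L' \<Longrightarrow> \<exists>f\<in>L'. \<exists>g\<in>L'. \<forall>j. f j \<in> I \<and> g j \<in> J \<and> l j = f j \<oplus> g j"
    using exact_at_minimal_syzygy[OF inf C LI ex] by blast
  let ?L = "{l \<in> L'. \<forall>j. l j \<in> J}"
  have "exact_at R P d m ?L"
  proof (rule exact_at_part[OF ideal_J ideal_I _ submodule_free_subset[OF A(3)] _ A(6)])
    show "J \<inter> I = {\<zero>}" using Int_IJ by auto
    fix l assume "l \<in> L'"
    then obtain f g where fg: "f \<in> L'" "g \<in> L'" "\<And>j. f j \<in> I \<and> g j \<in> J \<and> l j = f j \<oplus> g j" using A(7) by blast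
    have "g j \<in> J \<and> f j \<in> I \<and> l j = g j \<oplus> f j" for j
      using fg(3)[of j] a_comm[of "f j" "g j"] I.Icarr[of "f j"] J.Icarr[of "g j"] by simp
    then show "\<exists>f\<in>L'. \<exists>g\<in>L'. \<forall>j. f j \<in> J \<and> g j \<in> I \<and> l j = f j \<oplus> g j"
      by (intro bexI[OF _ fg(2)] bexI[OF _ fg(1)] allI)
  qed
  moreover have "?L \<noteq> {\<lambda>_. \<zero>}"
  proof -
    obtain z where z: "z \<in> J" "z \<noteq> \<zero>" using J_nonzero J.zero_closed by blast
    obtain t where t: "t \<in> A" using A(2) by auto
    have "(\<lambda>s. if s = t then z else \<zero>) \<in> ?L" using A(5)[OF z(1) t] z(1) J.zero_closed by auto
    moreover have "(\<lambda>s. if s = t then z else \<zero>) \<noteq> (\<lambda>_. \<zero>)" using z(2) by metis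
    ultimately show ?thesis by blast
  qed
  moreover have "submodule ?L R (Free A)" by (rule submodule_free_ideal_part[OF ideal_J A(3)])
  moreover have "\<forall>l\<in>?L. \<forall>j. l j \<in> J" by simp
  ultimately show ?thesis unfolding nz_exact_def
    by (intro exI[of _ A] exI[of _ ?L] conjI A(1))
qed

lemma nz_exact_step':
  assumes inf: "infinite (UNIV :: 'x set)" and nz: "nz_exact TYPE('x) J (Suc m)"
  shows "nz_exact TYPE('x) I m"
proof -
  interpret sw: split_complex R J I P d by (rule swap_complex)
  show ?thesis using sw.nz_exact_step[OF inf] nz by (simp add: nz_exact_def sw.nz_exact_def)
qed

text \<open>Two steps lead back to the same ideal.\<close>

lemma nz_exact_down:
  assumes inf: "infinite (UNIV :: 'x set)"
  shows "nz_exact TYPE('x) I (k + 2 * q) \<Longrightarrow> nz_exact TYPE('x) I k"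
    and "nz_exact TYPE('x) J (k + 2 * q) \<Longrightarrow> nz_exact TYPE('x) J k"
proof (induction q)
  case (Suc q)
  { case 1
    then show ?case using Suc.IH(1) nz_exact_step[OF inf, of "Suc (k + 2 * q)"] nz_exact_step'[OF inf, of "k + 2 * q"] by simp }
  { case 2
    then show ?case using Suc.IH(2) nz_exact_step'[OF inf, of "Suc (k + 2 * q)"] nz_exact_step[OF inf, of "k + 2 * q"] by simp }
qed simp_all

text \<open>The class \<open>z e \<otimes> c\<close> of \<open>Tor\<close> is realised as a cycle of
  \<open>LP\<close> over \<open>L'\<close> in degree 2 of \<open>P\<close>. That it is a boundary
  forces \<open>z\<close> into the square of \<open>mx\<close> for every \<open>z\<close> in
  \<open>J\<close>, against \<open>J_not_in_square\<close>. The index types of the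
  \<open>M\<close>-side and the \<open>N\<close>-side differ, whence \<open>'x\<close> and
  \<open>'y\<close>.\<close>

lemma syzygy_part_zero:
  fixes B0 B1 :: "'x set"
  assumes inf: "infinite (UNIV :: 'x set)" and inf': "infinite (UNIV :: 'y set)" and nz: "nz_exact TYPE('y) I 2"
    and M: "module R M" and res: "projective_resolution R M P d \<epsilon>"
    and pres: "min_pres M B0 y B1 G" and v: "v \<in> Ker B1 B0 G" "\<And>b. v b \<in> I"
  shows "v = (\<lambda>_. \<zero>)"
proof (rule ccontr)
  assume v0: "v \<noteq> (\<lambda>_. \<zero>)"
  obtain C :: "'y set" and L where C: "finite C" "submodule L R (Free C)" "L \<noteq> {\<lambda>_. \<zero>}"
    and LI: "\<forall>l\<in>L. \<forall>j. l j \<in> I" and exL: "exact_at R P d (Suc 1) L"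
    using nz unfolding nz_exact_def by (auto simp: numeral_2_eq_2)
  obtain A :: "'y set" and L' where "finite A" and A1: "A \<noteq> {}" and L': "submodule L' R (Free A)"
    and A3: "\<And>l t. l \<in> L' \<Longrightarrow> l t \<in> mx" and A4: "\<And>z t. z \<in> J \<Longrightarrow> t \<in> A \<Longrightarrow> (\<lambda>s. if s = t then z else \<zero>) \<in> L'"
    and ex: "exact_at R P d 1 L'"
    and "\<And>l. l \<in> L' \<Longrightarrow> \<exists>f\<in>L'. \<exists>g\<in>L'. \<forall>j. f j \<in> I \<and> g j \<in> J \<and> l j = f j \<oplus> g j"
    by (rule exact_at_minimal_syzygy[OF inf' C LI exL], rule that, assumption+)
  note A2 = submodule_free_subset[OF L']
  note B1 = min_presD(4)[OF pres] and G = min_presD(5)[OF pres]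
  define e0 where "e0 = lin R M y"
  have e0: "e0 \<in> Hom (Free B0) M" "e0 ` Vec B0 = carrier M"
    and e1: "lin R (Free B0) G ` Vec B1 = {v \<in> Vec B0. e0 v = \<zero>\<^bsub>M\<^esub>}"
    unfolding e0_def using lin_hom[OF M min_presD(2)[OF pres]] min_presD(3,6)[OF pres] by simp_all
  let ?F0 = "Free B0" and ?F1 = "Free B1"
  let ?e1 = "lin R ?F0 G"
  let ?K2 = "{v \<in> carrier ?F1. ?e1 v = (\<lambda>_. \<zero>)}"
  let ?KI = "{l \<in> ?K2. \<forall>j. l j \<in> I}"
  interpret M: module R M by fact
  interpret F0: module R ?F0 by (rule module_free)
  interpret F1: module R ?F1 by (rule module_free)
  have e1h: "?e1 \<in> Hom ?F1 ?F0" by (rule lin_hom[OF module_free G])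
  have K2: "submodule ?K2 R ?F1" using submodule_kernel[OF module_free module_free e1h] by simp
  have KI: "submodule ?KI R ?F1" by (rule submodule_free_ideal_part[OF ideal_I K2])
  obtain B2 :: "'x set" and G2 where B2: "finite B2" and G2K: "\<And>b. b \<in> B2 \<Longrightarrow> G2 b \<in> ?K2"
    and im2: "lin R ?F1 G2 ` Vec B2 = ?K2"
    and min2: "\<And>v b. v \<in> Vec B2 \<Longrightarrow> lin R ?F1 G2 v = (\<lambda>_. \<zero>) \<Longrightarrow> v b \<in> mx"
    using minimal_cover_free[OF B1 K2 inf] by blast
  let ?F2 = "Free B2" let ?e2 = "lin R ?F1 G2"
  interpret F2: module R ?F2 by (rule module_free)
  have G2: "G2 b \<in> carrier ?F1" if "b \<in> B2" for b using G2K[OF that] by simp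
  have e2h: "?e2 \<in> Hom ?F2 ?F1" by (rule lin_hom[OF module_free G2])
  have e2K: "?e2 e \<in> ?K2" if "e \<in> carrier ?F2" for e using im2 that by blast

  \<comment> \<open>Finds the minimal generator \<open>e\<close>. If every vector mapped into
    \<open>?KI\<close> had all coordinates in \<open>mx\<close>, then \<open>?KI\<close> would equal
    \<open>mx\<close> times itself and vanish by Nakayama, although it contains
    \<open>v\<close>.\<close>
  have "\<exists>e\<in>carrier ?F2. ?e2 e \<in> ?KI \<and> (\<exists>b. e b \<notin> mx)"
  proof (rule ccontr)
    assume no: "\<not> ?thesis"
    have "\<exists>fg. fst fg \<in> ?K2 \<and> snd fg \<in> ?K2 \<and> (\<forall>t. fst fg t \<in> I \<and> snd fg t \<in> J \<and> G2 b t = fst fg t \<oplus> snd fg t)"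
      if b: "b \<in> B2" for b
    proof -
      obtain f g where "f \<in> ?K2" "g \<in> ?K2" "\<forall>t. f t \<in> I \<and> g t \<in> J \<and> G2 b t = f t \<oplus> g t"
        using min_pres_splits[OF pres G2K[OF b]] by (elim bexE)
      then show ?thesis by (intro exI[of _ "(f, g)"]) simp
    qed
    then have "\<forall>b\<in>B2. \<exists>fg. fst fg \<in> ?K2 \<and> snd fg \<in> ?K2 \<and> (\<forall>t. fst fg t \<in> I \<and> snd fg t \<in> J \<and> G2 b t = fst fg t \<oplus> snd fg t)"
      by (rule ballI)
    from bchoice[OF this] obtain fg where fg0: "\<forall>b\<in>B2. fst (fg b) \<in> ?K2 \<and> snd (fg b) \<in> ?K2 \<and>
      (\<forall>t. fst (fg b) t \<in> I \<and> snd (fg b) t \<in> J \<and> G2 b t = fst (fg b) t \<oplus> snd (fg b) t)" by (rule exE)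
    define f g where "f b = fst (fg b)" and "g b = snd (fg b)" for b
    have fg: "f b \<in> ?K2 \<and> g b \<in> ?K2 \<and> (\<forall>t. f b t \<in> I \<and> g b t \<in> J \<and> G2 b t = f b t \<oplus> g b t)" if "b \<in> B2" for b
      using bspec[OF fg0 that] unfolding f_def g_def .
    have fKI: "f b \<in> ?KI" if "b \<in> B2" for b using fg[OF that] by blast
    let ?S = "{m \<odot>\<^bsub>?F1\<^esub> h | m h. m \<in> mx \<and> h \<in> ?KI}"
    have SF: "?S \<subseteq> carrier ?F1"
    proof clarify
      fix m h assume "m \<in> mx" "h \<in> carrier ?F1"
      then show "m \<odot>\<^bsub>?F1\<^esub> h \<in> carrier ?F1" using mx.Icarr F1.smult_closed by blast
    qed
    have Ssub: "submodule (span_of R ?F1 ?S) R ?F1" by (rule submodule_span_of[OF module_free SF])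
    have "?KI \<subseteq> span_of R ?F1 ?S"
    proof
      fix w assume w: "w \<in> ?KI"
      then obtain e where e: "e \<in> carrier ?F2" "w = ?e2 e" using im2 by blast
      then have emx: "e b \<in> mx" for b using no w by blast
      have "\<forall>b. \<exists>i j. i \<in> I \<and> j \<in> J \<and> e b = i \<oplus> j" using emx mx_iff by blast
      then obtain p q where pq: "\<And>b. p b \<in> I" "\<And>b. q b \<in> J" "\<And>b. e b = p b \<oplus> q b" by metis
      have c: "p b \<in> carrier R" "q b \<in> carrier R" for b using pq I.Icarr J.Icarr by auto
      have fc: "f b t \<in> carrier R" "g b t \<in> carrier R" if "b \<in> B2" for b t
        using fg[OF that] I.Icarr J.Icarr by auto
      have x: "p b \<odot>\<^bsub>?F1\<^esub> f b \<in> carrier ?F1" if "b \<in> B2" for b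
        using F1.smult_closed[OF c(1), of "f b" b] fg[OF that] by blast
      let ?x = "\<Oplus>\<^bsub>?F1\<^esub>b\<in>B2. p b \<odot>\<^bsub>?F1\<^esub> f b"
      have xS: "?x \<in> span_of R ?F1 ?S"
        by (rule submodule_finsum[OF module_free Ssub B2], rule subsetD[OF span_of_superset])
          (use pq(1) I_mx fKI in blast)
      \<comment> \<open>The mixed products of \<open>p\<close> with \<open>g\<close> and of
        \<open>q\<close> with \<open>f\<close> vanish because \<open>I J = 0\<close>. What is left
        is a sum in \<open>I\<close> plus a sum in \<open>J\<close>; as \<open>w t\<close> is in
        \<open>I\<close>, the second sum is zero, so \<open>w\<close> is a combination of the
        \<open>f b\<close> with coefficients in \<open>mx\<close>.\<close>
      have "w t = ?x t" for t
      proof -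
        have "w t = (\<Oplus>b\<in>B2. e b \<otimes> G2 b t)"
          unfolding e(2) by (rule lin_free_pointwise[OF B2 G2 e(1)])
        also have "\<dots> = (\<Oplus>b\<in>B2. p b \<otimes> f b t \<oplus> q b \<otimes> g b t)"
        proof (rule finsum_cong'[OF refl])
          fix b assume b: "b \<in> B2"
          have "e b \<otimes> G2 b t = (p b \<oplus> q b) \<otimes> (f b t \<oplus> g b t)" using pq(3) fg[OF b] by simp
          also have "\<dots> = p b \<otimes> f b t \<oplus> q b \<otimes> g b t"
            using c[of b] fc[OF b, of t] mult_IJ[of "p b" "g b t"] mult_JI[of "f b t" "q b"] pq(1,2)[of b] fg[OF b]
            by (simp add: l_distr r_distr)
          finally show "e b \<otimes> G2 b t = p b \<otimes> f b t \<oplus> q b \<otimes> g b t" .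
        qed (use c fc in auto)
        also have "\<dots> = (\<Oplus>b\<in>B2. p b \<otimes> f b t) \<oplus> (\<Oplus>b\<in>B2. q b \<otimes> g b t)"
          by (rule finsum_addf) (use c fc in auto)
        finally have w_eq: "w t = (\<Oplus>b\<in>B2. p b \<otimes> f b t) \<oplus> (\<Oplus>b\<in>B2. q b \<otimes> g b t)" (is "_ = ?a \<oplus> ?b") .
        have aI: "?a \<in> I"
          by (rule ideal_finsum[OF ideal_I B2]) (use pq(1) fc I.I_r_closed in blast)
        have bJ: "?b \<in> J"
          by (rule ideal_finsum[OF ideal_J B2]) (use pq(2) fc J.I_r_closed in blast)
        have cc: "?a \<in> carrier R" "?b \<in> carrier R" using aI bJ I.Icarr J.Icarr by auto
        have "?b = w t \<ominus> ?a" using w_eq cc by (simp add: minus_eq a_comm a_assoc r_neg2 r_neg1)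
        then have "?b \<in> I" using w aI by (auto simp: minus_eq)
        then have "?b = \<zero>" using bJ Int_IJ by auto
        then have "w t = ?a" using w_eq cc by simp
        also have "\<dots> = ?x t" using free_finsum[OF B2 x, of _ t] by simp
        finally show ?thesis .
      qed
      then have "w = ?x" by auto
      then show "w \<in> span_of R ?F1 ?S" using xS by simp
    qed
    moreover obtain D where D: "finite D" "D \<subseteq> ?KI" "span_of R ?F1 D = ?KI"
      by (rule noetherian_free[OF B1 KI])
    ultimately have "?KI = {\<zero>\<^bsub>?F1\<^esub>}" by (intro nakayama[OF module_free D(1) _ D(3)]) (use D(2) in auto)
    moreover have "v \<in> ?KI" using v by simp
    ultimately show False using v0 by simp
  qed
  then obtain e b where e: "e \<in> carrier ?F2" "?e2 e \<in> ?KI" and eb: "e b \<notin> mx" by blast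
  have u: "e b \<in> Units R" by (rule unit_if_notin_mx[OF free_closed[OF e(1)] eb])

  have \<epsilon>: "\<epsilon> \<in> Hom (P 0) M" "\<epsilon> ` carrier (P 0) = carrier M"
    "d 0 ` carrier (P (Suc 0)) = {x \<in> carrier (P 0). \<epsilon> x = \<zero>\<^bsub>M\<^esub>}"
    using res unfolding projective_resolution_def by auto
  interpret P0: module R "P 0" by (rule module_P)
  interpret P1: module R "P (Suc 0)" by (rule module_P)
  interpret P2: module R "P (Suc (Suc 0))" by (rule module_P)
  interpret P3: module R "P (Suc (Suc (Suc 0)))" by (rule module_P)
  note d0 = d_hom[of 0] and d1 = d_hom[of "Suc 0"] and d2 = d_hom[of "Suc (Suc 0)"]
  have e0e1: "e0 (?e1 x) = \<zero>\<^bsub>M\<^esub>" if "x \<in> carrier ?F1" for x using e1 that by blast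
  have e1e2: "?e1 (?e2 x) = (\<lambda>_. \<zero>)" if "x \<in> carrier ?F2" for x using e2K[OF that] by blast
  have \<epsilon>d: "\<epsilon> (d 0 x) = \<zero>\<^bsub>M\<^esub>" if "x \<in> carrier (P (Suc 0))" for x using \<epsilon>(3) that by blast
  note c0 = module_homD(1)[OF e0(1)] and c1 = module_homD(1)[OF e1h] and c2 = module_homD(1)[OF e2h]

  \<comment> \<open>Chain maps over the identity of \<open>M\<close> in degrees 0 to 2:
    \<open>f\<close> from the minimal free modules to \<open>P\<close>, and \<open>g\<close>
    back.\<close>
  obtain f0 where f0: "f0 \<in> Hom ?F0 (P 0)" "\<And>x. x \<in> carrier ?F0 \<Longrightarrow> \<epsilon> (f0 x) = e0 x"
    using projective_lift[OF projective_free module_P M e0(1) \<epsilon>(1)] c0 \<epsilon>(2) by blast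
  obtain g0 where g0: "g0 \<in> Hom (P 0) ?F0" "\<And>x. x \<in> carrier (P 0) \<Longrightarrow> e0 (g0 x) = \<epsilon> x"
    using projective_lift[OF projective module_free M \<epsilon>(1) e0(1)] module_homD(1)[OF \<epsilon>(1)] e0(2) by blast
  have f0e1: "f0 (?e1 x) \<in> d 0 ` carrier (P (Suc 0))" if "x \<in> carrier ?F1" for x
    using module_homD(1)[OF f0(1) c1[OF that]] f0(2)[OF c1[OF that]] e0e1[OF that] \<epsilon>(3) by simp
  obtain f1 where f1: "f1 \<in> Hom ?F1 (P (Suc 0))" "\<And>x. x \<in> carrier ?F1 \<Longrightarrow> d 0 (f1 x) = f0 (?e1 x)"
    using projective_lift[OF projective_free module_P module_P module_hom_comp[OF e1h f0(1)] d0 f0e1] by blast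
  have g0d: "g0 (d 0 x) \<in> ?e1 ` carrier ?F1" if "x \<in> carrier (P (Suc 0))" for x
    using module_homD(1)[OF g0(1) module_homD(1)[OF d0 that]] g0(2)[OF module_homD(1)[OF d0 that]] \<epsilon>d[OF that] e1 by simp
  obtain g1 where g1: "g1 \<in> Hom (P (Suc 0)) ?F1" "\<And>x. x \<in> carrier (P (Suc 0)) \<Longrightarrow> ?e1 (g1 x) = g0 (d 0 x)"
    using projective_lift[OF projective module_free module_free module_hom_comp[OF d0 g0(1)] e1h g0d] by blast
  have f1e2: "f1 (?e2 x) \<in> d (Suc 0) ` carrier (P (Suc (Suc 0)))" if "x \<in> carrier ?F2" for x
    using f1(2)[OF c2[OF that]] e1e2[OF that] module_hom_zero[OF module_free module_P f0(1)]
      module_homD(1)[OF f1(1) c2[OF that]] exact[of 0] by simp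
  obtain f2 where f2: "f2 \<in> Hom ?F2 (P (Suc (Suc 0)))" "\<And>x. x \<in> carrier ?F2 \<Longrightarrow> d (Suc 0) (f2 x) = f1 (?e2 x)"
    using projective_lift[OF projective_free module_P module_P module_hom_comp[OF e2h f1(1)] d1 f1e2] by blast
  have g1d: "g1 (d (Suc 0) x) \<in> ?K2" if "x \<in> carrier (P (Suc (Suc 0)))" for x
    using that g1(2)[OF module_homD(1)[OF d1 that]] d_d[of x 0] module_homD(1)[OF g1(1) module_homD(1)[OF d1 that]]
      module_hom_zero[OF module_P module_free g0(1)] by simp
  obtain g2 where g2: "g2 \<in> Hom (P (Suc (Suc 0))) ?F2"
    "\<And>x. x \<in> carrier (P (Suc (Suc 0))) \<Longrightarrow> ?e2 (g2 x) = g1 (d (Suc 0) x)"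
    using projective_lift[OF projective module_free module_free module_hom_comp[OF d1 g1(1)] e2h g1d[folded im2]] by blast
  note fc0 = module_homD(1)[OF f0(1)] and fc1 = module_homD(1)[OF f1(1)] and fc2 = module_homD(1)[OF f2(1)]
  note gc0 = module_homD(1)[OF g0(1)] and gc1 = module_homD(1)[OF g1(1)] and gc2 = module_homD(1)[OF g2(1)]
  have id0: "(\<lambda>x. x) \<in> Hom ?F0 ?F0" and id1: "(\<lambda>x. x) \<in> Hom ?F1 ?F1" by (rule module_homI; simp)+

  \<comment> \<open>Homotopy between \<open>g \<circ> f\<close> and the identity of the minimal
    side: \<open>g0 f0 - 1 = e1 h0\<close> and \<open>g1 f1 - 1 = e2 h1 + h0 e1\<close>.\<close>
  let ?k0 = "\<lambda>x. g0 (f0 x) \<ominus>\<^bsub>?F0\<^esub> x"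
  have k0: "?k0 \<in> Hom ?F0 ?F0"
    by (rule module_hom_diff[OF module_free module_free module_hom_comp[OF f0(1) g0(1)] id0])
  have k0z: "?k0 x \<in> ?e1 ` carrier ?F1" if x: "x \<in> carrier ?F0" for x
  proof -
    have "e0 (?k0 x) = \<zero>\<^bsub>M\<^esub>"
      using module_hom_minus[OF module_free M e0(1) gc0[OF fc0[OF x]] x] g0(2)[OF fc0[OF x]] f0(2)[OF x] c0[OF x]
      by (simp add: M.minus_eq M.r_neg)
    then show ?thesis using e1 module_homD(1)[OF k0 x] by simp
  qed
  obtain h0 where h0: "h0 \<in> Hom ?F0 ?F1" "\<And>x. x \<in> carrier ?F0 \<Longrightarrow> ?e1 (h0 x) = ?k0 x"
    using projective_lift[OF projective_free module_free module_free k0 e1h k0z] by blast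
  note hc0 = module_homD(1)[OF h0(1)]
  let ?k1 = "\<lambda>x. (g1 (f1 x) \<ominus>\<^bsub>?F1\<^esub> x) \<ominus>\<^bsub>?F1\<^esub> h0 (?e1 x)"
  have k1: "?k1 \<in> Hom ?F1 ?F1"
    by (rule module_hom_diff[OF module_free module_free module_hom_diff[OF module_free module_free
      module_hom_comp[OF f1(1) g1(1)] id1] module_hom_comp[OF e1h h0(1)]])
  have k1z: "?k1 x \<in> ?e2 ` carrier ?F2" if x: "x \<in> carrier ?F1" for x
  proof -
    have "?e1 (?k1 x) = (?e1 (g1 (f1 x)) \<ominus>\<^bsub>?F0\<^esub> ?e1 x) \<ominus>\<^bsub>?F0\<^esub> ?e1 (h0 (?e1 x))"
      using module_hom_minus[OF module_free module_free e1h] gc1[OF fc1[OF x]] x hc0[OF c1[OF x]] F1.minus_closed by simp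
    also have "?e1 (g1 (f1 x)) = g0 (f0 (?e1 x))" using g1(2)[OF fc1[OF x]] f1(2)[OF x] by simp
    also have "?e1 (h0 (?e1 x)) = ?k0 (?e1 x)" by (rule h0(2)[OF c1[OF x]])
    also have "?k0 (?e1 x) \<ominus>\<^bsub>?F0\<^esub> ?k0 (?e1 x) = \<zero>\<^bsub>?F0\<^esub>"
      using module_homD(1)[OF k0 c1[OF x]] F0.r_neg by (simp only: F0.minus_eq)
    finally have "?k1 x \<in> ?K2" using module_homD(1)[OF k1 x] by simp
    then show ?thesis using im2 by blast
  qed
  obtain h1 where h1: "h1 \<in> Hom ?F1 ?F2" "\<And>x. x \<in> carrier ?F1 \<Longrightarrow> ?e2 (h1 x) = ?k1 x"
    using projective_lift[OF projective_free module_free module_free k1 e2h k1z] by blast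
  note hc1 = module_homD(1)[OF h1(1)]

  define p where "p = f2 e"
  have p: "p \<in> carrier (P (Suc (Suc 0)))" unfolding p_def by (rule fc2[OF e(1)])
  \<comment> \<open>No free module in degree 3 is built, so the homotopy stops here. The remaining
    error \<open>?ge\<close> is only known to lie in the kernel of \<open>?e2\<close>, but by
    minimality this puts its coordinates into \<open>mx\<close>.\<close>
  let ?ge = "(g2 p \<ominus>\<^bsub>?F2\<^esub> e) \<ominus>\<^bsub>?F2\<^esub> h1 (?e2 e)"
  have e2e: "?e2 e \<in> carrier ?F1" by (rule c2[OF e(1)])
  have gec: "?ge \<in> carrier ?F2" using gc2[OF p] e(1) hc1[OF e2e] F2.minus_closed by simp
  have ge: "?e2 ?ge = (\<lambda>_. \<zero>)"
  proof -
    let ?y = "g1 (f1 (?e2 e)) \<ominus>\<^bsub>?F1\<^esub> ?e2 e"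
    have yc: "?y \<in> carrier ?F1" by (rule F1.minus_closed[OF gc1[OF fc1[OF e2e]] e2e])
    have hh: "h0 (?e1 (?e2 e)) = \<zero>\<^bsub>?F1\<^esub>"
      using e1e2[OF e(1)] module_hom_zero[OF module_free module_free h0(1)] by simp
    have "?e2 ?ge = (?e2 (g2 p) \<ominus>\<^bsub>?F1\<^esub> ?e2 e) \<ominus>\<^bsub>?F1\<^esub> ?e2 (h1 (?e2 e))"
      using module_hom_minus[OF module_free module_free e2h] gc2[OF p] e(1) hc1[OF e2e] F2.minus_closed by simp
    also have "?e2 (g2 p) = g1 (f1 (?e2 e))" using g2(2)[OF p] f2(2)[OF e(1)] by (simp add: p_def)
    also have "?e2 (h1 (?e2 e)) = ?y \<ominus>\<^bsub>?F1\<^esub> \<zero>\<^bsub>?F1\<^esub>"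
      using h1(2)[OF e2e] unfolding hh .
    also have "?y \<ominus>\<^bsub>?F1\<^esub> \<zero>\<^bsub>?F1\<^esub> = ?y"
      using F1.minus_add_cancel[OF yc F1.zero_closed] F1.r_zero[OF F1.minus_closed[OF yc F1.zero_closed]] by argo
    also have "?y \<ominus>\<^bsub>?F1\<^esub> ?y = \<zero>\<^bsub>?F1\<^esub>"
      using F1.r_neg[OF yc] F1.minus_eq[of ?y ?y] by argo
    finally show ?thesis by simp
  qed
  obtain t0 where t0: "t0 \<in> A" using A1 by auto
  have "J \<subseteq> Q" if Q: "ideal Q R" "\<And>m m'. m \<in> mx \<Longrightarrow> m' \<in> mx \<Longrightarrow> m \<otimes> m' \<in> Q" for Q
  proof
    fix z assume z: "z \<in> J"
    interpret Q: ideal Q R by (rule Q(1))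
    have zR: "z \<in> carrier R" using z by (rule J.Icarr)
    have ze: "z \<odot>\<^bsub>?F1\<^esub> ?e2 e = \<zero>\<^bsub>?F1\<^esub>" using mult_JI[OF _ z] e(2) by auto
    \<comment> \<open>This is \<open>z e \<otimes> c\<close> with \<open>p\<close> the image of
      \<open>e\<close> in \<open>P\<close> and \<open>t0\<close> the index of the generator
      \<open>c\<close>. It is a cycle because \<open>?e2 e\<close> has coordinates in
      \<open>I\<close> and is therefore killed by \<open>z\<close>.\<close>
    let ?u = "\<lambda>j. (if j = t0 then z else \<zero>) \<odot>\<^bsub>P (Suc (Suc 0))\<^esub> p"
    have uLP: "?u \<in> LP R L' (P (Suc (Suc 0)))"
      by (rule LP_single[OF module_P A2 A4[OF z t0] p])
    have "d (Suc 0) (z \<odot>\<^bsub>P (Suc (Suc 0))\<^esub> p) = z \<odot>\<^bsub>P (Suc 0)\<^esub> f1 (?e2 e)"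
      using module_homD(3)[OF d1 zR p] f2(2)[OF e(1)] by (simp add: p_def)
    also have "\<dots> = f1 (z \<odot>\<^bsub>?F1\<^esub> ?e2 e)" using module_homD(3)[OF f1(1) zR e2e] by simp
    also have "\<dots> = \<zero>\<^bsub>P (Suc 0)\<^esub>" unfolding ze by (rule module_hom_zero[OF module_free module_P f1(1)])
    finally have "\<forall>j. d (Suc 0) (?u j) = \<zero>\<^bsub>P (Suc 0)\<^esub>"
      using p module_hom_zero[OF module_P module_P d1] by simp
    with bspec[OF ex[unfolded exact_at_def One_nat_def] uLP]
    have "\<exists>u'\<in>LP R L' (P (Suc (Suc (Suc 0)))). \<forall>j. ?u j = d (Suc (Suc 0)) (u' j)" by (rule mp)
    then obtain u' where u': "u' \<in> LP R L' (P (Suc (Suc (Suc 0))))" "\<And>j. ?u j = d (Suc (Suc 0)) (u' j)"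
      by (elim bexE) (rule that, auto)
    let ?c = "\<lambda>x. g2 (d (Suc (Suc 0)) x)"
    have ch: "?c \<in> Hom (P (Suc (Suc (Suc 0)))) ?F2" by (rule module_hom_comp[OF d2 g2(1)])
    have cmx: "?c x t \<in> mx" if x: "x \<in> carrier (P (Suc (Suc (Suc 0))))" for x t
    proof (rule min2[OF module_homD(1)[OF ch x]])
      show "?e2 (?c x) = (\<lambda>_. \<zero>)"
        using g2(2)[OF module_homD(1)[OF d2 x]] d_d[OF x] module_hom_zero[OF module_P module_free g1(1)] by simp
    qed
    \<comment> \<open>Each of the two factors contributes one element of \<open>mx\<close>: the
      entries of \<open>L'\<close> lie in \<open>mx\<close>, and \<open>?c\<close> maps into the
      kernel of \<open>?e2\<close>, whose vectors have coordinates in \<open>mx\<close>.\<close>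
    have cQ: "?c (u' t0) b \<in> Q" using u'(1)
    proof induction
      case LP_zero
      show ?case using module_hom_zero[OF module_P module_free ch] by simp
    next
      case (LP_step l x w)
      have wc: "w t0 \<in> carrier (P (Suc (Suc (Suc 0))))" by (rule LP_closed[OF module_P A2 LP_step(3)])
      have lR: "l t0 \<in> carrier R" using A3[OF LP_step(1)] by (rule mx.Icarr)
      have "?c (l t0 \<odot>\<^bsub>P (Suc (Suc (Suc 0)))\<^esub> x \<oplus>\<^bsub>P (Suc (Suc (Suc 0)))\<^esub> w t0) b = l t0 \<otimes> ?c x b \<oplus> ?c (w t0) b"
        using module_homD(2)[OF ch P3.smult_closed[OF lR LP_step(2)] wc] module_homD(3)[OF ch lR LP_step(2)] by simp
      then show ?case using Q(2)[OF A3[OF LP_step(1)] cmx[OF LP_step(2)]] LP_step(4) by simp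
    qed
    have "?c (u' t0) = g2 (z \<odot>\<^bsub>P (Suc (Suc 0))\<^esub> p)"
      using u'(2)[of t0] by simp
    then have zg: "?c (u' t0) = (\<lambda>x. z \<otimes> g2 p x)"
      using module_homD(3)[OF g2(1) zR p] by simp
    have 1: "z \<otimes> g2 p b \<in> Q" using cQ unfolding zg .
    \<comment> \<open>By the homotopy \<open>z g2 p\<close> is the sum of \<open>z e\<close>,
      \<open>z h1 (?e2 e)\<close> and \<open>z ?ge\<close>. The second vanishes since
      \<open>z\<close> kills \<open>?e2 e\<close>, and the third lies in \<open>Q\<close> at
      \<open>b\<close>. So \<open>z\<close> times the unit \<open>e b\<close> lies in
      \<open>Q\<close>.\<close>
    have 2: "z \<otimes> ?ge b \<in> Q" by (rule Q(2)[OF J_mx[OF z] min2[OF gec ge]])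
    have "z \<odot>\<^bsub>?F2\<^esub> h1 (?e2 e) = \<zero>\<^bsub>?F2\<^esub>"
      using module_homD(3)[OF h1(1) zR e2e] module_hom_zero[OF module_free module_free h1(1)] unfolding ze by simp
    then have zh: "z \<otimes> h1 (?e2 e) b = \<zero>" by (auto dest: fun_cong[of _ _ b])
    have cR: "g2 p b \<in> carrier R" "e b \<in> carrier R" "h1 (?e2 e) b \<in> carrier R"
      using free_closed[OF gc2[OF p]] free_closed[OF e(1)] free_closed[OF hc1[OF e2e]] by auto
    have "?ge b = (g2 p b \<ominus> e b) \<ominus> h1 (?e2 e) b"
      using fun_cong[OF free_minus[OF F2.minus_closed[OF gc2[OF p] e(1)] hc1[OF e2e]], of b]
        fun_cong[OF free_minus[OF gc2[OF p] e(1)], of b] by simp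
    then have "z \<otimes> ?ge b = z \<otimes> g2 p b \<ominus> z \<otimes> e b"
      using zR cR zh by (simp add: minus_eq r_distr r_minus)
    then have "z \<otimes> e b = z \<otimes> g2 p b \<ominus> z \<otimes> ?ge b"
      using zR cR by (simp add: minus_eq minus_add r_neg r_neg1 r_neg2 a_ac)
    then have "z \<otimes> e b \<in> Q" using 1 2 by (simp add: minus_eq)
    then have "(z \<otimes> e b) \<otimes> inv (e b) \<in> Q" by (rule Q.I_r_closed[OF _ Units_inv_closed[OF u]])
    then show "z \<in> Q" using u zR cR by (simp add: m_assoc)
  qed
  then show False by (rule J_not_in_square)
qed

end

section \<open>Combining the two parities\<close>

context split_local_ring
begin

lemma nz_exact_parts:
  assumes "split_complex R I J P d" and pres: "min_pres N B0 y B1 G" and L: "L = Ker B1 B0 G"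
    and nz: "{l \<in> L. \<forall>j. l j \<in> I} \<noteq> {\<lambda>_. \<zero>}"
    and ex: "exact_at R P d m (L :: ('x \<Rightarrow> 'a) set)"
  shows "split_complex.nz_exact R P d TYPE('x) I m"
proof -
  interpret split_complex R I J P d by fact
  have sub: "submodule L R (Free B1)" unfolding L by (rule submodule_Ker[OF min_presD(5)[OF pres]])
  have "exact_at R P d m {l \<in> L. \<forall>j. l j \<in> I}"
  proof (rule exact_at_part[OF ideal_I ideal_J Int_IJ submodule_free_subset[OF sub] _ ex])
    fix l assume l: "l \<in> L"
    show "\<exists>f\<in>L. \<exists>g\<in>L. \<forall>j. f j \<in> I \<and> g j \<in> J \<and> l j = f j \<oplus> g j"
      using min_pres_splits[OF pres] l unfolding L .
  qed
  moreover have "\<forall>l\<in>{l \<in> L. \<forall>j. l j \<in> I}. \<forall>j. l j \<in> I" by simp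
  ultimately show ?thesis unfolding nz_exact_def
    by (intro exI[of _ B1] exI[of _ "{l \<in> L. \<forall>j. l j \<in> I}"] conjI min_presD(4)[OF pres] nz submodule_free_ideal_part[OF ideal_I sub])
qed

theorem Tor_rigidity:
  fixes M :: "('a, 'm) module" and N :: "('a, 'n) module"
  assumes M: "module R M" and fgM: "finitely_generated R M"
    and N: "module R N" and fgN: "finitely_generated R N"
    and ij: "i \<ge> 2" "j \<ge> 3"
    and Tor: "zero_module (Tor R (2 * i + 1) M N)" "zero_module (Tor R (2 * j) M N)"
  shows "proj_dim R M \<le> 1 \<or> proj_dim R N \<le> 1"
proof (rule disjCI)
  assume pdN: "\<not> proj_dim R N \<le> 1"
  have infM: "infinite (UNIV :: ('m \<times> 'a) list set)" and infN: "infinite (UNIV :: ('n \<times> 'a) list set)"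
    by (rule infinite_UNIV_listI)+
  obtain A0 :: "('n \<times> 'a) list set" and y and A1 :: "('n \<times> 'a) list set" and G
    where presN: "min_pres N A0 y A1 G" using ex_min_pres[OF N fgN infN] by (elim exE)
  obtain B0 :: "('m \<times> 'a) list set" and x and B1 :: "('m \<times> 'a) list set" and H
    where presM: "min_pres M B0 x B1 H" using ex_min_pres[OF M fgM infM] by (elim exE)
  note pN = min_presD[OF presN] and pM = min_presD[OF presM]
  let ?L0 = "{v \<in> Vec A0. lin R N y v = \<zero>\<^bsub>N\<^esub>}" and ?L1 = "Ker A1 A0 G" and ?K = "Ker B1 B0 H"
  \<comment> \<open>Otherwise the minimal presentation would be a resolution of \<open>N\<close> of
    length one.\<close>
  have L1: "?L1 \<noteq> {\<lambda>_. \<zero>}" using min_pres_proj_dim[OF N presN] pdN by argo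

  obtain P :: "nat \<Rightarrow> ('a, ('a, 'm) resolution_element) module" and d \<epsilon>
    where res: "projective_resolution R M P d \<epsilon>"
    and van: "\<And>n Z. zero_module (Tor R (Suc n) M N) \<Longrightarrow> Z \<in> carrier (tensor_module R (P (Suc n)) N) \<Longrightarrow>
      tensor_map R (P (Suc n)) (P n) N (d n) Z = \<zero>\<^bsub>tensor_module R (P n) N\<^esub> \<Longrightarrow>
      \<exists>Y\<in>carrier (tensor_module R (P (Suc (Suc n))) N).
        Z = tensor_map R (P (Suc (Suc n))) (P (Suc n)) N (d (Suc n)) Y"
    apply (rule Tor_vanishing[OF M fgM N])
    subgoal premises p by (rule p(1)[OF p(2) p(3)])
    done
  have "projective_complex R P d"
    by (intro projective_complex.intro projective_complex_axioms.intro is_cring)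
      (use res in \<open>auto simp: projective_resolution_def\<close>)
  then interpret split_complex R I J P d
    by (intro split_complex.intro split_complex_axioms.intro split_local_ring_axioms)
  interpret sw: split_complex R J I P d by (rule swap_complex)
  have sw_pres: "sw.min_pres V B0 y B1 G = min_pres V B0 y B1 G"
    for V :: "('a, 'z) module" and B0 :: "'x set" and y and B1 :: "'y set" and G
    unfolding min_pres_def sw.min_pres_def mx_swap ..

  \<comment> \<open>The offset is three: \<open>exact_at\<close> in index \<open>m\<close> expresses
    vanishing of \<open>Tor\<close> in degree \<open>m + 1\<close> against the second syzygy, and
    the two syzygies of \<open>N\<close> account for two more degrees.\<close>
  have ex: "exact_at R P d m ?L1" if "zero_module (Tor R (Suc (Suc (Suc m))) M N)" for m
  proof (rule exact_at_shift[OF pN(4,5)])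
    have "exact_at R P d (Suc m) ?L0"
      by (rule exact_at_of_tensor[OF N van[OF that] pN(1-3)])
    then show "exact_at R P d (Suc m) (lin R (Free A0) G ` Vec A1)"
      unfolding pN(6) .
  qed
  \<comment> \<open>The indices are written as 2 or 3 plus an even number:
    \<open>nz_exact_down\<close> removes the even part without changing the ideal, and one more step
    from 3 to 2 exchanges it.\<close>
  have "2 * i + 1 = Suc (Suc (Suc (2 + 2 * (i - 2))))" "2 * j = Suc (Suc (Suc (3 + 2 * (j - 3))))" using ij by auto
  then have ex_even: "exact_at R P d (2 + 2 * (i - 2)) ?L1" and ex_odd: "exact_at R P d (3 + 2 * (j - 3)) ?L1"
    using ex[of "2 + 2 * (i - 2)"] ex[of "3 + 2 * (j - 3)"] Tor by simp_all
  have nz: "nz_exact TYPE(('n \<times> 'a) list) I 2 \<and> nz_exact TYPE(('n \<times> 'a) list) J 2"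
  \<comment> \<open>At least one of the two parts of the second syzygy of \<open>N\<close> is
    nonzero. Whichever it is, the even index yields its own ideal and the odd index the other
    one.\<close>
  proof (cases "{l \<in> ?L1. \<forall>j. l j \<in> I} = {\<lambda>_. \<zero>}")
    case False
    note nz = nz_exact_parts[OF split_complex_axioms presN refl False]
    have "nz_exact TYPE(('n \<times> 'a) list) I 2" by (rule nz_exact_down(1)[OF infN nz[OF ex_even]])
    moreover have "nz_exact TYPE(('n \<times> 'a) list) J 2"
      by (rule nz_exact_step[OF infN]) (use nz_exact_down(1)[OF infN nz[OF ex_odd]] in \<open>simp add: numeral_3_eq_3 numeral_2_eq_2\<close>)
    ultimately show ?thesis by simp
  next
    case True
    have "{l \<in> ?L1. \<forall>j. l j \<in> J} \<noteq> {\<lambda>_. \<zero>}"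
    proof
      assume J0: "{l \<in> ?L1. \<forall>j. l j \<in> J} = {\<lambda>_. \<zero>}"
      have "l = (\<lambda>_. \<zero>)" if l: "l \<in> ?L1" for l
      proof -
        have "\<exists>f\<in>?L1. \<exists>g\<in>?L1. \<forall>t. f t \<in> I \<and> g t \<in> J \<and> l t = f t \<oplus> g t"
          by (rule min_pres_splits[OF presN l])
        then obtain f g where "f \<in> ?L1" "g \<in> ?L1" and fg: "\<forall>t. f t \<in> I \<and> g t \<in> J \<and> l t = f t \<oplus> g t"
          by (elim bexE)
        then have "f \<in> {l \<in> ?L1. \<forall>j. l j \<in> I}" "g \<in> {l \<in> ?L1. \<forall>j. l j \<in> J}" by simp_all
        then have "f = (\<lambda>_. \<zero>)" "g = (\<lambda>_. \<zero>)" unfolding True J0 by simp_all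
        then show ?thesis using fg by auto
      qed
      moreover have "(\<lambda>_. \<zero>) \<in> ?L1"
        using submodule_zero_closed[OF module_free submodule_Ker[OF pN(5)]] by simp
      ultimately show False using L1 by blast
    qed
    note nz = sw.nz_exact_parts[unfolded sw_pres, OF sw.split_complex_axioms presN refl this]
    have "nz_exact TYPE(('n \<times> 'a) list) J 2" by (rule nz_exact_down(2)[OF infN nz[OF ex_even]])
    moreover have "nz_exact TYPE(('n \<times> 'a) list) I 2"
      by (rule nz_exact_step'[OF infN]) (use nz_exact_down(2)[OF infN nz[OF ex_odd]] in \<open>simp add: numeral_3_eq_3 numeral_2_eq_2\<close>)
    ultimately show ?thesis by simp
  qed
  have "v = (\<lambda>_. \<zero>)" if v: "v \<in> ?K" for v
  proof -
    have "\<exists>f\<in>?K. \<exists>g\<in>?K. \<forall>t. f t \<in> I \<and> g t \<in> J \<and> v t = f t \<oplus> g t"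
      by (rule min_pres_splits[OF presM v])
    then obtain f g where f: "f \<in> ?K" and g: "g \<in> ?K" and fg: "\<forall>t. f t \<in> I \<and> g t \<in> J \<and> v t = f t \<oplus> g t"
      by (elim bexE)
    have fI: "f b \<in> I" and gJ: "g b \<in> J" for b using fg by simp_all
    have "f = (\<lambda>_. \<zero>)"
      by (rule syzygy_part_zero[OF infM infN conjunct1[OF nz] M res presM f fI])
    moreover have "g = (\<lambda>_. \<zero>)"
      by (rule sw.syzygy_part_zero[unfolded sw_pres, OF infM infN conjunct2[OF nz] M res presM g gJ])
    ultimately show ?thesis using fg by auto
  qed
  moreover have "(\<lambda>_. \<zero>) \<in> ?K"
    using submodule_zero_closed[OF module_free submodule_Ker[OF pM(5)]] by simp
  ultimately have "?K = {\<lambda>_. \<zero>}" by blast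
  then show "proj_dim R M \<le> 1" by (rule min_pres_proj_dim[OF M presM])
qed

end

subsection \<open>Fiber products of local rings\<close>

text \<open>Zorn's lemma; a nonempty chain of ideals contains its own union because the ring is
  Noetherian.\<close>

lemma (in noetherian_ring) exists_maximalideal:
  assumes "ideal K R" "\<one> \<notin> K"
  obtains K' where "maximalideal K' R" "K \<subseteq> K'"
proof -
  let ?A = "{K'. ideal K' R \<and> K \<subseteq> K' \<and> \<one> \<notin> K'}"
  have "\<exists>K'\<in>?A. \<forall>K''\<in>?A. K' \<subseteq> K'' \<longrightarrow> K'' = K'"
  proof (rule subset_Zorn_nonempty)
    fix C assume C: "C \<noteq> {}" "subset.chain ?A C"
    then have "subset.chain {K'. ideal K' R} C" unfolding pred_on.chain_def by blast
    from ideal_chain_is_trivial[OF C(1) this] show "\<Union>C \<in> ?A" using C(2) unfolding pred_on.chain_def by blast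
  qed (use assms in blast)
  then obtain K' where K'A: "K' \<in> ?A" and max: "\<forall>K''\<in>?A. K' \<subseteq> K'' \<longrightarrow> K'' = K'" by (rule bexE)
  then have K': "ideal K' R" "K \<subseteq> K'" "\<one> \<notin> K'" by simp_all
  have "maximalideal K' R"
  proof (rule maximalidealI[OF K'(1)])
    show "carrier R \<noteq> K'" using K'(3) by auto
    fix D assume D: "ideal D R" "K' \<subseteq> D" "D \<subseteq> carrier R"
    show "D = K' \<or> D = carrier R"
    proof (cases "\<one> \<in> D")
      case True
      then show ?thesis using ideal.one_imp_carrier[OF D(1)] by simp
    next
      case False
      then have "D \<in> ?A" using D K'(2) by simp
      then have "D = K'" using max D(2) by simp
      then show ?thesis by simp
    qed
  qed
  then show thesis using that K'(2) by blast
qed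

lemma (in local_ring) nonunit_in_maximal:
  assumes "x \<in> carrier R" "x \<notin> Units R"
  shows "x \<in> \<mm>"
proof -
  have "\<one> \<notin> PIdl x"
  proof
    assume "\<one> \<in> PIdl x"
    then obtain y where "y \<in> carrier R" "\<one> = y \<otimes> x" unfolding cgenideal_def by auto
    then have "x \<in> Units R" using assms(1) m_comm unfolding Units_def by auto
    then show False using assms(2) by simp
  qed
  then obtain K where K: "maximalideal K R" "PIdl x \<subseteq> K"
    using exists_maximalideal[OF cgenideal_ideal[OF assms(1)]] by blast
  then have "K = \<mm>" using unique by blast
  then show ?thesis using K(2) cgenideal_self[OF assms(1)] by blast
qed

lemma (in local_ring) maximal_no_units:
  assumes "x \<in> \<mm>" shows "x \<notin> Units R"
proof
  assume u: "x \<in> Units R"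
  interpret maximalideal \<mm> R by (rule maximal)
  have "\<one> \<in> \<mm>" using I_r_closed[OF assms, of "inv x"] u by simp
  then show False using one_imp_carrier I_notcarr by simp
qed

locale residue_fiber_product = S: local_ring S \<mm> + T: local_ring T \<nn> + k: field k
  for S :: "('s, 'c) ring_scheme" and \<mm> and T :: "('t, 'd) ring_scheme" and \<nn> and k :: "('k, 'e) ring_scheme" +
  fixes \<pi>S :: "'s \<Rightarrow> 'k" and \<pi>T :: "'t \<Rightarrow> 'k"
  assumes \<pi>S: "residue_map S \<mm> k \<pi>S" and \<pi>T: "residue_map T \<nn> k \<pi>T"
begin

abbreviation "FP \<equiv> fiber_product S T \<pi>S \<pi>T"

lemma FP_simps [simp]:
  "carrier FP = {(s, t). s \<in> carrier S \<and> t \<in> carrier T \<and> \<pi>S s = \<pi>T t}"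
  "(s, t) \<oplus>\<^bsub>FP\<^esub> (s', t') = (s \<oplus>\<^bsub>S\<^esub> s', t \<oplus>\<^bsub>T\<^esub> t')"
  "(s, t) \<otimes>\<^bsub>FP\<^esub> (s', t') = (s \<otimes>\<^bsub>S\<^esub> s', t \<otimes>\<^bsub>T\<^esub> t')"
  "\<zero>\<^bsub>FP\<^esub> = (\<zero>\<^bsub>S\<^esub>, \<zero>\<^bsub>T\<^esub>)" "\<one>\<^bsub>FP\<^esub> = (\<one>\<^bsub>S\<^esub>, \<one>\<^bsub>T\<^esub>)"
  by (simp_all add: fiber_product_def RDirProd_def DirProd_def monoid.defs)

sublocale hS: ring_hom_ring S k \<pi>S
  using \<pi>S unfolding residue_map_def by (intro ring_hom_ringI2 S.ring_axioms k.ring_axioms) auto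

sublocale hT: ring_hom_ring T k \<pi>T
  using \<pi>T unfolding residue_map_def by (intro ring_hom_ringI2 T.ring_axioms k.ring_axioms) auto

lemma surj: "\<pi>S ` carrier S = carrier k" "\<pi>T ` carrier T = carrier k"
  using \<pi>S \<pi>T unfolding residue_map_def by auto

lemma kernel: "\<mm> = {s \<in> carrier S. \<pi>S s = \<zero>\<^bsub>k\<^esub>}" "\<nn> = {t \<in> carrier T. \<pi>T t = \<zero>\<^bsub>k\<^esub>}"
  using \<pi>S unfolding residue_map_def a_kernel_def' apply (elim conjE) apply (rule sym) apply assumption
  using \<pi>T unfolding residue_map_def a_kernel_def' apply (elim conjE) apply (rule sym) apply assumption
  done

lemma lift_S: "s \<in> carrier S \<Longrightarrow> \<exists>t\<in>carrier T. \<pi>S s = \<pi>T t"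
  using surj hS.hom_closed by (metis imageE)

lemma lift_T: "t \<in> carrier T \<Longrightarrow> \<exists>s\<in>carrier S. \<pi>S s = \<pi>T t"
  using surj hT.hom_closed by (metis imageE)

lemma cring_FP: "cring FP"
proof (rule cringI)
  show "abelian_group FP"
  proof (rule abelian_groupI)
    fix x assume "x \<in> carrier FP"
    then obtain s t where "x = (s, t)" "s \<in> carrier S" "t \<in> carrier T" "\<pi>S s = \<pi>T t" by auto
    then show "\<exists>y\<in>carrier FP. y \<oplus>\<^bsub>FP\<^esub> x = \<zero>\<^bsub>FP\<^esub>"
      by (intro bexI[of _ "(\<ominus>\<^bsub>S\<^esub> s, \<ominus>\<^bsub>T\<^esub> t)"]) (auto simp: S.l_neg T.l_neg)
  qed (auto simp: S.a_ac T.a_ac)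
  show "comm_monoid FP"
    by (rule comm_monoidI) (auto simp: S.m_ac T.m_ac)
qed (auto simp: S.l_distr T.l_distr)

sublocale FP: cring FP by (rule cring_FP)

lemma FP_minus: "(s, t) \<in> carrier FP \<Longrightarrow> \<ominus>\<^bsub>FP\<^esub> (s, t) = (\<ominus>\<^bsub>S\<^esub> s, \<ominus>\<^bsub>T\<^esub> t)"
  by (rule FP.minus_equality) (auto simp: S.l_neg T.l_neg)

text \<open>Stability under all of \<open>S\<close> comes from the surjectivity of the projection of
  \<open>FP\<close> to \<open>S\<close>, provided by \<open>lift_S\<close>.\<close>

lemma ideal_fst:
  assumes "ideal K FP"
  shows "ideal (fst ` K) S"
proof (rule idealI)
  interpret K: ideal K FP by fact
  show "subgroup (fst ` K) (add_monoid S)"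
  proof (rule S.add.subgroupI)
    have ne: "x \<in> A \<Longrightarrow> A \<noteq> {}" for x :: 's and A by (rule notI) simp
    have "fst x \<in> carrier S" if "x \<in> K" for x using K.Icarr[OF that] by (cases x) simp
    then show "fst ` K \<subseteq> carrier S" by (rule image_subsetI)
    have "fst \<zero>\<^bsub>FP\<^esub> \<in> fst ` K" by (rule imageI[OF K.zero_closed])
    then show "fst ` K \<noteq> {}" by (rule ne)
    fix a assume "a \<in> fst ` K"
    then obtain t where at: "(a, t) \<in> K" by auto
    then have "\<ominus>\<^bsub>FP\<^esub> (a, t) \<in> K" by simp
    then show "\<ominus>\<^bsub>S\<^esub> a \<in> fst ` K" using FP_minus[OF K.Icarr[OF at]] by (metis fst_conv imageI)
    fix b assume "b \<in> fst ` K"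
    then obtain u where "(b, u) \<in> K" by auto
    then have "(a, t) \<oplus>\<^bsub>FP\<^esub> (b, u) \<in> K" using at K.a_closed by blast
    then show "a \<oplus>\<^bsub>S\<^esub> b \<in> fst ` K" by (metis FP_simps(2) fst_conv imageI)
  qed
  fix a x assume "a \<in> fst ` K" and x: "x \<in> carrier S"
  then obtain t where at: "(a, t) \<in> K" by auto
  obtain u where "u \<in> carrier T" "\<pi>S x = \<pi>T u" using lift_S[OF x] by blast
  then have xu: "(x, u) \<in> carrier FP" using x by simp
  show "x \<otimes>\<^bsub>S\<^esub> a \<in> fst ` K" using K.I_l_closed[OF at xu] by (metis FP_simps(3) fst_conv imageI)
  show "a \<otimes>\<^bsub>S\<^esub> x \<in> fst ` K" using K.I_r_closed[OF at xu] by (metis FP_simps(3) fst_conv imageI)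
qed (rule S.ring_axioms)

lemma ideal_snd:
  assumes "ideal K FP"
  shows "ideal {t. (\<zero>\<^bsub>S\<^esub>, t) \<in> K} T"
proof (rule idealI)
  interpret K: ideal K FP by fact
  show "subgroup {t. (\<zero>\<^bsub>S\<^esub>, t) \<in> K} (add_monoid T)"
  proof (rule T.add.subgroupI)
    show "{t. (\<zero>\<^bsub>S\<^esub>, t) \<in> K} \<subseteq> carrier T" using K.Icarr by fastforce
    show "{t. (\<zero>\<^bsub>S\<^esub>, t) \<in> K} \<noteq> {}" using K.zero_closed by auto
    fix a assume a: "a \<in> {t. (\<zero>\<^bsub>S\<^esub>, t) \<in> K}"
    then have "\<ominus>\<^bsub>FP\<^esub> (\<zero>\<^bsub>S\<^esub>, a) \<in> K" by simp
    then show "\<ominus>\<^bsub>T\<^esub> a \<in> {t. (\<zero>\<^bsub>S\<^esub>, t) \<in> K}" using FP_minus[of "\<zero>\<^bsub>S\<^esub>" a] K.Icarr a by fastforce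
    fix b assume b: "b \<in> {t. (\<zero>\<^bsub>S\<^esub>, t) \<in> K}"
    have "(\<zero>\<^bsub>S\<^esub>, a) \<oplus>\<^bsub>FP\<^esub> (\<zero>\<^bsub>S\<^esub>, b) \<in> K" by (rule K.a_closed) (use a b in auto)
    then show "a \<oplus>\<^bsub>T\<^esub> b \<in> {t. (\<zero>\<^bsub>S\<^esub>, t) \<in> K}" by simp
  qed
  fix a x assume a: "a \<in> {t. (\<zero>\<^bsub>S\<^esub>, t) \<in> K}" and x: "x \<in> carrier T"
  obtain u where u: "u \<in> carrier S" "\<pi>S u = \<pi>T x" using lift_T[OF x] by blast
  then have ux: "(u, x) \<in> carrier FP" using x by simp
  have aK: "(\<zero>\<^bsub>S\<^esub>, a) \<in> K" using a by simp
  show "x \<otimes>\<^bsub>T\<^esub> a \<in> {t. (\<zero>\<^bsub>S\<^esub>, t) \<in> K}" using K.I_l_closed[OF aK ux] u by simp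
  show "a \<otimes>\<^bsub>T\<^esub> x \<in> {t. (\<zero>\<^bsub>S\<^esub>, t) \<in> K}" using K.I_r_closed[OF aK ux] u by simp
qed (rule T.ring_axioms)

text \<open>An ideal \<open>K\<close> is controlled by its projection to \<open>S\<close> and by its
  elements with first component zero, which form an ideal of \<open>T\<close>. Lifts of generators
  of the former together with generators of the latter generate \<open>K\<close>.\<close>

lemma noetherian_FP: "noetherian_ring FP"
proof (rule FP.noetherian_ringI)
  fix K assume K: "ideal K FP"
  interpret K: ideal K FP by fact
  obtain A1 where A1: "A1 \<subseteq> carrier S" "finite A1" "fst ` K = Idl\<^bsub>S\<^esub> A1"
    using S.finetely_gen[OF ideal_fst[OF K]] by blast
  have "A1 \<subseteq> fst ` K" using S.genideal_self[OF A1(1)] A1(3) by simp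
  from finite_subset_image[OF A1(2) this]
  obtain A2 where A2: "A2 \<subseteq> K" "finite A2" "A1 = fst ` A2" by (elim exE conjE) (rule that, auto)
  obtain B where B: "B \<subseteq> carrier T" "finite B" "{t. (\<zero>\<^bsub>S\<^esub>, t) \<in> K} = Idl\<^bsub>T\<^esub> B"
    using T.finetely_gen[OF ideal_snd[OF K]] by blast
  let ?A = "A2 \<union> Pair \<zero>\<^bsub>S\<^esub> ` B"
  have BK: "Pair \<zero>\<^bsub>S\<^esub> ` B \<subseteq> K" using T.genideal_self[OF B(1)] B(3) by blast
  have AK: "?A \<subseteq> K" using A2(1) BK by blast
  have AF: "?A \<subseteq> carrier FP" using AK K.a_subset by blast
  let ?D = "Idl\<^bsub>FP\<^esub> ?A"
  have D: "ideal ?D FP" by (rule FP.genideal_ideal[OF AF])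
  interpret D: ideal ?D FP by (rule D)
  have AD: "?A \<subseteq> ?D" by (rule FP.genideal_self[OF AF])
  have DK: "?D \<subseteq> K" by (rule FP.genideal_minimal[OF K AK])
  have 1: "fst ` K \<subseteq> fst ` ?D"
    unfolding A1(3) by (rule S.genideal_minimal[OF ideal_fst[OF D]]) (use A2(3) AD in blast)
  have 2: "{t. (\<zero>\<^bsub>S\<^esub>, t) \<in> K} \<subseteq> {t. (\<zero>\<^bsub>S\<^esub>, t) \<in> ?D}"
    unfolding B(3) by (rule T.genideal_minimal[OF ideal_snd[OF D]]) (use AD in blast)
  have "K \<subseteq> ?D"
  proof
    fix x assume x: "x \<in> K"
    then have "fst x \<in> fst ` ?D" using 1 by blast
    then obtain w where w: "w \<in> ?D" "fst x = fst w" by auto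
    obtain s t u where xw: "x = (s, t)" "w = (s, u)" using w(2) by (cases x; cases w) auto
    have c: "(s, t) \<in> carrier FP" "(s, u) \<in> carrier FP" using x w(1) xw K.Icarr D.Icarr by blast+
    have xw_eq: "x \<ominus>\<^bsub>FP\<^esub> w = (\<zero>\<^bsub>S\<^esub>, t \<ominus>\<^bsub>T\<^esub> u)"
      using FP_minus[OF c(2)] c by (simp add: xw FP.minus_eq T.minus_eq S.r_neg)
    have "\<ominus>\<^bsub>FP\<^esub> w \<in> K" using w(1) DK by blast
    then have "x \<ominus>\<^bsub>FP\<^esub> w \<in> K" using x by (simp add: FP.minus_eq)
    then have "x \<ominus>\<^bsub>FP\<^esub> w \<in> ?D" using 2 unfolding xw_eq by blast
    then have "(x \<ominus>\<^bsub>FP\<^esub> w) \<oplus>\<^bsub>FP\<^esub> w \<in> ?D" using w(1) by simp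
    then show "x \<in> ?D" using FP.minus_add_cancel[OF c] unfolding xw by simp
  qed
  then have "K = ?D" using DK by blast
  moreover have "finite ?A" using A2(2) B(2) by blast
  ultimately show "\<exists>A\<subseteq>carrier FP. finite A \<and> K = Idl\<^bsub>FP\<^esub> A" using AF by blast
qed

text \<open>A nonzero residue puts both components outside the maximal ideals, so both are units.
  The pair of inverses belongs to \<open>FP\<close> because both residues invert the same element of
  \<open>k\<close>.\<close>

lemma Unit_FP:
  assumes st: "(s, t) \<in> carrier FP" and "\<pi>S s \<noteq> \<zero>\<^bsub>k\<^esub>"
  shows "(s, t) \<in> Units FP"
proof -
  have c: "s \<in> carrier S" "t \<in> carrier T" "\<pi>S s = \<pi>T t" using st by auto
  have s: "s \<in> Units S" using S.nonunit_in_maximal[OF c(1)] kernel(1) assms(2) by auto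
  have t: "t \<in> Units T" using T.nonunit_in_maximal[OF c(2)] kernel(2) assms(2) c(3) by auto
  have "\<pi>S (inv\<^bsub>S\<^esub> s) = inv\<^bsub>k\<^esub> (\<pi>S s)"
    using hS.hom_mult[of s "inv\<^bsub>S\<^esub> s"] s c by (intro k.comm_inv_char[symmetric]) simp_all
  moreover have "\<pi>T (inv\<^bsub>T\<^esub> t) = inv\<^bsub>k\<^esub> (\<pi>T t)"
    using hT.hom_mult[of t "inv\<^bsub>T\<^esub> t"] t c by (intro k.comm_inv_char[symmetric]) simp_all
  ultimately have "(inv\<^bsub>S\<^esub> s, inv\<^bsub>T\<^esub> t) \<in> carrier FP" using s t c by simp
  moreover have "(inv\<^bsub>S\<^esub> s, inv\<^bsub>T\<^esub> t) \<otimes>\<^bsub>FP\<^esub> (s, t) = \<one>\<^bsub>FP\<^esub>" "(s, t) \<otimes>\<^bsub>FP\<^esub> (inv\<^bsub>S\<^esub> s, inv\<^bsub>T\<^esub> t) = \<one>\<^bsub>FP\<^esub>"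
    using s t by simp_all
  ultimately show ?thesis using st unfolding Units_def by blast
qed

lemma ideal_zero_snd: "ideal {(s, t). s \<in> \<mm> \<and> t = \<zero>\<^bsub>T\<^esub>} FP"
proof (rule idealI)
  show "subgroup {(s, t). s \<in> \<mm> \<and> t = \<zero>\<^bsub>T\<^esub>} (add_monoid FP)"
  proof (rule FP.add.subgroupI)
    have "(\<zero>\<^bsub>S\<^esub>, \<zero>\<^bsub>T\<^esub>) \<in> {(s, t). s \<in> \<mm> \<and> t = \<zero>\<^bsub>T\<^esub>}" by (simp add: kernel)
    then show "{(s, t). s \<in> \<mm> \<and> t = \<zero>\<^bsub>T\<^esub>} \<noteq> {}" by blast
    fix x assume "x \<in> {(s, t). s \<in> \<mm> \<and> t = \<zero>\<^bsub>T\<^esub>}"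
    then obtain s where s: "x = (s, \<zero>\<^bsub>T\<^esub>)" "s \<in> carrier S" "\<pi>S s = \<zero>\<^bsub>k\<^esub>" unfolding kernel by auto
    then show "\<ominus>\<^bsub>FP\<^esub> x \<in> {(s, t). s \<in> \<mm> \<and> t = \<zero>\<^bsub>T\<^esub>}" using FP_minus[of s "\<zero>\<^bsub>T\<^esub>"] by (simp add: kernel)
  qed (auto simp: kernel)
qed (auto simp: kernel FP.ring_axioms)

lemma ideal_zero_fst: "ideal {(s, t). s = \<zero>\<^bsub>S\<^esub> \<and> t \<in> \<nn>} FP"
proof (rule idealI)
  show "subgroup {(s, t). s = \<zero>\<^bsub>S\<^esub> \<and> t \<in> \<nn>} (add_monoid FP)"
  proof (rule FP.add.subgroupI)
    have "(\<zero>\<^bsub>S\<^esub>, \<zero>\<^bsub>T\<^esub>) \<in> {(s, t). s = \<zero>\<^bsub>S\<^esub> \<and> t \<in> \<nn>}" by (simp add: kernel)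
    then show "{(s, t). s = \<zero>\<^bsub>S\<^esub> \<and> t \<in> \<nn>} \<noteq> {}" by blast
    fix x assume "x \<in> {(s, t). s = \<zero>\<^bsub>S\<^esub> \<and> t \<in> \<nn>}"
    then obtain t where s: "x = (\<zero>\<^bsub>S\<^esub>, t)" "t \<in> carrier T" "\<pi>T t = \<zero>\<^bsub>k\<^esub>" unfolding kernel by auto
    then show "\<ominus>\<^bsub>FP\<^esub> x \<in> {(s, t). s = \<zero>\<^bsub>S\<^esub> \<and> t \<in> \<nn>}" using FP_minus[of "\<zero>\<^bsub>S\<^esub>" t] by (simp add: kernel)
  qed (auto simp: kernel)
qed (auto simp: kernel FP.ring_axioms)

text \<open>The assumptions on \<open>ring_iso\<close> encode that \<open>S\<close> and
  \<open>T\<close> differ from \<open>k\<close>: a residue map with zero kernel would be an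
  isomorphism, so both maximal ideals are nonzero.\<close>

lemma split_FP:
  assumes "\<pi>S \<notin> ring_iso S k" "\<pi>T \<notin> ring_iso T k"
  shows "split_local_ring FP {(s, t). s \<in> \<mm> \<and> t = \<zero>\<^bsub>T\<^esub>} {(s, t). s = \<zero>\<^bsub>S\<^esub> \<and> t \<in> \<nn>}"
    (is "split_local_ring FP ?I ?J")
proof (intro split_local_ring.intro noetherian_cring.intro split_local_ring_axioms.intro)
  show "?I \<inter> ?J = {\<zero>\<^bsub>FP\<^esub>}" by (auto simp: kernel)
  show "\<exists>i\<in>?I. \<exists>j\<in>?J. x = i \<oplus>\<^bsub>FP\<^esub> j" if x: "x \<in> carrier FP" "x \<notin> Units FP" for x
  proof -
    obtain s t where st: "x = (s, t)" "s \<in> carrier S" "t \<in> carrier T" "\<pi>S s = \<pi>T t" using x(1) by auto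
    then have "\<pi>S s = \<zero>\<^bsub>k\<^esub>" using Unit_FP[of s t] x by auto
    then show ?thesis using st
      by (intro bexI[of _ "(s, \<zero>\<^bsub>T\<^esub>)"] bexI[of _ "(\<zero>\<^bsub>S\<^esub>, t)"]) (auto simp: kernel)
  qed
  show "i \<oplus>\<^bsub>FP\<^esub> j \<notin> Units FP" if i: "i \<in> ?I" and j: "j \<in> ?J" for i j
  proof
    assume u: "i \<oplus>\<^bsub>FP\<^esub> j \<in> Units FP"
    obtain s t where st: "i = (s, \<zero>\<^bsub>T\<^esub>)" "j = (\<zero>\<^bsub>S\<^esub>, t)" "s \<in> \<mm>" "t \<in> \<nn>" using i j by auto
    have c: "s \<in> carrier S" "t \<in> carrier T" using st(3,4) unfolding kernel by auto
    obtain y where y: "y \<in> carrier FP" "y \<otimes>\<^bsub>FP\<^esub> (s, t) = \<one>\<^bsub>FP\<^esub>"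
      using u c unfolding Units_def st(1,2) by auto
    obtain s' t' where "y = (s', t')" "s' \<in> carrier S" "s' \<otimes>\<^bsub>S\<^esub> s = \<one>\<^bsub>S\<^esub>" using y by auto
    then have "s \<in> Units S" using c S.m_comm unfolding Units_def by auto
    then show False using S.maximal_no_units[OF st(3)] by simp
  qed
  show "?I \<noteq> {\<zero>\<^bsub>FP\<^esub>}"
  proof
    assume I0: "?I = {\<zero>\<^bsub>FP\<^esub>}"
    have "s = \<zero>\<^bsub>S\<^esub>" if "s \<in> a_kernel S k \<pi>S" for s
    proof -
      have "(s, \<zero>\<^bsub>T\<^esub>) \<in> ?I" using that \<pi>S unfolding residue_map_def by simp
      then show ?thesis unfolding I0 by simp
    qed
    then have "a_kernel S k \<pi>S \<subseteq> {\<zero>\<^bsub>S\<^esub>}" by blast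
    moreover have "\<zero>\<^bsub>S\<^esub> \<in> a_kernel S k \<pi>S" unfolding a_kernel_def' by simp
    ultimately have "a_kernel S k \<pi>S = {\<zero>\<^bsub>S\<^esub>}" by blast
    then have "inj_on \<pi>S (carrier S)" by (rule hS.trivial_ker_imp_inj)
    then have "\<pi>S \<in> ring_iso S k"
      using hS.homh surj(1) by (auto simp: ring_iso_def bij_betw_def)
    then show False using assms(1) by simp
  qed
  show "?J \<noteq> {\<zero>\<^bsub>FP\<^esub>}"
  proof
    assume J0: "?J = {\<zero>\<^bsub>FP\<^esub>}"
    have "t = \<zero>\<^bsub>T\<^esub>" if "t \<in> a_kernel T k \<pi>T" for t
    proof -
      have "(\<zero>\<^bsub>S\<^esub>, t) \<in> ?J" using that \<pi>T unfolding residue_map_def by simp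
      then show ?thesis unfolding J0 by simp
    qed
    then have "a_kernel T k \<pi>T \<subseteq> {\<zero>\<^bsub>T\<^esub>}" by blast
    moreover have "\<zero>\<^bsub>T\<^esub> \<in> a_kernel T k \<pi>T" unfolding a_kernel_def' by simp
    ultimately have "a_kernel T k \<pi>T = {\<zero>\<^bsub>T\<^esub>}" by blast
    then have "inj_on \<pi>T (carrier T)" by (rule hT.trivial_ker_imp_inj)
    then have "\<pi>T \<in> ring_iso T k"
      using hT.homh surj(2) by (auto simp: ring_iso_def bij_betw_def)
    then show False using assms(2) by simp
  qed
qed (rule cring_FP noetherian_FP ideal_zero_snd ideal_zero_fst)+

end

theorem theorem1p18:
  fixes S :: "('s, 'c) ring_scheme" and T :: "('t, 'd) ring_scheme" and k :: "('k, 'e) ring_scheme"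
    and \<pi>S :: "'s \<Rightarrow> 'k" and \<pi>T :: "'t \<Rightarrow> 'k"
    and M :: "('s \<times> 't, 'm) module" and N :: "('s \<times> 't, 'n) module"
    and i j :: nat
  assumes "local_ring S \<mm>" and "local_ring T \<nn>" and "field k"
    and "residue_map S \<mm> k \<pi>S" and "residue_map T \<nn> k \<pi>T"
    and "\<pi>S \<notin> ring_iso S k" and "\<pi>T \<notin> ring_iso T k"
  defines "R \<equiv> fiber_product S T \<pi>S \<pi>T"
  assumes "module R M" and "finitely_generated R M"
    and "module R N" and "finitely_generated R N"
    and "i \<ge> 2" and "j \<ge> 3"
    and "zero_module (Tor R (2 * i + 1) M N)" and "zero_module (Tor R (2 * j) M N)"
  shows "proj_dim R M \<le> 1 \<or> proj_dim R N \<le> 1"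
proof -
  interpret residue_fiber_product S \<mm> T \<nn> k \<pi>S \<pi>T
    using assms by (intro residue_fiber_product.intro residue_fiber_product_axioms.intro)
  show ?thesis
    unfolding R_def
    by (rule split_local_ring.Tor_rigidity[OF split_FP[OF assms(6,7)] assms(9-16)[unfolded R_def]])
qed

end
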